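(* Let $(\mathcal{M},g)$ be a paracompact, connected, pseudo-Riemannian manifold of dimension $n$ and signature $(p,q)$, and let $U\subseteq\mathcal{M}$ be an open subset carrying a local frame of $T\mathcal{M}$. Then the space $\Gamma(U,\bigwedge(T^{*}\mathcal{M}))$ of sections over $U$ of the exterior bundle of $T^{*}\mathcal{M}$, equipped with the Graf product $\diamond$, is a Clifford algebra.
   Context: Let $\{e_1,\dots,e_n\}$ be a local frame of $T\mathcal{M}$ over $U$ and let $\{e^1,\dots,e^n\}$ be the associated coframe of $T^{*}\mathcal{M}$, so that $e^i(e_j)=\delta^i_j 1_\Gamma$, where $1_\Gamma$ is the constant function $1$, the unit element of the exterior algebra of differential forms. Let $g^{*}$ be the metric on $T^{*}\mathcal{M}$ reciprocal to $g$, and write $g^{ij}=g^{*}(e^i,e^j)\in\mathbb{R}$. A $k$-form on $U$ is an element of $\Gamma(U,\bigwedge^k(T^{*}\mathcal{M}))$. For a frame vector $e_i$, $e_i\rfloor$ denotes the contraction (interior product) on forms, which is linear, maps $k$-forms to $(k-1)$-forms (and $0$-forms to $0$), and satisfies $e_i\rfloor e^j=\delta_i^j 1_\Gamma$ and $e_i\rfloor(\alpha\wedge\beta)=(e_i\rfloor\alpha)\wedge\beta+(-1)^{k}\alpha\wedge(e_i\rfloor\beta)$ for a $k$-form $\alpha$ and a form $\beta$. The contracted wedge product of order $l$ of two forms $f_1,f_2\in\Gamma(U,\bigwedge(T^{*}\mathcal{M}))$ is defined iteratively by $$f_1\wedge_0 f_2=f_1\wedge f_2,\qquad f_1\wedge_l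 f_2=\sum_{i,j=1}^n g^{ij}(e_i\rfloor f_1)\wedge_{l-1}(e_j\rfloor f_2)\quad (l\ge 1).$$ The Graf product $\diamond$ is defined, for an $r$-form $f_1$ and an $s$-form $f_2$ with $r\le s$, by $$f_1\diamond f_2=\sum_{l=0}^r\frac{(-1)^{l(r-l)+[l/2]}}{l!}\,f_1\wedge_l f_2,\qquad f_2\diamond f_1=(-1)^{rs}\sum_{l=0}^r\frac{(-1)^{l(r-l+1)+[l/2]}}{l!}\,f_1\wedge_l f_2,$$ and extended bilinearly to all forms, where $[x]$ denotes the integer part of $x$. *)

theory Defs
  imports "HOL-Analysis.Analysis" "HOL-Algebra.Module"
begin

section \<open>Smooth manifolds\<close>

primrec Ck_on :: "nat \<Rightarrow> 'a::euclidean_space set \<Rightarrow> ('a \<Rightarrow> 'b::real_normed_vector) \<Rightarrow> bool" where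
  "Ck_on 0 S f \<longleftrightarrow> continuous_on S f"
| "Ck_on (Suc k) S f \<longleftrightarrow> (\<forall>x\<in>S. f differentiable (at x)) \<and>
     (\<forall>v. Ck_on k S (\<lambda>x. frechet_derivative f (at x) v))"

text \<open>Only used for open \<open>S\<close>.\<close>
definition smooth_on :: "'a::euclidean_space set \<Rightarrow> ('a \<Rightarrow> 'b::real_normed_vector) \<Rightarrow> bool" where
  "smooth_on S f \<longleftrightarrow> (\<forall>k. Ck_on k S f)"

text \<open>A chart is a pair of its domain and a total function whose values off the domain are ignored.\<close>
type_synonym ('m, 'n) chart = "'m set \<times> ('m \<Rightarrow> real^'n)"

abbreviation chart_inv :: "('m, 'n) chart \<Rightarrow> real^'n \<Rightarrow> 'm" where
  "chart_inv c \<equiv> inv_into (fst c) (snd c)"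

definition smooth_atlas :: "('m::topological_space, 'n::finite) chart set \<Rightarrow> bool" where
  "smooth_atlas A \<longleftrightarrow>
     (\<forall>c\<in>A. open (fst c) \<and> open (snd c ` fst c) \<and>
            homeomorphism (fst c) (snd c ` fst c) (snd c) (chart_inv c)) \<and>
     (\<Union>c\<in>A. fst c) = UNIV \<and>
     (\<forall>c\<in>A. \<forall>d\<in>A. smooth_on (snd c ` (fst c \<inter> fst d)) (snd d \<circ> chart_inv c))"

definition paracompact_UNIV :: "'m::topological_space itself \<Rightarrow> bool" where
  "paracompact_UNIV _ \<longleftrightarrow>
     (\<forall>\<C>::'m set set. (\<forall>C\<in>\<C>. open C) \<and> \<Union>\<C> = UNIV \<longrightarrow>
        (\<exists>\<D>. (\<forall>D\<in>\<D>. open D \<and> (\<exists>C\<in>\<C>. D \<subseteq> C)) \<and> \<Union>\<D> = UNIV \<and>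
             locally_finite_in euclidean \<D>))"

text \<open>The manifold is the whole type \<open>'m\<close>; its dimension is \<open>CARD('n)\<close>.\<close>
definition smooth_manifold :: "('m::t2_space, 'n::finite) chart set \<Rightarrow> bool" where
  "smooth_manifold A \<longleftrightarrow>
     smooth_atlas A \<and> paracompact_UNIV TYPE('m) \<and> connected (UNIV :: 'm set)"

definition smooth_fun_on ::
    "('m::topological_space, 'n::finite) chart set \<Rightarrow> 'm set \<Rightarrow> ('m \<Rightarrow> real) \<Rightarrow> bool" where
  "smooth_fun_on A W f \<longleftrightarrow> (\<forall>c\<in>A. smooth_on (snd c ` (W \<inter> fst c)) (f \<circ> chart_inv c))"

definition smooth_at ::
    "('m::topological_space, 'n::finite) chart set \<Rightarrow> 'm \<Rightarrow> ('m \<Rightarrow> real) \<Rightarrow> bool" where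
  "smooth_at A x f \<longleftrightarrow> (\<exists>W. open W \<and> x \<in> W \<and> smooth_fun_on A W f)"


section \<open>Tangent vectors, frames and metrics\<close>

type_synonym 'm tvec = "('m \<Rightarrow> real) \<Rightarrow> real"

text \<open>Derivations at \<open>x\<close> of the functions smooth near \<open>x\<close>.  The value on other functions is
  fixed to be 0 so that equality of tangent vectors is equality of functions.  That a derivation
  depends only on germs follows from the Leibniz rule, since the functions need
  not be smooth away from \<open>x\<close>.\<close>
definition tangent_space ::
    "('m::topological_space, 'n::finite) chart set \<Rightarrow> 'm \<Rightarrow> 'm tvec set" where
  "tangent_space A x = {v.
     (\<forall>f. \<not> smooth_at A x f \<longrightarrow> v f = 0) \<and>
     (\<forall>f h a b. smooth_at A x f \<and> smooth_at A x h \<longrightarrow>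
        v (\<lambda>y. a * f y + b * h y) = a * v f + b * v h) \<and>
     (\<forall>f h. smooth_at A x f \<and> smooth_at A x h \<longrightarrow>
        v (\<lambda>y. f y * h y) = f x * v h + h x * v f)}"

definition tcomb :: "real \<Rightarrow> 'm tvec \<Rightarrow> real \<Rightarrow> 'm tvec \<Rightarrow> 'm tvec" where
  "tcomb a v b w = (\<lambda>f. a * v f + b * w f)"

definition tangent_basis ::
    "('m::topological_space, 'n::finite) chart set \<Rightarrow> 'm \<Rightarrow> ('n \<Rightarrow> 'm tvec) \<Rightarrow> bool" where
  "tangent_basis A x b \<longleftrightarrow> (\<forall>i. b i \<in> tangent_space A x) \<and>
     (\<forall>v\<in>tangent_space A x. \<exists>!c. v = (\<lambda>f. \<Sum>i\<in>UNIV. c i * b i f))"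

text \<open>The coordinate vector \<open>\<partial>/\<partial>x\<^sup>i\<close> of the chart \<open>c\<close> at \<open>x \<in> fst c\<close>.\<close>
definition coord_vec ::
    "('m::topological_space, 'n::finite) chart set \<Rightarrow> ('m, 'n) chart \<Rightarrow> 'n \<Rightarrow> 'm \<Rightarrow> 'm tvec" where
  "coord_vec A c i x = (\<lambda>f. if smooth_at A x f
     then frechet_derivative (f \<circ> chart_inv c) (at (snd c x)) (axis i 1) else 0)"

text \<open>\<open>X x\<close> applied to the \<open>i\<close>-th coordinate function is the \<open>i\<close>-th component of \<open>X\<close> in the chart.\<close>
definition smooth_vector_field ::
    "('m::topological_space, 'n::finite) chart set \<Rightarrow> 'm set \<Rightarrow> ('m \<Rightarrow> 'm tvec) \<Rightarrow> bool" where
  "smooth_vector_field A U X \<longleftrightarrow> (\<forall>x\<in>U. X x \<in> tangent_space A x) \<and>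
     (\<forall>c\<in>A. \<forall>i. smooth_fun_on A (U \<inter> fst c) (\<lambda>x. X x (\<lambda>y. snd c y $ i)))"

definition local_frame ::
    "('m::topological_space, 'n::finite) chart set \<Rightarrow> 'm set \<Rightarrow> ('n \<Rightarrow> 'm \<Rightarrow> 'm tvec) \<Rightarrow> bool" where
  "local_frame A U e \<longleftrightarrow> (\<forall>i. smooth_vector_field A U (e i)) \<and>
     (\<forall>x\<in>U. tangent_basis A x (\<lambda>i. e i x))"

definition pseudo_riemannian_metric ::
    "('m::topological_space, 'n::finite) chart set \<Rightarrow> ('m \<Rightarrow> 'm tvec \<Rightarrow> 'm tvec \<Rightarrow> real) \<Rightarrow>
     nat \<Rightarrow> nat \<Rightarrow> bool" where
  "pseudo_riemannian_metric A g p q \<longleftrightarrow>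
     (\<forall>x. \<forall>u\<in>tangent_space A x. \<forall>v\<in>tangent_space A x. g x u v = g x v u) \<and>
     (\<forall>x. \<forall>u\<in>tangent_space A x. \<forall>v\<in>tangent_space A x. \<forall>w\<in>tangent_space A x. \<forall>a b.
        g x (tcomb a u b v) w = a * g x u w + b * g x v w) \<and>
     (\<forall>x. \<forall>v\<in>tangent_space A x. (\<forall>w\<in>tangent_space A x. g x v w = 0) \<longrightarrow> v = (\<lambda>f. 0)) \<and>
     (\<forall>c\<in>A. \<forall>i j. smooth_fun_on A (fst c) (\<lambda>x. g x (coord_vec A c i x) (coord_vec A c j x))) \<and>
     (\<forall>x. \<exists>b. tangent_basis A x b \<and> (\<forall>i j. i \<noteq> j \<longrightarrow> g x (b i) (b j) = 0) \<and>
        (\<forall>i. g x (b i) (b i) = 1 \<or> g x (b i) (b i) = -1) \<and>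
        card {i. g x (b i) (b i) = 1} = p \<and> card {i. g x (b i) (b i) = -1} = q)"


section \<open>Differential forms\<close>

text \<open>An element of the exterior algebra of a cotangent space is a function on lists of tangent
  vectors; its restriction to lists of length \<open>k\<close> is its component of degree \<open>k\<close>, an alternating
  \<open>k\<close>-linear form.  Such a form vanishes when \<open>k\<close> exceeds the dimension, so this is the direct
  sum of the exterior powers.\<close>
type_synonym 'm multiform = "'m tvec list \<Rightarrow> real"

definition ext_fibre ::
    "('m::topological_space, 'n::finite) chart set \<Rightarrow> 'm \<Rightarrow> 'm multiform set" where
  "ext_fibre A x = {\<omega>.
     (\<forall>vs. \<not> set vs \<subseteq> tangent_space A x \<longrightarrow> \<omega> vs = 0) \<and>
     (\<forall>us ws v w a b. set (us @ v # w # ws) \<subseteq> tangent_space A x \<longrightarrow>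
        \<omega> (us @ tcomb a v b w # ws) = a * \<omega> (us @ v # ws) + b * \<omega> (us @ w # ws)) \<and>
     (\<forall>vs. \<not> distinct vs \<longrightarrow> \<omega> vs = 0)}"

definition of_degree :: "nat \<Rightarrow> 'm multiform \<Rightarrow> bool" where
  "of_degree k \<omega> \<longleftrightarrow> (\<forall>vs. length vs \<noteq> k \<longrightarrow> \<omega> vs = 0)"

text \<open>Smooth sections over \<open>U\<close> of the exterior bundle, extended by 0 outside \<open>U\<close>.\<close>
definition form_sections ::
    "('m::topological_space, 'n::finite) chart set \<Rightarrow> 'm set \<Rightarrow> ('m \<Rightarrow> 'm multiform) set" where
  "form_sections A U = {\<omega>.
     (\<forall>x\<in>U. \<omega> x \<in> ext_fibre A x) \<and> (\<forall>x. x \<notin> U \<longrightarrow> \<omega> x = (\<lambda>vs. 0)) \<and>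
     (\<forall>c\<in>A. \<forall>is. smooth_fun_on A (U \<inter> fst c) (\<lambda>x. \<omega> x (map (\<lambda>i. coord_vec A c i x) is)))}"

definition degree_part :: "nat \<Rightarrow> ('m \<Rightarrow> 'm multiform) \<Rightarrow> 'm \<Rightarrow> 'm multiform" where
  "degree_part k \<omega> = (\<lambda>x vs. if length vs = k then \<omega> x vs else 0)"

text \<open>The sum over all shuffles: \<open>I\<close> is the set of positions of the arguments passed to \<open>\<alpha>\<close>,
  and the sign is that of the shuffle moving these positions to the front.  All degrees of
  \<open>\<alpha>\<close> and \<open>\<beta>\<close> are covered at once, since \<open>I\<close> may have any size.\<close>
definition wedge ::
    "('m \<Rightarrow> 'm multiform) \<Rightarrow> ('m \<Rightarrow> 'm multiform) \<Rightarrow> 'm \<Rightarrow> 'm multiform" where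
  "wedge \<alpha> \<beta> = (\<lambda>x vs. \<Sum>I\<in>Pow {..<length vs}.
     (-1) ^ card {(i, j). i \<in> I \<and> j \<in> {..<length vs} - I \<and> j < i} *
     \<alpha> x (nths vs I) * \<beta> x (nths vs (- I)))"

definition contraction ::
    "('m \<Rightarrow> 'm tvec) \<Rightarrow> ('m \<Rightarrow> 'm multiform) \<Rightarrow> 'm \<Rightarrow> 'm multiform" where
  "contraction X \<omega> = (\<lambda>x vs. \<omega> x (X x # vs))"

definition coframe ::
    "('m::topological_space, 'n::finite) chart set \<Rightarrow> ('n \<Rightarrow> 'm \<Rightarrow> 'm tvec) \<Rightarrow>
     'n \<Rightarrow> 'm \<Rightarrow> 'm multiform" where
  "coframe A e i x = (THE \<alpha>. \<alpha> \<in> ext_fibre A x \<and> of_degree 1 \<alpha> \<and>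
     (\<forall>j. \<alpha> [e j x] = (if i = j then 1 else 0)))"

definition sharp ::
    "('m::topological_space, 'n::finite) chart set \<Rightarrow> ('m \<Rightarrow> 'm tvec \<Rightarrow> 'm tvec \<Rightarrow> real) \<Rightarrow>
     'm \<Rightarrow> 'm multiform \<Rightarrow> 'm tvec" where
  "sharp A g x \<alpha> = (THE v. v \<in> tangent_space A x \<and> (\<forall>w\<in>tangent_space A x. g x v w = \<alpha> [w]))"

text \<open>The metric on the cotangent bundle reciprocal to \<open>g\<close>.\<close>
definition cometric ::
    "('m::topological_space, 'n::finite) chart set \<Rightarrow> ('m \<Rightarrow> 'm tvec \<Rightarrow> 'm tvec \<Rightarrow> real) \<Rightarrow>
     'm \<Rightarrow> 'm multiform \<Rightarrow> 'm multiform \<Rightarrow> real" where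
  "cometric A g x \<alpha> \<beta> = g x (sharp A g x \<alpha>) (sharp A g x \<beta>)"


section \<open>The Graf product\<close>

primrec contracted_wedge ::
    "('m::topological_space, 'n::finite) chart set \<Rightarrow> ('m \<Rightarrow> 'm tvec \<Rightarrow> 'm tvec \<Rightarrow> real) \<Rightarrow>
     ('n \<Rightarrow> 'm \<Rightarrow> 'm tvec) \<Rightarrow> nat \<Rightarrow>
     ('m \<Rightarrow> 'm multiform) \<Rightarrow> ('m \<Rightarrow> 'm multiform) \<Rightarrow> 'm \<Rightarrow> 'm multiform" where
  "contracted_wedge A g e 0 = (\<lambda>\<alpha> \<beta>. wedge \<alpha> \<beta>)"
| "contracted_wedge A g e (Suc l) = (\<lambda>\<alpha> \<beta> x vs. \<Sum>i\<in>UNIV. \<Sum>j\<in>UNIV.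
     cometric A g x (coframe A e i x) (coframe A e j x) *
     contracted_wedge A g e l (contraction (e i) \<alpha>) (contraction (e j) \<beta>) x vs)"

text \<open>The Graf product of an \<open>r\<close>-form \<open>\<alpha>\<close> and an \<open>s\<close>-form \<open>\<beta>\<close>.  If \<open>r > s\<close>, the form of
  lower degree is \<open>\<beta>\<close>.\<close>
definition graf_homogeneous ::
    "('m::topological_space, 'n::finite) chart set \<Rightarrow> ('m \<Rightarrow> 'm tvec \<Rightarrow> 'm tvec \<Rightarrow> real) \<Rightarrow>
     ('n \<Rightarrow> 'm \<Rightarrow> 'm tvec) \<Rightarrow> nat \<Rightarrow> nat \<Rightarrow>
     ('m \<Rightarrow> 'm multiform) \<Rightarrow> ('m \<Rightarrow> 'm multiform) \<Rightarrow> 'm \<Rightarrow> 'm multiform" where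
  "graf_homogeneous A g e r s \<alpha> \<beta> = (\<lambda>x vs.
     if r \<le> s
     then \<Sum>l\<le>r. (-1) ^ (l * (r - l) + l div 2) / fact l * contracted_wedge A g e l \<alpha> \<beta> x vs
     else (-1) ^ (r * s) *
       (\<Sum>l\<le>s. (-1) ^ (l * (s - l + 1) + l div 2) / fact l * contracted_wedge A g e l \<beta> \<alpha> x vs))"

definition graf_product ::
    "('m::topological_space, 'n::finite) chart set \<Rightarrow> ('m \<Rightarrow> 'm tvec \<Rightarrow> 'm tvec \<Rightarrow> real) \<Rightarrow>
     ('n \<Rightarrow> 'm \<Rightarrow> 'm tvec) \<Rightarrow>
     ('m \<Rightarrow> 'm multiform) \<Rightarrow> ('m \<Rightarrow> 'm multiform) \<Rightarrow> 'm \<Rightarrow> 'm multiform" where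
  "graf_product A g e \<alpha> \<beta> = (\<lambda>x vs. \<Sum>r\<le>CARD('n). \<Sum>s\<le>CARD('n).
     graf_homogeneous A g e r s (degree_part r \<alpha>) (degree_part s \<beta>) x vs)"


section \<open>Function ring and algebra of forms\<close>

text \<open>Smooth functions on \<open>U\<close>, extended by 0 outside \<open>U\<close>.\<close>
definition smooth_function_ring ::
    "('m::topological_space, 'n::finite) chart set \<Rightarrow> 'm set \<Rightarrow> ('m \<Rightarrow> real) ring" where
  "smooth_function_ring A U =
     \<lparr>carrier = {f. smooth_fun_on A U f \<and> (\<forall>x. x \<notin> U \<longrightarrow> f x = 0)},
      mult = (\<lambda>f h x. f x * h x),
      one = (\<lambda>x. if x \<in> U then 1 else 0),
      zero = (\<lambda>x. 0),
      add = (\<lambda>f h x. f x + h x)\<rparr>"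

definition graf_algebra ::
    "('m::topological_space, 'n::finite) chart set \<Rightarrow> ('m \<Rightarrow> 'm tvec \<Rightarrow> 'm tvec \<Rightarrow> real) \<Rightarrow>
     'm set \<Rightarrow> ('n \<Rightarrow> 'm \<Rightarrow> 'm tvec) \<Rightarrow> ('m \<Rightarrow> real, 'm \<Rightarrow> 'm multiform) module" where
  "graf_algebra A g U e =
     \<lparr>carrier = form_sections A U,
      mult = graf_product A g e,
      one = (\<lambda>x vs. if x \<in> U \<and> vs = [] then 1 else 0),
      zero = (\<lambda>x vs. 0),
      add = (\<lambda>\<alpha> \<beta> x vs. \<alpha> x vs + \<beta> x vs),
      smult = (\<lambda>f \<alpha> x vs. f x * \<alpha> x vs)\<rparr>"

text \<open>Sections of the cotangent bundle over \<open>U\<close>; only the module structure matters here.\<close>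
definition one_forms ::
    "('m::topological_space, 'n::finite) chart set \<Rightarrow> ('m \<Rightarrow> 'm tvec \<Rightarrow> 'm tvec \<Rightarrow> real) \<Rightarrow>
     'm set \<Rightarrow> ('n \<Rightarrow> 'm \<Rightarrow> 'm tvec) \<Rightarrow> ('m \<Rightarrow> real, 'm \<Rightarrow> 'm multiform) module" where
  "one_forms A g U e =
     graf_algebra A g U e \<lparr>carrier := {\<alpha> \<in> form_sections A U. \<forall>x. of_degree 1 (\<alpha> x)}\<rparr>"

definition cometric_on ::
    "('m::topological_space, 'n::finite) chart set \<Rightarrow> ('m \<Rightarrow> 'm tvec \<Rightarrow> 'm tvec \<Rightarrow> real) \<Rightarrow>
     'm set \<Rightarrow> ('m \<Rightarrow> 'm multiform) \<Rightarrow> ('m \<Rightarrow> 'm multiform) \<Rightarrow> 'm \<Rightarrow> real" where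
  "cometric_on A g U \<alpha> \<beta> = (\<lambda>x. if x \<in> U then cometric A g x (\<alpha> x) (\<beta> x) else 0)"


section \<open>Clifford algebras over a commutative ring\<close>

text \<open>Unlike \<open>algebra\<close> of HOL-Algebra, the multiplication need not be commutative.\<close>
locale assoc_algebra = module R A + A?: ring A for R (structure) and A (structure) +
  assumes smult_mult_left:
    "\<lbrakk>a \<in> carrier R; x \<in> carrier A; y \<in> carrier A\<rbrakk> \<Longrightarrow>
     (a \<odot>\<^bsub>A\<^esub> x) \<otimes>\<^bsub>A\<^esub> y = a \<odot>\<^bsub>A\<^esub> (x \<otimes>\<^bsub>A\<^esub> y)"
    and smult_mult_right:
    "\<lbrakk>a \<in> carrier R; x \<in> carrier A; y \<in> carrier A\<rbrakk> \<Longrightarrow>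
     x \<otimes>\<^bsub>A\<^esub> (a \<odot>\<^bsub>A\<^esub> y) = a \<odot>\<^bsub>A\<^esub> (x \<otimes>\<^bsub>A\<^esub> y)"

definition linear_maps ::
    "('r, 'x) ring_scheme \<Rightarrow> ('r, 'a, 'y) module_scheme \<Rightarrow> ('r, 'b, 'z) module_scheme \<Rightarrow>
     ('a \<Rightarrow> 'b) set" where
  "linear_maps R M N = {h. h \<in> carrier M \<rightarrow> carrier N \<and>
     (\<forall>x\<in>carrier M. \<forall>y\<in>carrier M. h (x \<oplus>\<^bsub>M\<^esub> y) = h x \<oplus>\<^bsub>N\<^esub> h y) \<and>
     (\<forall>a\<in>carrier R. \<forall>x\<in>carrier M. h (a \<odot>\<^bsub>M\<^esub> x) = a \<odot>\<^bsub>N\<^esub> h x)}"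

definition algebra_homs ::
    "('r, 'x) ring_scheme \<Rightarrow> ('r, 'a, 'y) module_scheme \<Rightarrow> ('r, 'b, 'z) module_scheme \<Rightarrow>
     ('a \<Rightarrow> 'b) set" where
  "algebra_homs R M N = ring_hom M N \<inter> linear_maps R M N"

locale symmetric_bilinear_module = module R V for R (structure) and V (structure) +
  fixes b :: "'v \<Rightarrow> 'v \<Rightarrow> 'r"
  assumes form_closed: "\<lbrakk>v \<in> carrier V; w \<in> carrier V\<rbrakk> \<Longrightarrow> b v w \<in> carrier R"
    and form_sym: "\<lbrakk>v \<in> carrier V; w \<in> carrier V\<rbrakk> \<Longrightarrow> b v w = b w v"
    and form_add: "\<lbrakk>u \<in> carrier V; v \<in> carrier V; w \<in> carrier V\<rbrakk> \<Longrightarrow>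
      b (u \<oplus>\<^bsub>V\<^esub> v) w = b u w \<oplus>\<^bsub>R\<^esub> b v w"
    and form_smult: "\<lbrakk>a \<in> carrier R; v \<in> carrier V; w \<in> carrier V\<rbrakk> \<Longrightarrow>
      b (a \<odot>\<^bsub>V\<^esub> v) w = a \<otimes>\<^bsub>R\<^esub> b v w"

definition clifford_map ::
    "('r, 'x) ring_scheme \<Rightarrow> ('r, 'v, 'y) module_scheme \<Rightarrow> ('v \<Rightarrow> 'v \<Rightarrow> 'r) \<Rightarrow>
     ('r, 'a, 'z) module_scheme \<Rightarrow> ('v \<Rightarrow> 'a) \<Rightarrow> bool" where
  "clifford_map R V b A \<iota> \<longleftrightarrow> \<iota> \<in> linear_maps R V A \<and>
     (\<forall>v\<in>carrier V. \<iota> v \<otimes>\<^bsub>A\<^esub> \<iota> v = b v v \<odot>\<^bsub>A\<^esub> \<one>\<^bsub>A\<^esub>)"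

text \<open>\<open>(A, \<iota>)\<close> is a Clifford algebra of the \<open>R\<close>-module \<open>V\<close> with symmetric bilinear form \<open>b\<close>.
  The universal property concerns test algebras with elements in the type \<open>'d\<close>; the locale
  predicate takes this type as its first argument, which a theorem should leave free.  That \<open>\<iota>\<close> generates \<open>A\<close> is a consequence of the universal property
  for large enough \<open>'d\<close>; it is included since it is part of the common definition by
  generators and relations.\<close>
locale clifford_algebra =
    symmetric_bilinear_module R V b + assoc_algebra R A
  for R :: "('r, 'x) ring_scheme" (structure) and V :: "('r, 'v, 'y) module_scheme" (structure)
    and b and A :: "('r, 'a, 'z) module_scheme" (structure) +
  fixes \<iota> :: "'v \<Rightarrow> 'a"
  assumes clifford_map: "clifford_map R V b A \<iota>"
    and generated: "\<lbrakk>S \<subseteq> carrier A; \<one>\<^bsub>A\<^esub> \<in> S; \<iota> ` carrier V \<subseteq> S;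
      \<And>x y. \<lbrakk>x \<in> S; y \<in> S\<rbrakk> \<Longrightarrow> x \<oplus>\<^bsub>A\<^esub> y \<in> S;
      \<And>x y. \<lbrakk>x \<in> S; y \<in> S\<rbrakk> \<Longrightarrow> x \<otimes>\<^bsub>A\<^esub> y \<in> S;
      \<And>a x. \<lbrakk>a \<in> carrier R; x \<in> S\<rbrakk> \<Longrightarrow> a \<odot>\<^bsub>A\<^esub> x \<in> S\<rbrakk> \<Longrightarrow> S = carrier A"
    and universal: "\<lbrakk>assoc_algebra R (B :: ('r, 'd) module); clifford_map R V b B f\<rbrakk> \<Longrightarrow>
      \<exists>F\<in>algebra_homs R A B. (\<forall>v\<in>carrier V. F (\<iota> v) = f v) \<and>
        (\<forall>F'\<in>algebra_homs R A B. (\<forall>v\<in>carrier V. F' (\<iota> v) = f v) \<longrightarrow>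
           (\<forall>x\<in>carrier A. F' x = F x))"

end

theory Submission
  imports Defs
begin

text \<open>Two facts carry the proof: Graf's formula has a recursive description in which its signs become
  natural, and every form can be built from one-forms by left Graf multiplication.

  A form at a point is a function on lists of tangent vectors, and prefixing a vector to the list is
  contraction.  Splitting the shuffles according to the destination of the first argument therefore
  turns the wedge product into a recursion on lists, \<open>contract_ext_prod\<close>, which says that contraction
  is an antiderivation.  The sign of the \<open>l\<close>-th term of Graf's formula is the product of the signs
  picked up by applying the grade involution after each of the \<open>l\<close> contractions of the left factor
  (\<open>signed_contracted_sign\<close>).  In this form two derivation laws hold: contraction by a vector is an
  antiderivation of the Graf product (\<open>contract_graf\<close>), and left wedge multiplication by a one-form
  \<open>\<theta>\<close> commutes with it up to a contraction by the vector metrically dual to \<open>\<theta>\<close>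
  (\<open>graf_oneform_ext_prod\<close>).  Since \<open>\<theta> \<diamond> \<alpha>\<close> is \<open>\<theta> \<and> \<alpha>\<close> plus the contraction of \<open>\<alpha>\<close> by that dual
  vector, the correction terms cancel and \<open>(\<theta> \<diamond> \<alpha>) \<diamond> \<beta> = \<theta> \<diamond> (\<alpha> \<diamond> \<beta>)\<close>.

  Euler's identity \<open>k \<alpha> = \<Sum>i. e\<^sup>i \<and> (e\<^sub>i \<rfloor> \<alpha>)\<close> for a \<open>k\<close>-form \<open>\<alpha>\<close> holds with \<open>\<diamond>\<close> in place
  of \<open>\<and>\<close> as well, because the extra terms \<open>g\<^sup>i\<^sup>j e\<^sub>j \<rfloor> e\<^sub>i \<rfloor> \<alpha>\<close> pair a symmetric with an
  antisymmetric expression.  So a set of forms that contains the unit, is a submodule and is stable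
  under left multiplication by one-forms contains every form (\<open>form_induct\<close>).  This gives
  associativity in general, generation by one-forms, and uniqueness in the universal property.

  For existence, a Clifford map \<open>f\<close> is extended by the same identity: the value at a \<open>k\<close>-form \<open>\<alpha>\<close> is
  \<open>1/k\<close> times the sum of \<open>f e\<^sup>i\<close> times the value at \<open>e\<^sub>i \<rfloor> \<alpha>\<close>.  The anticommutation relations of
  the \<open>f e\<^sup>i\<close> show by induction on the degree that this map turns left Graf multiplication by a
  one-form into multiplication in the target (\<open>ext_part_oneform\<close>), and \<open>form_induct\<close> makes it
  multiplicative.  No orthogonal frame enters, which matters since one need not exist on all of \<open>U\<close>.

  Smoothness reduces to sums, products and Cramer's rule: in a chart, the frame, its coframe and the
  Gram matrix of the frame are all expressed by smooth matrices and their inverses.\<close>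

section \<open>Smooth functions on an atlas\<close>

lemma Ck_on_subset: "Ck_on k S f \<Longrightarrow> S' \<subseteq> S \<Longrightarrow> Ck_on k S' f"
  by (induction k arbitrary: f) (auto intro: continuous_on_subset)

text \<open>Openness of \<open>S\<close> is what makes the derivatives of \<open>f\<close> and \<open>h\<close> agree on \<open>S\<close>: the definition uses
  derivatives in the ambient space.\<close>
lemma Ck_on_cong_imp:
  assumes "open S" "\<And>x. x \<in> S \<Longrightarrow> f x = h x" "Ck_on k S f"
  shows "Ck_on k S h"
  using assms(2,3)
proof (induction k arbitrary: f h)
  case 0
  then show ?case by (simp cong: continuous_on_cong)
next
  case (Suc k)
  have d: "f differentiable at x" if "x \<in> S" for x using Suc.prems that by auto
  have fd: "frechet_derivative h (at x) = frechet_derivative f (at x)" if "x \<in> S" for x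
    using frechet_derivative_transform_within_open[OF d[OF that] assms(1) that, of h]
      Suc.prems(1) by simp
  have "h differentiable at x" if "x \<in> S" for x
    using d[OF that] assms(1) Suc.prems(1) that
    by (meson differentiable_def has_derivative_transform_within_open)
  moreover have "Ck_on k S (\<lambda>x. frechet_derivative h (at x) v)" for v
    by (rule Suc.IH[of "\<lambda>x. frechet_derivative f (at x) v"]) (use Suc.prems fd in auto)
  ultimately show ?case by simp
qed

lemma Ck_on_SucD: "Ck_on (Suc k) S f \<Longrightarrow> Ck_on k S f"
proof (induction k arbitrary: f)
  case 0
  then show ?case
    by (auto simp: differentiable_imp_continuous_within continuous_at_imp_continuous_on)
next
  case (Suc k)
  then show ?case by simp
qed

lemma Ck_on_const: "Ck_on k S (\<lambda>x. c)"
  by (induction k arbitrary: c) auto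

lemma Ck_on_bounded_linear:
  assumes "open S" "bounded_linear L" "Ck_on k S f"
  shows "Ck_on k S (\<lambda>x. L (f x))"
  using assms(3)
proof (induction k arbitrary: f)
  case 0
  then show ?case by (simp add: bounded_linear.continuous_on[OF assms(2)])
next
  case (Suc k)
  have hd: "((\<lambda>x. L (f x)) has_derivative (\<lambda>v. L (frechet_derivative f (at x) v))) (at x)"
    if "x \<in> S" for x
    using Suc.prems that
    by (intro bounded_linear.has_derivative[OF assms(2)]) (auto simp: frechet_derivative_works)
  have fd: "frechet_derivative (\<lambda>x. L (f x)) (at x) v = L (frechet_derivative f (at x) v)"
    if "x \<in> S" for x v
    using frechet_derivative_at[OF hd[OF that]] by metis
  have "Ck_on k S (\<lambda>x. frechet_derivative (\<lambda>x. L (f x)) (at x) v)" for v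
    by (rule Ck_on_cong_imp[OF assms(1), of "\<lambda>x. L (frechet_derivative f (at x) v)"])
       (use Suc fd in auto)
  then show ?case using hd by (auto simp: differentiable_def)
qed

lemma Ck_on_add:
  assumes "open S" "Ck_on k S f" "Ck_on k S h"
  shows "Ck_on k S (\<lambda>x. f x + h x)"
  using assms(2,3)
proof (induction k arbitrary: f h)
  case 0
  then show ?case by (auto intro: continuous_intros)
next
  case (Suc k)
  have hd: "((\<lambda>x. f x + h x) has_derivative
      (\<lambda>v. frechet_derivative f (at x) v + frechet_derivative h (at x) v)) (at x)"
    if "x \<in> S" for x
    using Suc.prems that by (intro has_derivative_add) (auto simp: frechet_derivative_works)
  have fd: "frechet_derivative (\<lambda>x. f x + h x) (at x) v =
      frechet_derivative f (at x) v + frechet_derivative h (at x) v"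
    if "x \<in> S" for x v
    using frechet_derivative_at[OF hd[OF that]] by metis
  have "Ck_on k S (\<lambda>x. frechet_derivative (\<lambda>x. f x + h x) (at x) v)" for v
    by (rule Ck_on_cong_imp[OF assms(1),
          of "\<lambda>x. frechet_derivative f (at x) v + frechet_derivative h (at x) v"])
       (use Suc fd in auto)
  then show ?case using hd by (auto simp: differentiable_def)
qed

lemma Ck_on_mult:
  fixes f h :: "'a::euclidean_space \<Rightarrow> real"
  assumes "open S" "Ck_on k S f" "Ck_on k S h"
  shows "Ck_on k S (\<lambda>x. f x * h x)"
  using assms(2,3)
proof (induction k arbitrary: f h)
  case 0
  then show ?case by (auto intro: continuous_intros)
next
  case (Suc k)
  have hd: "((\<lambda>x. f x * h x) has_derivative
      (\<lambda>v. f x * frechet_derivative h (at x) v + frechet_derivative f (at x) v * h x)) (at x)"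
    if "x \<in> S" for x
    using Suc.prems that by (intro has_derivative_mult) (auto simp: frechet_derivative_works)
  have fd: "frechet_derivative (\<lambda>x. f x * h x) (at x) v =
      f x * frechet_derivative h (at x) v + frechet_derivative f (at x) v * h x"
    if "x \<in> S" for x v
    using frechet_derivative_at[OF hd[OF that]] by metis
  have "Ck_on k S (\<lambda>x. frechet_derivative (\<lambda>x. f x * h x) (at x) v)" for v
  proof (rule Ck_on_cong_imp[OF assms(1)])
    show "Ck_on k S (\<lambda>x. f x * frechet_derivative h (at x) v + frechet_derivative f (at x) v * h x)"
      using Suc.prems Ck_on_SucD[OF Suc.prems(1)] Ck_on_SucD[OF Suc.prems(2)]
      by (intro Ck_on_add assms(1) Suc.IH) auto
  qed (simp add: fd)
  then show ?case using hd by (auto simp: differentiable_def)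
qed

text \<open>The derivative of \<open>1/f\<close> is a product of \<open>f'\<close> and two factors \<open>1/f\<close>, so the induction hypothesis
  for \<open>1/f\<close> itself supplies the next order.\<close>
lemma Ck_on_inverse:
  fixes f :: "'a::euclidean_space \<Rightarrow> real"
  assumes "open S" "\<And>x. x \<in> S \<Longrightarrow> f x \<noteq> 0" "Ck_on k S f"
  shows "Ck_on k S (\<lambda>x. inverse (f x))"
  using assms(3)
proof (induction k)
  case 0
  then show ?case using assms(2) by (auto intro!: continuous_intros)
next
  case (Suc k)
  have hd: "((\<lambda>x. inverse (f x)) has_derivative
      (\<lambda>v. - (inverse (f x) * frechet_derivative f (at x) v * inverse (f x)))) (at x)"
    if "x \<in> S" for x
    using Suc.prems that assms(2)
    by (intro Deriv.has_derivative_inverse) (auto simp: frechet_derivative_works)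
  have fd: "frechet_derivative (\<lambda>x. inverse (f x)) (at x) v =
      -1 * (inverse (f x) * frechet_derivative f (at x) v * inverse (f x))"
    if "x \<in> S" for x v
    using frechet_derivative_at[OF hd[OF that]] by (metis mult_minus1)
  have i: "Ck_on k S (\<lambda>x. inverse (f x))" using Suc Ck_on_SucD by blast
  have "Ck_on k S (\<lambda>x. frechet_derivative (\<lambda>x. inverse (f x)) (at x) v)" for v
  proof (rule Ck_on_cong_imp[OF assms(1)])
    show "Ck_on k S (\<lambda>x. -1 * (inverse (f x) * frechet_derivative f (at x) v * inverse (f x)))"
      using Suc.prems i by (intro Ck_on_mult Ck_on_const assms(1)) auto
  qed (simp add: fd)
  then show ?case using hd by (auto simp: differentiable_def)
qed

lemma open_chart_image:
  assumes "smooth_atlas A" "c \<in> A" "open W"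
  shows "open (snd c ` (W \<inter> fst c))"
proof -
  have h: "homeomorphism (fst c) (snd c ` fst c) (snd c) (chart_inv c)" "open (snd c ` fst c)"
    using assms by (auto simp: smooth_atlas_def)
  have "openin (top_of_set (fst c)) (fst c \<inter> W)"
    using assms(3) by blast
  then have "openin (top_of_set (snd c ` fst c)) (snd c ` (fst c \<inter> W))"
    using homeomorphism_imp_open_map[OF h(1)] by blast
  then show ?thesis using h(2) by (metis Int_commute openin_open_trans)
qed

lemma chart_inv_chart:
  assumes "smooth_atlas A" "c \<in> A" "x \<in> fst c"
  shows "chart_inv c (snd c x) = x"
  using assms by (auto simp: smooth_atlas_def homeomorphism_def)

lemma smooth_fun_on_subset: "smooth_fun_on A W f \<Longrightarrow> W' \<subseteq> W \<Longrightarrow> smooth_fun_on A W' f"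
  unfolding smooth_fun_on_def smooth_on_def
  by (meson Ck_on_subset Int_mono image_mono order_refl)

locale atlas =
  fixes A :: "('m::t2_space, 'n::finite) chart set"
  assumes atlas: "smooth_atlas A"
begin

lemma smooth_cong:
  assumes "open W" "\<And>x. x \<in> W \<Longrightarrow> f x = h x" "smooth_fun_on A W f"
  shows "smooth_fun_on A W h"
  unfolding smooth_fun_on_def smooth_on_def
proof (intro ballI allI)
  fix c k assume c: "c \<in> A"
  show "Ck_on k (snd c ` (W \<inter> fst c)) (h \<circ> chart_inv c)"
  proof (rule Ck_on_cong_imp[OF open_chart_image[OF atlas c assms(1)]])
    show "Ck_on k (snd c ` (W \<inter> fst c)) (f \<circ> chart_inv c)"
      using assms(3) c by (auto simp: smooth_fun_on_def smooth_on_def)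
  qed (use assms(2) chart_inv_chart[OF atlas c] in auto)
qed

lemma smooth_const: "smooth_fun_on A W (\<lambda>x. a)"
  by (auto simp: smooth_fun_on_def smooth_on_def comp_def Ck_on_const)

lemma smooth_add:
  assumes "open W" "smooth_fun_on A W f" "smooth_fun_on A W h"
  shows "smooth_fun_on A W (\<lambda>x. f x + h x)"
  using assms unfolding smooth_fun_on_def smooth_on_def comp_def
  by (auto intro!: Ck_on_add open_chart_image[OF atlas])

lemma smooth_mult:
  assumes "open W" "smooth_fun_on A W f" "smooth_fun_on A W h"
  shows "smooth_fun_on A W (\<lambda>x. f x * h x)"
  using assms unfolding smooth_fun_on_def smooth_on_def comp_def
  by (auto intro!: Ck_on_mult open_chart_image[OF atlas])

lemma smooth_inverse:
  assumes "open W" "smooth_fun_on A W f" "\<And>x. x \<in> W \<Longrightarrow> f x \<noteq> 0"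
  shows "smooth_fun_on A W (\<lambda>x. inverse (f x))"
  using assms chart_inv_chart[OF atlas] unfolding smooth_fun_on_def smooth_on_def comp_def
  by (auto intro!: Ck_on_inverse open_chart_image[OF atlas])

lemma smooth_sum:
  assumes "open W" "\<And>i. i \<in> I \<Longrightarrow> smooth_fun_on A W (f i)"
  shows "smooth_fun_on A W (\<lambda>x. \<Sum>i\<in>I. f i x)"
  using assms(2)
  by (induction I rule: infinite_finite_induct) (auto intro: smooth_const smooth_add assms(1))

lemma smooth_prod:
  assumes "open W" "\<And>i. i \<in> I \<Longrightarrow> smooth_fun_on A W (f i)"
  shows "smooth_fun_on A W (\<lambda>x. \<Prod>i\<in>I. f i x)"
  using assms(2)
  by (induction I rule: infinite_finite_induct) (auto intro: smooth_const smooth_mult assms(1))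

lemma smooth_det:
  assumes "open W" "\<And>i j. smooth_fun_on A W (\<lambda>x. M x $ i $ j)"
  shows "smooth_fun_on A W (\<lambda>x. det (M x :: real^'k^'k))"
  unfolding det_def
  by (intro smooth_sum smooth_mult smooth_prod smooth_const assms)

text \<open>By Cramer's rule each entry of the inverse is a quotient of two determinants, hence a rational
  expression in the entries of \<open>M\<close>.\<close>
lemma smooth_inverse_matrix:
  fixes M N :: "'m \<Rightarrow> real^'k^'k"
  assumes W: "open W" and M: "\<And>i j. smooth_fun_on A W (\<lambda>x. M x $ i $ j)"
    and inv: "\<And>x. x \<in> W \<Longrightarrow> M x ** N x = mat 1"
  shows "smooth_fun_on A W (\<lambda>x. N x $ i $ j)"
proof -
  let ?C = "\<lambda>x. \<chi> a b. if b = i then (mat 1 :: real^'k^'k) $ a $ j else M x $ a $ b"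
  have sC: "smooth_fun_on A W (\<lambda>x. ?C x $ a $ b)" for a b
    by (cases "b = i") (simp_all add: M smooth_const)
  have d: "det (M x) \<noteq> 0" if "x \<in> W" for x
    using inv[OF that] by (metis det_I det_mul mult_zero_left zero_neq_one)
  have "smooth_fun_on A W (\<lambda>x. det (?C x) * inverse (det (M x)))"
    by (intro smooth_mult smooth_inverse smooth_det W M sC d)
  moreover have "det (?C x) * inverse (det (M x)) = N x $ i $ j" if x: "x \<in> W" for x
  proof -
    have "M x *v column j (N x) = column j (mat 1)"
      by (subst inv[OF x, symmetric])
         (simp add: vec_eq_iff column_def matrix_vector_mult_def matrix_matrix_mult_def)
    then have "column j (N x) = (\<chi> k. det (\<chi> a b. if b = k then column j (mat 1) $ a else M x $ a $ b) / det (M x))"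
      by (simp add: cramer[OF d[OF x]])
    then have "column j (N x) $ i = det (\<chi> a b. if b = i then column j (mat 1) $ a else M x $ a $ b) / det (M x)"
      by simp
    moreover have "column j (mat 1 :: real^'k^'k) $ a = mat 1 $ a $ j" for a
      by (simp add: column_def)
    ultimately have "column j (N x) $ i = det (?C x) / det (M x)"
      by (simp only:)
    then show ?thesis by (simp add: column_def divide_inverse)
  qed
  ultimately show ?thesis by (rule smooth_cong[OF W, rotated])
qed

section \<open>Tangent spaces, frames and the reciprocal metric\<close>

lemma smooth_at_lincomb:
  assumes "smooth_at A x f" "smooth_at A x h"
  shows "smooth_at A x (\<lambda>y. a * f y + b * h y)"
proof -
  obtain W V where "open W" "x \<in> W" "smooth_fun_on A W f" "open V" "x \<in> V" "smooth_fun_on A V h"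
    using assms by (auto simp: smooth_at_def)
  then have "smooth_fun_on A (W \<inter> V) (\<lambda>y. a * f y + b * h y)"
    by (intro smooth_add smooth_mult smooth_const) (auto intro: smooth_fun_on_subset)
  then show ?thesis using \<open>open W\<close> \<open>open V\<close> \<open>x \<in> W\<close> \<open>x \<in> V\<close> unfolding smooth_at_def by blast
qed

lemma smooth_at_mult:
  assumes "smooth_at A x f" "smooth_at A x h"
  shows "smooth_at A x (\<lambda>y. f y * h y)"
proof -
  obtain W V where "open W" "x \<in> W" "smooth_fun_on A W f" "open V" "x \<in> V" "smooth_fun_on A V h"
    using assms by (auto simp: smooth_at_def)
  then have "smooth_fun_on A (W \<inter> V) (\<lambda>y. f y * h y)"
    by (intro smooth_mult) (auto intro: smooth_fun_on_subset)
  then show ?thesis using \<open>open W\<close> \<open>open V\<close> \<open>x \<in> W\<close> \<open>x \<in> V\<close> unfolding smooth_at_def by blast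
qed

lemma smooth_at_differentiable:
  assumes "smooth_at A x f" "c \<in> A" "x \<in> fst c"
  shows "(f \<circ> chart_inv c) differentiable (at (snd c x))"
proof -
  obtain W where W: "x \<in> W" "smooth_fun_on A W f"
    using assms by (auto simp: smooth_at_def)
  then have "Ck_on (Suc 0) (snd c ` (W \<inter> fst c)) (f \<circ> chart_inv c)"
    using assms(2) unfolding smooth_fun_on_def smooth_on_def by blast
  then show ?thesis using W(1) assms(3) by auto
qed

lemma coord_fun_smooth:
  assumes "c \<in> A"
  shows "smooth_fun_on A (fst c) (\<lambda>y. snd c y $ i)"
  unfolding smooth_fun_on_def smooth_on_def
proof (intro ballI allI)
  fix d k assume d: "d \<in> A"
  have o: "open (fst c)" using atlas assms by (auto simp: smooth_atlas_def)
  have "Ck_on k (snd d ` (fst c \<inter> fst d)) (snd c \<circ> chart_inv d)"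
    using atlas assms d by (auto simp: smooth_atlas_def smooth_on_def Int_commute)
  from Ck_on_bounded_linear[OF open_chart_image[OF atlas d o] bounded_linear_vec_nth this]
  show "Ck_on k (snd d ` (fst c \<inter> fst d)) ((\<lambda>y. snd c y $ i) \<circ> chart_inv d)"
    by (simp add: comp_def)
qed

lemma coord_vec_in_tangent_space:
  assumes c: "c \<in> A" "x \<in> fst c"
  shows "coord_vec A c i x \<in> tangent_space A x"
proof -
  let ?D = "\<lambda>f. frechet_derivative (f \<circ> chart_inv c) (at (snd c x))"
  have w: "((f \<circ> chart_inv c) has_derivative ?D f) (at (snd c x))" if "smooth_at A x f" for f
    using smooth_at_differentiable[OF that c] frechet_derivative_works by blast
  have x: "chart_inv c (snd c x) = x" using chart_inv_chart[OF atlas c] .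
  have "?D (\<lambda>y. a * f y + b * h y) v = a * ?D f v + b * ?D h v"
    if "smooth_at A x f" "smooth_at A x h" for f h a b v
  proof -
    have "(((\<lambda>y. a * f y + b * h y) \<circ> chart_inv c) has_derivative (\<lambda>v. a * ?D f v + b * ?D h v))
        (at (snd c x))"
      using has_derivative_add[OF has_derivative_mult_right[OF w[OF that(1)], of a]
          has_derivative_mult_right[OF w[OF that(2)], of b]]
      by (simp add: comp_def)
    from fun_cong[OF frechet_derivative_at[OF this], of v] show ?thesis by simp
  qed
  moreover have "?D (\<lambda>y. f y * h y) v = f x * ?D h v + h x * ?D f v"
    if "smooth_at A x f" "smooth_at A x h" for f h v
  proof -
    have "(((\<lambda>y. f y * h y) \<circ> chart_inv c) has_derivative (\<lambda>v. f x * ?D h v + ?D f v * h x))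
        (at (snd c x))"
      using has_derivative_mult[OF w[OF that(1)] w[OF that(2)]]
      by (simp add: comp_def x)
    from fun_cong[OF frechet_derivative_at[OF this], of v] show ?thesis by (simp add: algebra_simps)
  qed
  ultimately show ?thesis
    unfolding tangent_space_def coord_vec_def
    by (auto simp: smooth_at_lincomb smooth_at_mult)
qed

text \<open>The coordinate vectors and the coordinate functions are dual to each other; this is the source of all
  matrix inverses relating frames and charts.\<close>
lemma coord_vec_coord_fun:
  assumes c: "c \<in> A" "x \<in> fst c"
  shows "coord_vec A c a x (\<lambda>y. snd c y $ b) = (if a = b then 1 else 0)"
proof -
  have o: "open (fst c)" "open (snd c ` fst c)"
    and h: "homeomorphism (fst c) (snd c ` fst c) (snd c) (chart_inv c)"
    using atlas c by (auto simp: smooth_atlas_def)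
  have "smooth_at A x (\<lambda>y. snd c y $ b)"
    using coord_fun_smooth[OF c(1)] o c(2) unfolding smooth_at_def by blast
  moreover have "frechet_derivative ((\<lambda>y. snd c y $ b) \<circ> chart_inv c) (at (snd c x)) = (\<lambda>z. z $ b)"
  proof (rule frechet_derivative_at[symmetric], rule has_derivative_transform_within_open)
    show "((\<lambda>z. z $ b) has_derivative (\<lambda>z. z $ b)) (at (snd c x))"
      by (rule bounded_linear_imp_has_derivative[OF bounded_linear_vec_nth])
  qed (use o c(2) h in \<open>auto simp: homeomorphism_def\<close>)
  ultimately show ?thesis by (auto simp: coord_vec_def axis_def)
qed

end

lemma tcomb_in_tangent_space:
  "v \<in> tangent_space A x \<Longrightarrow> w \<in> tangent_space A x \<Longrightarrow> tcomb a v b w \<in> tangent_space A x"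
  unfolding tangent_space_def tcomb_def
  by (auto simp: algebra_simps)

lemma zero_in_tangent_space: "(\<lambda>f. 0) \<in> tangent_space A x"
  by (auto simp: tangent_space_def)

lemma lincomb_in_tangent_space:
  assumes "\<And>i. i \<in> I \<Longrightarrow> b i \<in> tangent_space A x"
  shows "(\<lambda>f. \<Sum>i\<in>I. c i * b i f) \<in> tangent_space A x"
  using assms
proof (induction I rule: infinite_finite_induct)
  case (insert i I)
  then have "tcomb (c i) (b i) 1 (\<lambda>f. \<Sum>i\<in>I. c i * b i f) \<in> tangent_space A x"
    by (intro tcomb_in_tangent_space) auto
  then show ?case using insert by (simp add: tcomb_def)
qed (simp_all add: zero_in_tangent_space)

text \<open>Tangent vectors form a set of functions without a vector space type, so linearity is only known
  for two-term combinations; this passes to finite sums.\<close>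
lemma functional_lincomb:
  assumes lin: "\<And>v w a b. v \<in> tangent_space A x \<Longrightarrow> w \<in> tangent_space A x \<Longrightarrow>
      \<phi> (tcomb a v b w) = a * \<phi> v + b * \<phi> w"
    and "\<And>i. i \<in> I \<Longrightarrow> b i \<in> tangent_space A x"
  shows "\<phi> (\<lambda>f. \<Sum>i\<in>I. c i * b i f) = (\<Sum>i\<in>I. c i * (\<phi> (b i) :: real))"
proof -
  have z: "\<phi> (\<lambda>f. 0) = 0"
    using lin[OF zero_in_tangent_space zero_in_tangent_space, of 0 0] by (simp add: tcomb_def)
  show ?thesis using assms(2)
  proof (induction I rule: infinite_finite_induct)
    case (insert i I)
    then have "\<phi> (tcomb (c i) (b i) 1 (\<lambda>f. \<Sum>i\<in>I. c i * b i f)) =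
        c i * \<phi> (b i) + 1 * \<phi> (\<lambda>f. \<Sum>i\<in>I. c i * b i f)"
      by (intro lin lincomb_in_tangent_space) auto
    then show ?case using insert by (simp add: tcomb_def)
  qed (simp_all add: z)
qed

lemma ext_fibre_lincomb:
  assumes "\<omega> \<in> ext_fibre A x" "set (us @ ws) \<subseteq> tangent_space A x"
    "\<And>i. i \<in> I \<Longrightarrow> b i \<in> tangent_space A x"
  shows "\<omega> (us @ (\<lambda>f. \<Sum>i\<in>I. c i * b i f) # ws) = (\<Sum>i\<in>I. c i * \<omega> (us @ b i # ws))"
  by (rule functional_lincomb[of A x "\<lambda>v. \<omega> (us @ v # ws)"])
     (use assms in \<open>auto simp: ext_fibre_def\<close>)

locale framed_manifold = atlas A for A :: "('m::t2_space, 'n::finite) chart set" +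
  fixes g :: "'m \<Rightarrow> 'm tvec \<Rightarrow> 'm tvec \<Rightarrow> real"
    and p q :: nat and U :: "'m set" and e :: "'n \<Rightarrow> 'm \<Rightarrow> 'm tvec"
  assumes metric: "pseudo_riemannian_metric A g p q"
    and open_U: "open U"
    and frame: "local_frame A U e"
begin

lemma frame_in [simp]: "x \<in> U \<Longrightarrow> e i x \<in> tangent_space A x"
  using frame by (auto simp: local_frame_def tangent_basis_def)

definition coeff :: "'m \<Rightarrow> 'm tvec \<Rightarrow> 'n \<Rightarrow> real" where
  "coeff x v = (THE c. v = (\<lambda>f. \<Sum>i\<in>UNIV. c i * e i x f))"

lemma frame_unique:
  assumes "x \<in> U" "v \<in> tangent_space A x"
  shows "\<exists>!c. v = (\<lambda>f. \<Sum>i\<in>UNIV. c i * e i x f)"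
  using assms frame by (auto simp: local_frame_def tangent_basis_def)

lemma coeff_expand:
  "x \<in> U \<Longrightarrow> v \<in> tangent_space A x \<Longrightarrow> (\<lambda>f. \<Sum>i\<in>UNIV. coeff x v i * e i x f) = v"
  unfolding coeff_def by (rule theI'[OF frame_unique, symmetric])

lemma coeff_eqI:
  assumes "x \<in> U" "v = (\<lambda>f. \<Sum>i\<in>UNIV. c i * e i x f)"
  shows "coeff x v = c"
proof -
  have "v \<in> tangent_space A x"
    unfolding assms(2) using assms(1) by (intro lincomb_in_tangent_space) auto
  show ?thesis unfolding coeff_def
    by (rule the1_equality[OF frame_unique[OF assms(1) \<open>v \<in> _\<close>]]) (rule assms(2))
qed

lemma coeff_frame: "x \<in> U \<Longrightarrow> coeff x (e j x) = (\<lambda>i. if i = j then 1 else 0)"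
  by (rule coeff_eqI) (simp_all add: if_distrib[of "\<lambda>a. a * _"] cong: if_cong)

lemma coeff_tcomb:
  assumes "x \<in> U" "v \<in> tangent_space A x" "w \<in> tangent_space A x"
  shows "coeff x (tcomb a v b w) = (\<lambda>i. a * coeff x v i + b * coeff x w i)"
proof (rule coeff_eqI[OF assms(1)])
  have "tcomb a v b w = tcomb a (\<lambda>f. \<Sum>i\<in>UNIV. coeff x v i * e i x f) b
      (\<lambda>f. \<Sum>i\<in>UNIV. coeff x w i * e i x f)"
    by (simp add: coeff_expand assms)
  then show "tcomb a v b w = (\<lambda>f. \<Sum>i\<in>UNIV. (a * coeff x v i + b * coeff x w i) * e i x f)"
    by (simp add: tcomb_def fun_eq_iff algebra_simps sum.distrib sum_distrib_left)
qed

lemma coeff_form_in: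
  assumes x: "x \<in> U"
  shows "(\<lambda>vs. if length vs = 1 \<and> hd vs \<in> tangent_space A x then coeff x (hd vs) i else 0)
    \<in> ext_fibre A x" (is "?\<alpha> \<in> _")
  unfolding ext_fibre_def
  proof (rule CollectI, intro conjI allI impI)
  fix vs :: "'m tvec list" assume "\<not> set vs \<subseteq> tangent_space A x"
  then show "?\<alpha> vs = 0" by (cases vs) auto
  next
  fix us ws v w a b assume s: "set (us @ v # w # ws) \<subseteq> tangent_space A x"
  show "?\<alpha> (us @ tcomb a v b w # ws) = a * ?\<alpha> (us @ v # ws) + b * ?\<alpha> (us @ w # ws)"
    using s x by (cases us) (auto simp: tcomb_in_tangent_space coeff_tcomb)
  next
  fix vs :: "'m tvec list" assume "\<not> distinct vs"
  then show "?\<alpha> vs = 0" by (cases vs) auto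
  qed

lemma coframe_eq:
  assumes x: "x \<in> U"
  shows "coframe A e i x =
    (\<lambda>vs. if length vs = 1 \<and> hd vs \<in> tangent_space A x then coeff x (hd vs) i else 0)"
    (is "_ = ?\<alpha>")
  unfolding coframe_def
proof (rule the_equality, intro conjI)
  show "?\<alpha> \<in> ext_fibre A x" by (rule coeff_form_in[OF x])
  show "of_degree 1 ?\<alpha>" by (auto simp: of_degree_def)
  show "\<forall>j. ?\<alpha> [e j x] = (if i = j then 1 else 0)" using x by (auto simp: coeff_frame)
next
  fix \<alpha> assume a: "\<alpha> \<in> ext_fibre A x \<and> of_degree 1 \<alpha> \<and> (\<forall>j. \<alpha> [e j x] = (if i = j then 1 else 0))"
  show "\<alpha> = ?\<alpha>"
  proof
    fix vs
    show "\<alpha> vs = ?\<alpha> vs"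
    proof (cases "length vs = 1 \<and> hd vs \<in> tangent_space A x")
      case True
      then obtain v where v: "vs = [v]" "v \<in> tangent_space A x" by (cases vs) auto
      have al: "\<alpha> [e j x] = (if i = j then 1 else 0)" for j using a by blast
      have "\<alpha> [v] = (\<Sum>j\<in>UNIV. coeff x v j * \<alpha> [e j x])"
        using ext_fibre_lincomb[of \<alpha> A x "[]" "[]" UNIV "\<lambda>j. e j x" "coeff x v"] a x
        by (simp add: coeff_expand[OF x v(2)])
      also have "\<dots> = coeff x v i"
        unfolding al by (simp add: if_distrib[of "\<lambda>a. _ * a"] cong: if_cong)
      finally show ?thesis using v by simp
    next
      case False
      then show ?thesis using a
        by (cases vs) (auto simp: of_degree_def ext_fibre_def)
    qed
  qed
qed

text \<open>Let \<open>P\<close> hold the frame components of the coordinate vectors and \<open>Q\<close> the chart components of the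
  frame.  Evaluating the expansion of a coordinate vector on coordinate functions gives \<open>P Q = 1\<close>.
  As the matrices are square, \<open>Q P = 1\<close> follows, so the coordinate vectors span the tangent space.
  In this way the dimension count contained in the existence of the frame replaces the usual
  Taylor expansion argument.\<close>
lemma frame_coord:
  assumes x: "x \<in> U" and c: "c \<in> A" "x \<in> fst c"
  defines "P \<equiv> (\<chi> a i. coeff x (coord_vec A c a x) i) :: real^'n^'n"
    and "Q \<equiv> (\<chi> i b. e i x (\<lambda>y. snd c y $ b)) :: real^'n^'n"
  shows "Q ** P = mat 1"
    and "e j x = (\<lambda>f. \<Sum>a\<in>UNIV. e j x (\<lambda>y. snd c y $ a) * coord_vec A c a x f)"
proof -
  have ex: "(\<lambda>f. \<Sum>i\<in>UNIV. P $ a $ i * e i x f) = coord_vec A c a x" for a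
    using coeff_expand[OF x coord_vec_in_tangent_space[OF c]] by (simp add: P_def)
  have "(\<Sum>i\<in>UNIV. P $ a $ i * Q $ i $ b) = (if a = b then 1 else 0)" for a b
    using fun_cong[OF ex[of a], of "\<lambda>y. snd c y $ b"] coord_vec_coord_fun[OF c] by (simp add: Q_def)
  then have "P ** Q = mat 1"
    by (simp add: matrix_matrix_mult_def vec_eq_iff mat_def)
  then show QP: "Q ** P = mat 1" by (simp add: matrix_left_right_inverse)
  have "(\<Sum>a\<in>UNIV. Q $ j $ a * P $ a $ i) = (if j = i then 1 else 0)" for i
    using QP by (simp add: matrix_matrix_mult_def vec_eq_iff mat_def)
  \<comment> \<open>The coordinate vectors are expanded in the frame, and \<open>Q P = 1\<close> contracts the double sum.\<close>
  then have QPs: "(\<Sum>a\<in>UNIV. Q $ j $ a * P $ a $ i) = (if j = i then 1 else 0)" for i .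
  have "(\<Sum>a\<in>UNIV. Q $ j $ a * coord_vec A c a x f) = e j x f" for f
  proof -
    have "(\<Sum>a\<in>UNIV. Q $ j $ a * coord_vec A c a x f) =
        (\<Sum>a\<in>UNIV. \<Sum>i\<in>UNIV. Q $ j $ a * P $ a $ i * e i x f)"
      by (simp only: fun_cong[OF ex, of _ f, symmetric] sum_distrib_left mult.assoc)
    also have "\<dots> = (\<Sum>i\<in>UNIV. (\<Sum>a\<in>UNIV. Q $ j $ a * P $ a $ i) * e i x f)"
      unfolding sum_distrib_right by (rule sum.swap)
    also have "\<dots> = e j x f"
      unfolding QPs by (simp add: if_distrib[of "\<lambda>a. a * _"] cong: if_cong)
    finally show ?thesis .
  qed
  then show "e j x = (\<lambda>f. \<Sum>a\<in>UNIV. e j x (\<lambda>y. snd c y $ a) * coord_vec A c a x f)"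
    by (intro ext) (simp add: Q_def)
qed

lemma open_chart_dom: "c \<in> A \<Longrightarrow> open (U \<inter> fst c)"
  using atlas open_U by (auto simp: smooth_atlas_def)

lemma frame_component_smooth:
  "c \<in> A \<Longrightarrow> smooth_fun_on A (U \<inter> fst c) (\<lambda>x. e i x (\<lambda>y. snd c y $ a))"
  using frame by (auto simp: local_frame_def smooth_vector_field_def)

text \<open>These components are the entries of the inverse of the smooth matrix of frame components.\<close>
lemma coframe_component_smooth:
  assumes c: "c \<in> A"
  shows "smooth_fun_on A (U \<inter> fst c) (\<lambda>x. coeff x (coord_vec A c a x) i)"
  using smooth_inverse_matrix[OF open_chart_dom[OF c],
    of "\<lambda>x. \<chi> i b. e i x (\<lambda>y. snd c y $ b)" "\<lambda>x. \<chi> a i. coeff x (coord_vec A c a x) i" a i]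
    frame_component_smooth[OF c] frame_coord(1) c
  by simp

abbreviation gram :: "'m \<Rightarrow> real^'n^'n" where
  "gram x \<equiv> \<chi> i j. g x (e i x) (e j x)"

lemma metric_tcomb:
  assumes "u \<in> tangent_space A x" "v \<in> tangent_space A x" "w \<in> tangent_space A x"
  shows "g x (tcomb a u b v) w = a * g x u w + b * g x v w"
proof -
  have "\<forall>x. \<forall>u\<in>tangent_space A x. \<forall>v\<in>tangent_space A x. \<forall>w\<in>tangent_space A x. \<forall>a b.
      g x (tcomb a u b v) w = a * g x u w + b * g x v w"
    using metric unfolding pseudo_riemannian_metric_def by (elim conjE) assumption
  then show ?thesis using assms by simp
qed

lemma metric_nondegenerate:
  assumes "v \<in> tangent_space A x" "\<And>w. w \<in> tangent_space A x \<Longrightarrow> g x v w = 0"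
  shows "v = (\<lambda>f. 0)"
proof -
  have "\<forall>x. \<forall>v\<in>tangent_space A x. (\<forall>w\<in>tangent_space A x. g x v w = 0) \<longrightarrow> v = (\<lambda>f. 0)"
    using metric unfolding pseudo_riemannian_metric_def by (elim conjE) assumption
  then show ?thesis using assms by simp
qed

lemma metric_coord_smooth:
  assumes "c \<in> A"
  shows "smooth_fun_on A (fst c) (\<lambda>x. g x (coord_vec A c i x) (coord_vec A c j x))"
proof -
  have "\<forall>c\<in>A. \<forall>i j. smooth_fun_on A (fst c) (\<lambda>x. g x (coord_vec A c i x) (coord_vec A c j x))"
    using metric unfolding pseudo_riemannian_metric_def by (elim conjE) assumption
  then show ?thesis using assms by simp
qed

lemma metric_lincomb_left:
  assumes "w \<in> tangent_space A x" "\<And>i. i \<in> I \<Longrightarrow> b i \<in> tangent_space A x"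
  shows "g x (\<lambda>f. \<Sum>i\<in>I. c i * b i f) w = (\<Sum>i\<in>I. c i * g x (b i) w)"
  by (rule functional_lincomb[of A x "\<lambda>v. g x v w"])
     (use assms in \<open>auto simp: metric_tcomb\<close>)

lemma metric_sym:
  "u \<in> tangent_space A x \<Longrightarrow> v \<in> tangent_space A x \<Longrightarrow> g x u v = g x v u"
  using metric unfolding pseudo_riemannian_metric_def by (elim conjE) simp

lemma metric_lincomb_right:
  assumes "w \<in> tangent_space A x" "\<And>i. i \<in> I \<Longrightarrow> b i \<in> tangent_space A x"
  shows "g x w (\<lambda>f. \<Sum>i\<in>I. c i * b i f) = (\<Sum>i\<in>I. c i * g x w (b i))"
  using assms metric_lincomb_left[OF assms]
  by (simp add: metric_sym[OF assms(1)] lincomb_in_tangent_space)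

text \<open>A vector in the kernel of the Gram matrix is orthogonal to the frame, hence to every vector.\<close>
lemma gram_invertible:
  assumes x: "x \<in> U"
  shows "invertible (gram x)"
proof -
  have "c = 0" if "gram x *v c = 0" for c
  proof -
    let ?v = "\<lambda>f. \<Sum>i\<in>UNIV. c $ i * e i x f"
    have v: "?v \<in> tangent_space A x" using x by (intro lincomb_in_tangent_space) auto
    have z: "g x (e j x) ?v = 0" for j
      using that x by (simp add: metric_lincomb_right vec_eq_iff matrix_vector_mult_def mult.commute)
    have "g x ?v w = 0" if w: "w \<in> tangent_space A x" for w
    proof -
      have "g x ?v w = g x w ?v" using metric_sym v w by blast
      also have "\<dots> = (\<Sum>j\<in>UNIV. coeff x w j * g x (e j x) ?v)"
        by (subst coeff_expand[OF x w, symmetric], rule metric_lincomb_left) (use v x in auto)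
      finally show ?thesis using z by simp
    qed
    then have "?v = (\<lambda>f. 0)"
      using metric_nondegenerate[OF v] by blast
    then have "coeff x (\<lambda>f. 0) = ($) c" using coeff_eqI[OF x, of "\<lambda>f. 0" "($) c"] by simp
    moreover have "coeff x (\<lambda>f. 0) = (\<lambda>i. 0)" by (rule coeff_eqI[OF x]) simp
    ultimately have "($) c = (\<lambda>i. 0)" by metis
    then show "c = 0" by (simp add: vec_eq_iff fun_eq_iff)
  qed
  then obtain B where "B ** gram x = mat 1" using matrix_left_invertible_ker[of "gram x"] by auto
  then show ?thesis by (auto simp: invertible_def matrix_left_right_inverse)
qed

text \<open>The functions \<open>g\<^sup>i\<^sup>j\<close> of Graf's formula.\<close>
definition ginv :: "'m \<Rightarrow> 'n \<Rightarrow> 'n \<Rightarrow> real" where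
  "ginv x i j = cometric A g x (coframe A e i x) (coframe A e j x)"

abbreviation gram_inv :: "'m \<Rightarrow> real^'n^'n" where
  "gram_inv x \<equiv> matrix_inv (gram x)"

lemma gram_inv: "x \<in> U \<Longrightarrow> gram x ** gram_inv x = mat 1"
  using someI_ex[OF gram_invertible[unfolded invertible_def]] unfolding matrix_inv_def by blast

lemma gram_inv_sum:
  "x \<in> U \<Longrightarrow> (\<Sum>j\<in>UNIV. g x (e i x) (e j x) * gram_inv x $ j $ k) = (if i = k then 1 else 0)"
  using gram_inv[of x] by (simp add: matrix_matrix_mult_def vec_eq_iff mat_def)

lemma gram_inv_sym:
  assumes "x \<in> U" shows "gram_inv x $ i $ j = gram_inv x $ j $ i"
proof -
  have "transpose (gram x) = gram x"
    using assms by (simp add: transpose_def vec_eq_iff metric_sym)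
  then have l: "transpose (gram_inv x) ** gram x = mat 1"
    using arg_cong[OF gram_inv[OF assms], of transpose]
    by (simp only: matrix_transpose_mul transpose_mat)
  have "transpose (gram_inv x) = transpose (gram_inv x) ** (gram x ** gram_inv x)"
    by (simp only: gram_inv[OF assms] matrix_mul_rid)
  also have "\<dots> = gram_inv x"
    by (simp only: matrix_mul_assoc l matrix_mul_lid)
  finally have "transpose (gram_inv x) = gram_inv x" .
  from arg_cong[OF this, of "\<lambda>M. M $ j $ i"] show ?thesis by (simp add: transpose_def)
qed

lemma sharp_eq:
  assumes x: "x \<in> U" and a: "\<alpha> \<in> ext_fibre A x"
  shows "sharp A g x \<alpha> = (\<lambda>f. \<Sum>j\<in>UNIV. (\<Sum>i\<in>UNIV. gram_inv x $ j $ i * \<alpha> [e i x]) * e j x f)"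
    (is "_ = ?s")
  unfolding sharp_def
proof (rule the_equality, intro conjI ballI)
  show s: "?s \<in> tangent_space A x" using x by (intro lincomb_in_tangent_space) auto
  show gs: "g x ?s w = \<alpha> [w]" if w: "w \<in> tangent_space A x" for w
  proof -
    have eq: "g x (e k x) ?s = \<alpha> [e k x]" for k
    proof -
      have "g x (e k x) ?s = (\<Sum>j\<in>UNIV. (\<Sum>i\<in>UNIV. gram_inv x $ j $ i * \<alpha> [e i x]) * g x (e k x) (e j x))"
        using x by (intro metric_lincomb_right) auto
      also have "\<dots> = (\<Sum>i\<in>UNIV. (\<Sum>j\<in>UNIV. g x (e k x) (e j x) * gram_inv x $ j $ i) * \<alpha> [e i x])"
        unfolding sum_distrib_right by (subst sum.swap) (simp add: algebra_simps)
      also have "\<dots> = \<alpha> [e k x]"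
        by (simp only: gram_inv_sum[OF x]) (simp add: if_distrib[of "\<lambda>a. a * _"] cong: if_cong)
      finally show ?thesis .
    qed
    have "g x w ?s = (\<Sum>k\<in>UNIV. coeff x w k * g x (e k x) ?s)"
      by (subst coeff_expand[OF x w, symmetric], rule metric_lincomb_left) (use s x in auto)
    also have "\<dots> = (\<Sum>k\<in>UNIV. coeff x w k * \<alpha> [e k x])" by (simp only: eq)
    also have "\<dots> = \<alpha> [w]"
      using ext_fibre_lincomb[OF a, of "[]" "[]" UNIV "\<lambda>k. e k x" "coeff x w"] x
      by (simp add: coeff_expand[OF x w])
    finally show ?thesis using metric_sym[OF s w] by simp
  qed
  fix v assume v: "v \<in> tangent_space A x \<and> (\<forall>w\<in>tangent_space A x. g x v w = \<alpha> [w])"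
  have "g x (tcomb 1 v (-1) ?s) w = 1 * g x v w + (-1) * g x ?s w" if "w \<in> tangent_space A x" for w
    using v s that by (intro metric_tcomb) auto
  then have "\<forall>w\<in>tangent_space A x. g x (tcomb 1 v (-1) ?s) w = 0" using v gs by simp
  moreover have "tcomb 1 v (-1) ?s \<in> tangent_space A x" using v s tcomb_in_tangent_space by blast
  ultimately have "tcomb 1 v (-1) ?s = (\<lambda>f. 0)"
    using metric_nondegenerate by blast
  then show "v = ?s" by (simp add: tcomb_def fun_eq_iff)
qed

text \<open>Musical isomorphisms disappear from the computation: \<open>sharp\<close> of a one-form has the components
  obtained by applying the inverse Gram matrix, and pairing with a frame vector recovers the form.\<close>
lemma cometric_gram:
  assumes x: "x \<in> U" and a: "\<alpha> \<in> ext_fibre A x" and b: "\<beta> \<in> ext_fibre A x"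
  shows "cometric A g x \<alpha> \<beta> = (\<Sum>i\<in>UNIV. \<Sum>j\<in>UNIV. gram_inv x $ i $ j * \<alpha> [e i x] * \<beta> [e j x])"
proof -
  let ?s = "sharp A g x \<alpha>"
  let ?t = "sharp A g x \<beta>"
  have s: "?s \<in> tangent_space A x"
    unfolding sharp_eq[OF x a] using x by (intro lincomb_in_tangent_space) auto
  have eq: "g x ?s (e j x) = \<alpha> [e j x]" for j
  proof -
    have "g x ?s (e j x) = (\<Sum>k\<in>UNIV. (\<Sum>i\<in>UNIV. gram_inv x $ k $ i * \<alpha> [e i x]) * g x (e k x) (e j x))"
      unfolding sharp_eq[OF x a] using x by (intro metric_lincomb_left) auto
    also have "\<dots> = (\<Sum>i\<in>UNIV. (\<Sum>k\<in>UNIV. g x (e j x) (e k x) * gram_inv x $ k $ i) * \<alpha> [e i x])"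
      unfolding sum_distrib_right using x
      by (subst sum.swap) (simp add: algebra_simps metric_sym)
    also have "\<dots> = \<alpha> [e j x]"
      by (simp only: gram_inv_sum[OF x]) (simp add: if_distrib[of "\<lambda>a. a * _"] cong: if_cong)
    finally show ?thesis .
  qed
  have "g x ?s ?t = (\<Sum>j\<in>UNIV. (\<Sum>i\<in>UNIV. gram_inv x $ j $ i * \<beta> [e i x]) * g x ?s (e j x))"
    unfolding sharp_eq[OF x b] using x s by (intro metric_lincomb_right) auto
  also have "\<dots> = (\<Sum>i\<in>UNIV. \<Sum>j\<in>UNIV. gram_inv x $ i $ j * \<alpha> [e i x] * \<beta> [e j x])"
    by (simp add: eq sum_distrib_left sum_distrib_right algebra_simps)
  finally show ?thesis by (simp add: cometric_def)
qed

lemma coframe_in: "x \<in> U \<Longrightarrow> coframe A e i x \<in> ext_fibre A x"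
  by (simp only: coframe_eq coeff_form_in)

lemma coframe_frame: "x \<in> U \<Longrightarrow> coframe A e i x [e j x] = (if i = j then 1 else 0)"
  by (simp add: coframe_eq coeff_frame)

lemma ginv_eq: "x \<in> U \<Longrightarrow> ginv x i j = gram_inv x $ i $ j"
  by (simp add: ginv_def cometric_gram coframe_in coframe_frame
      if_distrib[of "\<lambda>a. a * _"] if_distrib[of "\<lambda>a. _ * a"] cong: if_cong)

lemma ginv_sym: "x \<in> U \<Longrightarrow> ginv x i j = ginv x j i"
  by (simp add: ginv_eq gram_inv_sym)

lemma cometric_eq:
  assumes "x \<in> U" "\<alpha> \<in> ext_fibre A x" "\<beta> \<in> ext_fibre A x"
  shows "cometric A g x \<alpha> \<beta> = (\<Sum>i\<in>UNIV. \<Sum>j\<in>UNIV. ginv x i j * \<alpha> [e i x] * \<beta> [e j x])"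
  using assms by (simp add: cometric_gram ginv_eq)

lemma ginv_smooth:
  assumes c: "c \<in> A"
  shows "smooth_fun_on A (U \<inter> fst c) (\<lambda>x. ginv x i j)"
proof -
  note o = open_chart_dom[OF c]
  have "smooth_fun_on A (U \<inter> fst c) (\<lambda>x. g x (e i x) (e j x))" for i j
  proof -
    let ?E = "\<lambda>i a x. e i x (\<lambda>y. snd c y $ a)"
    have gs: "smooth_fun_on A (U \<inter> fst c) (\<lambda>x. g x (coord_vec A c a x) (coord_vec A c b x))" for a b
      by (rule smooth_fun_on_subset[OF metric_coord_smooth[OF c]]) auto
    have "smooth_fun_on A (U \<inter> fst c) (\<lambda>x. \<Sum>a\<in>UNIV. \<Sum>b\<in>UNIV.
        ?E i a x * (?E j b x * g x (coord_vec A c a x) (coord_vec A c b x)))"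
      by (intro smooth_sum smooth_mult frame_component_smooth gs o c)
    moreover have "(\<Sum>a\<in>UNIV. \<Sum>b\<in>UNIV.
        ?E i a x * (?E j b x * g x (coord_vec A c a x) (coord_vec A c b x))) = g x (e i x) (e j x)"
      if "x \<in> U \<inter> fst c" for x
    proof -
      have x: "x \<in> U" "x \<in> fst c" using that by auto
      note cv = coord_vec_in_tangent_space[OF c x(2)]
      have "g x (e i x) (e j x) = g x (\<lambda>f. \<Sum>a\<in>UNIV. ?E i a x * coord_vec A c a x f) (e j x)"
        by (rule arg_cong[of _ _ "\<lambda>v. g x v (e j x)"]) (rule frame_coord(2)[OF x(1) c x(2)])
      also have "\<dots> = (\<Sum>a\<in>UNIV. ?E i a x * g x (coord_vec A c a x) (e j x))"
        using x cv by (intro metric_lincomb_left) auto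
      also have "\<dots> = (\<Sum>a\<in>UNIV. ?E i a x *
          g x (coord_vec A c a x) (\<lambda>f. \<Sum>b\<in>UNIV. ?E j b x * coord_vec A c b x f))"
        by (simp only: frame_coord(2)[OF x(1) c x(2), of j, symmetric])
      also have "\<dots> = (\<Sum>a\<in>UNIV. ?E i a x *
          (\<Sum>b\<in>UNIV. ?E j b x * g x (coord_vec A c a x) (coord_vec A c b x)))"
        using cv by (simp add: metric_lincomb_right)
      finally show ?thesis by (simp add: sum_distrib_left)
    qed
    ultimately show ?thesis by (rule smooth_cong[OF o, rotated])
  qed
  then have "smooth_fun_on A (U \<inter> fst c) (\<lambda>x. gram_inv x $ i $ j)"
    using smooth_inverse_matrix[OF o, of gram gram_inv i j] gram_inv by simp
  then show ?thesis
    using smooth_cong[OF o, of "\<lambda>x. gram_inv x $ i $ j" "\<lambda>x. ginv x i j"] by (simp add: ginv_eq)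
qed

end

section \<open>The exterior product of forms at a point\<close>

text \<open>Interior product at a point.\<close>
definition contract :: "'v \<Rightarrow> ('v list \<Rightarrow> real) \<Rightarrow> 'v list \<Rightarrow> real" where
  "contract v \<alpha> = (\<lambda>vs. \<alpha> (v # vs))"

text \<open>The grade involution: the sign \<open>(-1)\<^sup>k\<close> on \<open>k\<close>-forms, applied to all degrees at once.\<close>
definition invol :: "('v list \<Rightarrow> real) \<Rightarrow> 'v list \<Rightarrow> real" where
  "invol \<alpha> = (\<lambda>vs. (-1) ^ length vs * \<alpha> vs)"

text \<open>The shuffle product computed by deciding where the first argument goes.  If it goes to \<open>\<beta>\<close>, it has
  to pass all arguments of \<open>\<alpha>\<close>, and the grade involution of \<open>\<alpha>\<close> records the resulting sign.
  Identities of the wedge product thus become inductions on the list of arguments, and most of them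
  hold for arbitrary functions on lists, alternating or not.\<close>
fun ext_prod :: "('v list \<Rightarrow> real) \<Rightarrow> ('v list \<Rightarrow> real) \<Rightarrow> 'v list \<Rightarrow> real" where
  "ext_prod \<alpha> \<beta> [] = \<alpha> [] * \<beta> []"
| "ext_prod \<alpha> \<beta> (v # vs) = ext_prod (contract v \<alpha>) \<beta> vs + ext_prod (invol \<alpha>) (contract v \<beta>) vs"

text \<open>Subsets of the positions of \<open>v # vs\<close> are split into those that contain position 0 and those that do
  not.\<close>
lemma sum_Pow_lessThan_Suc:
  "(\<Sum>I\<in>Pow {..<Suc n}. F I) =
     (\<Sum>I\<in>Pow {..<n}. F (insert 0 (Suc ` I))) + (\<Sum>I\<in>Pow {..<n}. F (Suc ` I) :: real)"
proof -
  have P: "Pow (Suc ` {..<n}) = image Suc ` Pow {..<n}"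
    by (rule image_Pow_surj[OF refl, symmetric])
  have inj: "inj_on (image Suc) X" for X by (rule inj_on_subset[of _ UNIV]) (auto simp: inj_image_eq_iff intro: injI)
  have inj': "inj_on (insert 0) (image Suc ` Pow {..<n})"
    by (rule inj_onI) (auto simp: insert_eq_iff)
  have "(\<Sum>I\<in>Pow {..<Suc n}. F I) = (\<Sum>I\<in>image Suc ` Pow {..<n}. F I) +
      (\<Sum>I\<in>insert 0 ` image Suc ` Pow {..<n}. F I)"
    unfolding lessThan_Suc_eq_insert_0 Pow_insert P
    by (rule sum.union_disjoint) auto
  also have "\<dots> = (\<Sum>I\<in>Pow {..<n}. F (Suc ` I)) + (\<Sum>I\<in>Pow {..<n}. F (insert 0 (Suc ` I)))"
    by (simp only: sum.reindex[OF inj'] sum.reindex[OF inj] comp_def)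
  finally show ?thesis by simp
qed

definition shuffle_inversions :: "nat \<Rightarrow> nat set \<Rightarrow> (nat \<times> nat) set" where
  "shuffle_inversions n I = {(i, j). i \<in> I \<and> j \<in> {..<n} - I \<and> j < i}"

lemma finite_shuffle_inversions:
  assumes "I \<subseteq> {..<n}" shows "finite (shuffle_inversions n I)"
  by (rule finite_subset[of _ "{..<n} \<times> {..<n}"]) (use assms in \<open>auto simp: shuffle_inversions_def\<close>)

lemma shuffle_inversions_insert:
  "shuffle_inversions (Suc n) (insert 0 (Suc ` I)) = map_prod Suc Suc ` shuffle_inversions n I"
  unfolding shuffle_inversions_def
  by (auto simp: image_iff less_Suc_eq_0_disj gr0_conv_Suc)

lemma shuffle_inversions_Suc:
  "shuffle_inversions (Suc n) (Suc ` I) =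
     map_prod Suc Suc ` shuffle_inversions n I \<union> (\<lambda>i. (Suc i, 0)) ` I"
  unfolding shuffle_inversions_def
  by (auto simp: image_iff less_Suc_eq_0_disj gr0_conv_Suc)

text \<open>Position 0 creates no inversion when it is selected; when it is not, it is inverted with every
  selected position.\<close>
lemma card_shuffle_inversions:
  assumes I: "I \<subseteq> {..<n}"
  shows "card (shuffle_inversions (Suc n) (insert 0 (Suc ` I))) = card (shuffle_inversions n I)"
    and "card (shuffle_inversions (Suc n) (Suc ` I)) = card (shuffle_inversions n I) + card I"
proof -
  have fI: "finite I" using I finite_subset by blast
  have inj: "inj_on (map_prod Suc Suc) X" for X
    by (rule inj_on_subset[of _ UNIV]) (auto intro: prod.inj_map)
  show "card (shuffle_inversions (Suc n) (insert 0 (Suc ` I))) = card (shuffle_inversions n I)"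
    by (simp add: shuffle_inversions_insert card_image[OF inj])
  have "card (shuffle_inversions (Suc n) (Suc ` I)) =
      card (map_prod Suc Suc ` shuffle_inversions n I) + card ((\<lambda>i. (Suc i, 0::nat)) ` I)"
    unfolding shuffle_inversions_Suc
    by (rule card_Un_disjoint) (use fI finite_shuffle_inversions[OF I] in auto)
  also have "card ((\<lambda>i. (Suc i, 0::nat)) ` I) = card I"
    by (rule card_image) (auto intro: inj_onI)
  finally show "card (shuffle_inversions (Suc n) (Suc ` I)) = card (shuffle_inversions n I) + card I"
    by (simp add: card_image[OF inj])
qed

lemma wedge_eq_ext_prod: "wedge \<alpha> \<beta> x = ext_prod (\<alpha> x) (\<beta> x)"
proof -
  define S where "S \<alpha> \<beta> vs = (\<Sum>I\<in>Pow {..<length vs}.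
      (-1) ^ card (shuffle_inversions (length vs) I) * \<alpha> (nths vs I) * \<beta> (nths vs (- I)))"
    for \<alpha> \<beta> :: "'a tvec list \<Rightarrow> real" and vs
  have n1: "nths (v # vs) (insert 0 (Suc ` I)) = v # nths vs I" for v :: "'a tvec" and vs I
    by (auto simp: nths_Cons image_iff)
  have n2: "nths (v # vs) (Suc ` I) = nths vs I" for v :: "'a tvec" and vs I
    by (auto simp: nths_Cons image_iff)
  have n3: "nths (v # vs) (- insert 0 (Suc ` I)) = nths vs (- I)" for v :: "'a tvec" and vs I
  proof -
    have "{j. Suc j \<in> - insert 0 (Suc ` I)} = - I" by auto
    then show ?thesis by (simp add: nths_Cons)
  qed
  have n4: "nths (v # vs) (- Suc ` I) = v # nths vs (- I)" for v :: "'a tvec" and vs I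
  proof -
    have "{j. Suc j \<in> - Suc ` I} = - I" by auto
    then show ?thesis by (auto simp: nths_Cons)
  qed
  have "S \<alpha> \<beta> vs = ext_prod \<alpha> \<beta> vs" for \<alpha> \<beta> vs
  proof (induction vs arbitrary: \<alpha> \<beta>)
    case Nil
    then show ?case by (simp add: S_def shuffle_inversions_def)
  next
    case (Cons v vs)
    have l: "length (nths vs I) = card I" if "I \<subseteq> {..<length vs}" for I
      using that by (auto simp: length_nths intro!: arg_cong[of _ _ card])
    have "S \<alpha> \<beta> (v # vs) = S (contract v \<alpha>) \<beta> vs + S (invol \<alpha>) (contract v \<beta>) vs"
      unfolding S_def length_Cons sum_Pow_lessThan_Suc n1 n2 n3 n4
      by (intro arg_cong2[of _ _ _ _ "(+)"] sum.cong refl)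
         (auto simp: card_shuffle_inversions contract_def invol_def l power_add)
    then show ?case using Cons by simp
  qed
  then show ?thesis
    by (auto simp: wedge_def S_def shuffle_inversions_def fun_eq_iff)
qed

lemma contract_lincomb:
  "contract v (\<lambda>vs. a * \<alpha> vs + b * \<beta> vs) = (\<lambda>vs. a * contract v \<alpha> vs + b * contract v \<beta> vs)"
  by (simp add: contract_def)

lemma invol_lincomb:
  "invol (\<lambda>vs. a * \<alpha> vs + b * \<beta> vs) = (\<lambda>vs. a * invol \<alpha> vs + b * invol \<beta> vs)"
  by (simp add: invol_def algebra_simps)

lemma invol_invol [simp]: "invol (invol \<alpha>) = \<alpha>"
  by (simp add: invol_def mult.assoc[symmetric] power_add[symmetric] flip: mult_2)

lemma contract_invol: "contract v (invol \<alpha>) = (\<lambda>vs. - invol (contract v \<alpha>) vs)"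
  by (simp add: invol_def contract_def)

lemma ext_prod_lincomb_left:
  "ext_prod (\<lambda>vs. a * \<alpha> vs + b * \<alpha>' vs) \<beta> vs = a * ext_prod \<alpha> \<beta> vs + b * ext_prod \<alpha>' \<beta> vs"
  by (induction vs arbitrary: \<alpha> \<alpha>' \<beta>) (simp_all add: contract_lincomb invol_lincomb algebra_simps)

lemma ext_prod_lincomb_right:
  "ext_prod \<alpha> (\<lambda>vs. a * \<beta> vs + b * \<beta>' vs) vs = a * ext_prod \<alpha> \<beta> vs + b * ext_prod \<alpha> \<beta>' vs"
  by (induction vs arbitrary: \<alpha> \<beta> \<beta>') (simp_all add: contract_lincomb algebra_simps)

text \<open>For products that are linear in each argument: the one rule on two-term combinations yields the
  rewrite rules for zero, sums, differences, negatives, multiples and finite sums.\<close>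
lemma linear_functional_rules:
  fixes L :: "('v list \<Rightarrow> real) \<Rightarrow> real"
  assumes L: "\<And>a b \<alpha> \<beta>. L (\<lambda>vs. a * \<alpha> vs + b * \<beta> vs) = a * L \<alpha> + b * L \<beta>"
  shows "L (\<lambda>vs. 0) = 0" and "L (\<lambda>vs. \<alpha> vs + \<beta> vs) = L \<alpha> + L \<beta>"
    and "L (\<lambda>vs. \<alpha> vs - \<beta> vs) = L \<alpha> - L \<beta>" and "L (\<lambda>vs. - \<alpha> vs) = - L \<alpha>"
    and "L (\<lambda>vs. c * \<alpha> vs) = c * L \<alpha>"
    and "L (\<lambda>vs. \<Sum>i\<in>I. \<gamma> i vs) = (\<Sum>i\<in>I. L (\<gamma> i))"
proof -
  show z: "L (\<lambda>vs. 0) = 0" using L[of 0 _ 0] by simp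
  show add: "L (\<lambda>vs. \<alpha> vs + \<beta> vs) = L \<alpha> + L \<beta>" for \<alpha> \<beta> using L[of 1 \<alpha> 1 \<beta>] by simp
  show "L (\<lambda>vs. \<alpha> vs - \<beta> vs) = L \<alpha> - L \<beta>" using L[of 1 \<alpha> "-1" \<beta>] by simp
  show "L (\<lambda>vs. - \<alpha> vs) = - L \<alpha>" using L[of "-1" \<alpha> 0 \<alpha>] by simp
  show "L (\<lambda>vs. c * \<alpha> vs) = c * L \<alpha>" using L[of c \<alpha> 0 \<alpha>] by simp
  show "L (\<lambda>vs. \<Sum>i\<in>I. \<gamma> i vs) = (\<Sum>i\<in>I. L (\<gamma> i))"
    by (induction I rule: infinite_finite_induct) (simp_all add: z add)
qed

lemmas ext_prod_left = linear_functional_rules[of "\<lambda>\<alpha>. ext_prod \<alpha> \<beta> vs" for \<beta> vs, OF ext_prod_lincomb_left]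
lemmas ext_prod_right = linear_functional_rules[of "\<lambda>\<beta>. ext_prod \<alpha> \<beta> vs" for \<alpha> vs, OF ext_prod_lincomb_right]

lemma contract_ext_prod:
  "contract v (ext_prod \<alpha> \<beta>) = (\<lambda>vs. ext_prod (contract v \<alpha>) \<beta> vs + ext_prod (invol \<alpha>) (contract v \<beta>) vs)"
  by (simp add: contract_def[of v "ext_prod \<alpha> \<beta>"])

lemma invol_ext_prod: "invol (ext_prod \<alpha> \<beta>) = ext_prod (invol \<alpha>) (invol \<beta>)"
proof -
  have "(-1) ^ length vs * ext_prod \<alpha> \<beta> vs = ext_prod (invol \<alpha>) (invol \<beta>) vs" for vs
  proof (induction vs arbitrary: \<alpha> \<beta>)
    case (Cons v vs)
    have "(-1) ^ length (v # vs) * ext_prod \<alpha> \<beta> (v # vs) =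
       - ((-1) ^ length vs * ext_prod (contract v \<alpha>) \<beta> vs)
       - ((-1) ^ length vs * ext_prod (invol \<alpha>) (contract v \<beta>) vs)"
      by (simp add: algebra_simps)
    then show ?case unfolding Cons by (simp add: contract_invol ext_prod_left ext_prod_right)
  qed (simp add: invol_def)
  then show ?thesis by (simp add: fun_eq_iff invol_def[of "ext_prod \<alpha> \<beta>"])
qed

lemma ext_prod_assoc: "ext_prod (ext_prod \<alpha> \<beta>) \<gamma> vs = ext_prod \<alpha> (ext_prod \<beta> \<gamma>) vs"
  by (induction vs arbitrary: \<alpha> \<beta> \<gamma>)
     (simp_all add: contract_ext_prod invol_ext_prod ext_prod_left ext_prod_right)

definition unit_form :: "'v list \<Rightarrow> real" where
  "unit_form vs = (if vs = [] then 1 else 0)"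

lemma invol_unit_form [simp]: "invol unit_form = unit_form"
  by (auto simp: invol_def unit_form_def)

lemma contract_unit_form [simp]: "contract v unit_form = (\<lambda>vs. 0)"
  by (simp add: contract_def unit_form_def)

lemma ext_prod_unit_left [simp]: "ext_prod unit_form \<beta> vs = \<beta> vs"
  by (induction vs arbitrary: \<beta>) (simp_all add: ext_prod_left, simp_all add: unit_form_def contract_def)

lemma ext_prod_unit_right [simp]: "ext_prod \<alpha> unit_form vs = \<alpha> vs"
  by (induction vs arbitrary: \<alpha>) (simp_all add: ext_prod_right, simp_all add: unit_form_def contract_def)

lemma contract_of_degree: "of_degree k \<alpha> \<Longrightarrow> of_degree (k - 1) (contract v \<alpha>)"
  by (auto simp: of_degree_def contract_def)

lemma contract_of_degree_0: "of_degree 0 \<alpha> \<Longrightarrow> contract v \<alpha> = (\<lambda>vs. 0)"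
  by (auto simp: of_degree_def contract_def)

lemma invol_of_degree: "of_degree k \<alpha> \<Longrightarrow> invol \<alpha> = (\<lambda>vs. (-1) ^ k * \<alpha> vs)"
  by (auto simp: of_degree_def invol_def fun_eq_iff)

lemma ext_prod_commute:
  assumes "of_degree r \<alpha>" "of_degree s \<beta>"
  shows "ext_prod \<alpha> \<beta> vs = (-1) ^ (r * s) * ext_prod \<beta> \<alpha> vs"
  using assms
proof (induction vs arbitrary: r s \<alpha> \<beta>)
  case Nil
  then show ?case by (cases r; cases s) (auto simp: of_degree_def)
next
  case (Cons v vs)
  have 1: "ext_prod (contract v \<alpha>) \<beta> vs = (-1) ^ (r * s + s) * ext_prod \<beta> (contract v \<alpha>) vs"
  proof (cases r)
    case 0
    then show ?thesis using Cons.prems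
      by (simp add: contract_of_degree_0 ext_prod_left ext_prod_right)
  next
    case (Suc r')
    then show ?thesis using Cons.IH[OF contract_of_degree[OF Cons.prems(1)] Cons.prems(2), of v]
      by (simp add: power_add algebra_simps flip: mult_2 power_mult_distrib)
  qed
  have 2: "ext_prod \<alpha> (contract v \<beta>) vs = (-1) ^ (r * s + r) * ext_prod (contract v \<beta>) \<alpha> vs"
  proof (cases s)
    case 0
    then show ?thesis using Cons.prems
      by (simp add: contract_of_degree_0 ext_prod_left ext_prod_right)
  next
    case (Suc s')
    then show ?thesis using Cons.IH[OF Cons.prems(1) contract_of_degree[OF Cons.prems(2)], of v]
      by (simp add: power_add algebra_simps flip: mult_2 power_mult_distrib)
  qed
  have sq: "(-1) ^ k * ((-1) ^ k * y) = y" for k :: nat and y :: real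
    by (simp add: mult.assoc[symmetric] flip: power_mult_distrib)
  show ?case
    by (simp add: 1 2 invol_of_degree[OF Cons.prems(1)] invol_of_degree[OF Cons.prems(2)]
        ext_prod_left) (simp add: power_add algebra_simps sq)
qed

section \<open>The Graf product at a point\<close>

text \<open>Contracted wedge products in which the grade involution follows every contraction of the left
  factor.  On an \<open>r\<close>-form the involutions contribute \<open>(r - 1) + (r - 2) + \<dots> + (r - l)\<close> to the exponent
  of the sign, which has the parity of the exponent in Graf's formula.  The gain is that the signs are
  no longer tied to a degree, so both factors may be inhomogeneous.\<close>
primrec signed_contracted ::
    "('n::finite \<Rightarrow> 'n \<Rightarrow> real) \<Rightarrow> ('n \<Rightarrow> 'v) \<Rightarrow> nat \<Rightarrow> ('v list \<Rightarrow> real) \<Rightarrow> ('v list \<Rightarrow> real) \<Rightarrow>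
      'v list \<Rightarrow> real" where
  "signed_contracted h b 0 = ext_prod"
| "signed_contracted h b (Suc l) = (\<lambda>\<alpha> \<beta> vs. \<Sum>i\<in>UNIV. \<Sum>j\<in>UNIV.
     h i j * signed_contracted h b l (invol (contract (b i) \<alpha>)) (contract (b j) \<beta>) vs)"

lemma signed_contracted_lincomb_left:
  "signed_contracted h b l (\<lambda>vs. c * \<alpha> vs + d * \<alpha>' vs) \<beta> vs =
   c * signed_contracted h b l \<alpha> \<beta> vs + d * signed_contracted h b l \<alpha>' \<beta> vs"
  by (induction l arbitrary: \<alpha> \<alpha>' \<beta>)
     (simp_all add: ext_prod_lincomb_left contract_lincomb invol_lincomb algebra_simps
       sum_distrib_left sum.distrib)

lemma signed_contracted_lincomb_right:
  "signed_contracted h b l \<alpha> (\<lambda>vs. c * \<beta> vs + d * \<beta>' vs) vs =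
   c * signed_contracted h b l \<alpha> \<beta> vs + d * signed_contracted h b l \<alpha> \<beta>' vs"
  by (induction l arbitrary: \<alpha> \<beta> \<beta>')
     (simp_all add: ext_prod_lincomb_right contract_lincomb algebra_simps
       sum_distrib_left sum.distrib)

lemmas signed_contracted_left =
  linear_functional_rules[of "\<lambda>\<alpha>. signed_contracted h b l \<alpha> \<beta> vs" for h b l \<beta> vs, OF signed_contracted_lincomb_left]
lemmas signed_contracted_right =
  linear_functional_rules[of "\<lambda>\<beta>. signed_contracted h b l \<alpha> \<beta> vs" for h b l \<alpha> vs, OF signed_contracted_lincomb_right]

text \<open>Contraction of \<open>\<beta>\<close> by the vector metrically dual to the one-form \<open>\<theta>\<close>, where \<open>h\<close> is the reciprocal
  metric in the frame \<open>b\<close>.\<close>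
definition contract_form :: "('n::finite \<Rightarrow> 'n \<Rightarrow> real) \<Rightarrow> ('n \<Rightarrow> 'v) \<Rightarrow> ('v list \<Rightarrow> real) \<Rightarrow>
    ('v list \<Rightarrow> real) \<Rightarrow> 'v list \<Rightarrow> real" where
  "contract_form h b \<theta> \<beta> = (\<lambda>vs. \<Sum>i\<in>UNIV. \<Sum>j\<in>UNIV. h i j * \<theta> [b i] * contract (b j) \<beta> vs)"

lemma contract_form_degree_1:
  assumes "of_degree 1 \<theta>"
  shows "contract v \<theta> = (\<lambda>vs. \<theta> [v] * unit_form vs)"
  using assms by (auto simp: of_degree_def contract_def unit_form_def fun_eq_iff)

lemma contract_oneform_ext_prod:
  assumes "of_degree 1 \<theta>"
  shows "contract v (ext_prod \<theta> \<alpha>) = (\<lambda>vs. \<theta> [v] * \<alpha> vs - ext_prod \<theta> (contract v \<alpha>) vs)"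
  by (simp add: contract_ext_prod contract_form_degree_1[OF assms] invol_of_degree[OF assms]
      ext_prod_left)

lemma ext_fibre_iff:
  "\<omega> \<in> ext_fibre A x \<longleftrightarrow>
     (\<forall>vs. \<not> set vs \<subseteq> tangent_space A x \<longrightarrow> \<omega> vs = 0) \<and>
     (\<forall>us ws v w a b. set us \<subseteq> tangent_space A x \<longrightarrow> v \<in> tangent_space A x \<longrightarrow>
        w \<in> tangent_space A x \<longrightarrow> set ws \<subseteq> tangent_space A x \<longrightarrow>
        \<omega> (us @ tcomb a v b w # ws) = a * \<omega> (us @ v # ws) + b * \<omega> (us @ w # ws)) \<and>
     (\<forall>vs. \<not> distinct vs \<longrightarrow> \<omega> vs = 0)"
  unfolding ext_fibre_def by auto

lemma ext_fibre_contract: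
  assumes "\<alpha> \<in> ext_fibre A x" "v \<in> tangent_space A x"
  shows "contract v \<alpha> \<in> ext_fibre A x"
  unfolding ext_fibre_iff
proof (intro conjI allI impI)
  fix us ws u w a b
  assume "set us \<subseteq> tangent_space A x" "u \<in> tangent_space A x" "w \<in> tangent_space A x"
    "set ws \<subseteq> tangent_space A x"
  moreover have "set (v # us) \<subseteq> tangent_space A x" using calculation assms(2) by simp
  ultimately have "\<alpha> ((v # us) @ tcomb a u b w # ws) =
      a * \<alpha> ((v # us) @ u # ws) + b * \<alpha> ((v # us) @ w # ws)"
    using assms(1) unfolding ext_fibre_iff by blast
  then show "contract v \<alpha> (us @ tcomb a u b w # ws) =
      a * contract v \<alpha> (us @ u # ws) + b * contract v \<alpha> (us @ w # ws)"
    by (simp add: contract_def)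
qed (use assms in \<open>auto simp: ext_fibre_iff contract_def\<close>)

lemma ext_fibre_invol:
  assumes "\<alpha> \<in> ext_fibre A x" shows "invol \<alpha> \<in> ext_fibre A x"
  using assms unfolding ext_fibre_iff invol_def by (auto simp: algebra_simps)

lemma ext_fibre_scale_add:
  assumes "\<alpha> \<in> ext_fibre A x" "\<beta> \<in> ext_fibre A x"
  shows "(\<lambda>vs. a * \<alpha> vs + b * \<beta> vs) \<in> ext_fibre A x"
  using assms unfolding ext_fibre_iff by (auto simp: algebra_simps)

lemma ext_fibre_zero: "(\<lambda>vs. 0) \<in> ext_fibre A x"
  unfolding ext_fibre_iff by auto

lemma ext_fibre_outside:
  "\<alpha> \<in> ext_fibre A x \<Longrightarrow> \<not> set vs \<subseteq> tangent_space A x \<Longrightarrow> \<alpha> vs = 0"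
  unfolding ext_fibre_iff by blast

lemma ext_fibre_not_distinct:
  "\<alpha> \<in> ext_fibre A x \<Longrightarrow> \<not> distinct vs \<Longrightarrow> \<alpha> vs = 0"
  unfolding ext_fibre_iff by blast

lemma ext_fibre_tcomb:
  assumes "\<alpha> \<in> ext_fibre A x" "set us \<subseteq> tangent_space A x" "v \<in> tangent_space A x"
    "w \<in> tangent_space A x" "set ws \<subseteq> tangent_space A x"
  shows "\<alpha> (us @ tcomb a v b w # ws) = a * \<alpha> (us @ v # ws) + b * \<alpha> (us @ w # ws)"
  using assms unfolding ext_fibre_iff by blast

text \<open>Bilinear expansion of the value at a repeated sum \<open>u + v\<close>.\<close>
lemma ext_fibre_swap:
  assumes \<alpha>: "\<alpha> \<in> ext_fibre A x"
  shows "\<alpha> (u # v # vs) = - \<alpha> (v # u # vs)"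
proof (cases "set (u # v # vs) \<subseteq> tangent_space A x")
  case True
  let ?s = "tcomb 1 u 1 v"
  have T: "?s \<in> tangent_space A x" using True by (simp add: tcomb_in_tangent_space)
  have "0 = \<alpha> ([] @ ?s # ?s # vs)" using ext_fibre_not_distinct[OF \<alpha>] by simp
  also have "\<dots> = 1 * \<alpha> ([] @ u # ?s # vs) + 1 * \<alpha> ([] @ v # ?s # vs)"
    by (rule ext_fibre_tcomb[OF \<alpha>]) (use True T in auto)
  also have "\<dots> = \<alpha> ([u] @ ?s # vs) + \<alpha> ([v] @ ?s # vs)" by simp
  also have "\<alpha> ([u] @ ?s # vs) = 1 * \<alpha> ([u] @ u # vs) + 1 * \<alpha> ([u] @ v # vs)"
    by (rule ext_fibre_tcomb[OF \<alpha>]) (use True T in auto)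
  also have "\<alpha> ([v] @ ?s # vs) = 1 * \<alpha> ([v] @ u # vs) + 1 * \<alpha> ([v] @ v # vs)"
    by (rule ext_fibre_tcomb[OF \<alpha>]) (use True T in auto)
  finally show ?thesis
    using ext_fibre_not_distinct[OF \<alpha>, of "u # u # vs"] ext_fibre_not_distinct[OF \<alpha>, of "v # v # vs"]
    by simp
next
  case False
  then show ?thesis
    using ext_fibre_outside[OF \<alpha>, of "u # v # vs"] ext_fibre_outside[OF \<alpha>, of "v # u # vs"] by auto
qed

lemma contract_swap:
  assumes "\<alpha> \<in> ext_fibre A x"
  shows "contract u (contract v \<alpha>) = (\<lambda>vs. - contract v (contract u \<alpha>) vs)"
  unfolding contract_def by (rule ext) (rule ext_fibre_swap[OF assms])

text \<open>Moving the contraction by \<open>v\<close> past the contraction by \<open>b i\<close> costs a sign, and moving it past the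
  involution costs another one, so in the first term the signs cancel.  In the second term the two signs
  come from moving \<open>v\<close> past \<open>b j\<close> in \<open>\<beta>\<close> and the outer involution past \<open>b i\<close> in \<open>\<alpha>\<close>.\<close>
lemma contract_signed_contracted:
  assumes "\<alpha> \<in> ext_fibre A x" "\<beta> \<in> ext_fibre A x" and b: "\<And>i. b i \<in> tangent_space A x"
  shows "contract v (signed_contracted h b l \<alpha> \<beta>) = (\<lambda>vs.
    signed_contracted h b l (contract v \<alpha>) \<beta> vs + signed_contracted h b l (invol \<alpha>) (contract v \<beta>) vs)"
  using assms(1,2)
proof (induction l arbitrary: \<alpha> \<beta>)
  case 0
  then show ?case by (simp add: contract_ext_prod)
next
  case (Suc l)
  have a: "invol (contract (b i) \<alpha>) \<in> ext_fibre A x" for i using Suc.prems b ext_fibre_contract ext_fibre_invol by blast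
  have c: "contract (b i) \<beta> \<in> ext_fibre A x" for i using Suc.prems b ext_fibre_contract by blast
  have 1: "contract v (invol (contract (b i) \<alpha>)) = invol (contract (b i) (contract v \<alpha>))" for i
    unfolding contract_invol contract_swap[OF Suc.prems(1), of v] by (simp add: invol_def)
  have 2: "signed_contracted h b l (invol (contract (b i) (invol \<alpha>))) (contract (b j) (contract v \<beta>)) vs =
     signed_contracted h b l (invol (invol (contract (b i) \<alpha>))) (contract v (contract (b j) \<beta>)) vs" for i j vs
  proof -
    have "invol (contract (b i) (invol \<alpha>)) = (\<lambda>vs. - invol (invol (contract (b i) \<alpha>)) vs)"
      unfolding contract_invol by (simp add: invol_def)
    moreover have "contract (b j) (contract v \<beta>) = (\<lambda>vs. - contract v (contract (b j) \<beta>) vs)"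
      using contract_swap[OF Suc.prems(2)] .
    ultimately show ?thesis by (simp only: signed_contracted_left signed_contracted_right minus_minus)
  qed
  have "contract v (signed_contracted h b (Suc l) \<alpha> \<beta>) = (\<lambda>vs. \<Sum>i\<in>UNIV. \<Sum>j\<in>UNIV. h i j *
     contract v (signed_contracted h b l (invol (contract (b i) \<alpha>)) (contract (b j) \<beta>)) vs)"
    unfolding contract_def[of v] by simp
  also have "\<dots> = (\<lambda>vs. \<Sum>i\<in>UNIV. \<Sum>j\<in>UNIV. h i j *
     (signed_contracted h b l (invol (contract (b i) (contract v \<alpha>))) (contract (b j) \<beta>) vs +
      signed_contracted h b l (invol (contract (b i) (invol \<alpha>))) (contract (b j) (contract v \<beta>)) vs))"
    unfolding Suc.IH[OF a c] 1 2 ..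
  finally show ?case by (simp add: distrib_left sum.distrib)
qed

lemma contract_form_swap:
  assumes "\<beta> \<in> ext_fibre A x"
  shows "contract v (contract_form h b \<theta> \<beta>) = (\<lambda>vs. - contract_form h b \<theta> (contract v \<beta>) vs)"
proof -
  have "contract v (contract_form h b \<theta> \<beta>) =
      (\<lambda>vs. \<Sum>i\<in>UNIV. \<Sum>j\<in>UNIV. h i j * \<theta> [b i] * contract v (contract (b j) \<beta>) vs)"
    by (simp add: contract_form_def contract_def)
  then show ?thesis
    unfolding contract_swap[OF assms, of v] by (simp add: contract_form_def sum_negf)
qed

text \<open>Each of the \<open>Suc l\<close> contractions of \<open>\<theta> \<and> \<alpha>\<close> may hit \<open>\<theta>\<close>.  If one does, it leaves a scalar, and the
  matching contraction of \<open>\<beta>\<close> becomes the contraction by the vector dual to \<open>\<theta>\<close>; all \<open>Suc l\<close> choices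
  contribute equally, whence the factor.  It turns \<open>1 / fact (Suc l)\<close> into \<open>1 / fact l\<close> in the Graf
  product.\<close>
lemma signed_contracted_oneform:
  assumes "\<alpha> \<in> ext_fibre A x" "\<beta> \<in> ext_fibre A x" and b: "\<And>i. b i \<in> tangent_space A x" and \<theta>: "of_degree 1 \<theta>"
  shows "signed_contracted h b (Suc l) (ext_prod \<theta> \<alpha>) \<beta> vs =
    ext_prod \<theta> (signed_contracted h b (Suc l) \<alpha> \<beta>) vs +
    real (Suc l) * signed_contracted h b l (invol \<alpha>) (contract_form h b \<theta> \<beta>) vs"
  using assms(1,2)
proof (induction l arbitrary: \<alpha> \<beta> vs)
  let ?W = "signed_contracted h b"
  have inv: "invol (contract (b i) (ext_prod \<theta> \<alpha>)) =
      (\<lambda>vs. \<theta> [b i] * invol \<alpha> vs + ext_prod \<theta> (invol (contract (b i) \<alpha>)) vs)" for i \<alpha>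
  proof -
    have "invol (contract (b i) (ext_prod \<theta> \<alpha>)) =
        (\<lambda>vs. \<theta> [b i] * invol \<alpha> vs - invol (ext_prod \<theta> (contract (b i) \<alpha>)) vs)"
      by (simp add: contract_oneform_ext_prod[OF \<theta>] invol_def algebra_simps)
    then show ?thesis
      by (simp add: invol_ext_prod invol_of_degree[OF \<theta>] ext_prod_left)
  qed
  have expand: "?W (Suc l) (ext_prod \<theta> \<alpha>) \<beta> vs = ?W l (invol \<alpha>) (contract_form h b \<theta> \<beta>) vs +
      (\<Sum>i\<in>UNIV. \<Sum>j\<in>UNIV. h i j * ?W l (ext_prod \<theta> (invol (contract (b i) \<alpha>))) (contract (b j) \<beta>) vs)"
    for l \<alpha> \<beta> vs
    by (simp add: inv signed_contracted_left contract_form_def signed_contracted_right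
        distrib_left sum.distrib mult.assoc)
  have pull: "ext_prod \<theta> (?W (Suc l) \<alpha> \<beta>) vs = (\<Sum>i\<in>UNIV. \<Sum>j\<in>UNIV. h i j *
      ext_prod \<theta> (?W l (invol (contract (b i) \<alpha>)) (contract (b j) \<beta>)) vs)" for l \<alpha> \<beta> vs
    by (simp add: ext_prod_right)
  {
    case 0
    show ?case unfolding expand pull by (simp add: ext_prod_assoc)
  next
    case (Suc l)
    have a: "invol (contract (b i) \<alpha>) \<in> ext_fibre A x" for i using Suc.prems b ext_fibre_contract ext_fibre_invol by blast
    have c: "contract (b i) \<beta> \<in> ext_fibre A x" for i using Suc.prems b ext_fibre_contract by blast
    have m1: "invol (contract (b i) (invol \<alpha>)) = (\<lambda>vs. - contract (b i) \<alpha> vs)" for i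
      unfolding contract_invol
      by (simp add: invol_def)
    have "?W (Suc l) (invol \<alpha>) (contract_form h b \<theta> \<beta>) vs =
      (\<Sum>i\<in>UNIV. \<Sum>j\<in>UNIV. h i j *
        ?W l (contract (b i) \<alpha>) (contract_form h b \<theta> (contract (b j) \<beta>)) vs)"
      by (simp add: m1 contract_form_swap[OF Suc.prems(2)] signed_contracted_left signed_contracted_right)
    then have m: "(\<Sum>i\<in>UNIV. \<Sum>j\<in>UNIV. h i j * (real (Suc l) *
        ?W l (contract (b i) \<alpha>) (contract_form h b \<theta> (contract (b j) \<beta>)) vs)) =
      real (Suc l) * ?W (Suc l) (invol \<alpha>) (contract_form h b \<theta> \<beta>) vs"
      by (simp only: sum_distrib_left mult.left_commute)
    show ?case
      unfolding expand[of "Suc l"] Suc.IH[OF a c] pull[of "Suc l"] invol_invol distrib_left sum.distrib m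
      by (simp add: algebra_simps)
  }
qed

text \<open>Two equal entries can be moved next to each other at the cost of signs, and swapping them then gives
  a real number equal to its own negative.\<close>
lemma adjacent_swap_not_distinct:
  fixes \<omega> :: "'v list \<Rightarrow> real"
  assumes swap: "\<And>us u v ws. \<omega> (us @ u # v # ws) = - \<omega> (us @ v # u # ws)"
    and "\<not> distinct vs"
  shows "\<omega> vs = 0"
proof -
  have "\<omega> (us @ v # ys @ v # ws) = 0" for us v ys ws
  proof (induction ys arbitrary: us)
    case Nil
    then show ?case using swap[of us v v ws] by simp
  next
    case (Cons y ys)
    then show ?case using swap[of us v y "ys @ v # ws"] Cons[of "us @ [y]"] by simp
  qed
  moreover obtain us ys ws v where "vs = us @ [v] @ ys @ [v] @ ws"
    using not_distinct_decomp[OF assms(2)] by blast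
  ultimately show ?thesis by simp
qed

lemma ext_prod_swap:
  assumes "\<alpha> \<in> ext_fibre A x" "\<beta> \<in> ext_fibre A x"
  shows "ext_prod \<alpha> \<beta> (us @ u # v # ws) = - ext_prod \<alpha> \<beta> (us @ v # u # ws)"
  using assms
proof (induction us arbitrary: \<alpha> \<beta>)
  case Nil
  then show ?case
    by (simp add: contract_swap[OF Nil(1), of v] contract_swap[OF Nil(2), of v] contract_invol
        ext_prod_left ext_prod_right)
next
  case (Cons y us)
  show ?case
  proof (cases "y \<in> tangent_space A x")
    case True
    then show ?thesis using Cons by (simp add: ext_fibre_contract ext_fibre_invol)
  next
    case False
    then have "contract y \<alpha> = (\<lambda>vs. 0)" "contract y \<beta> = (\<lambda>vs. 0)"
      using Cons.prems by (auto simp: contract_def fun_eq_iff intro: ext_fibre_outside)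
    then show ?thesis by (simp add: ext_prod_left ext_prod_right)
  qed
qed

lemma contract_outside:
  assumes "\<alpha> \<in> ext_fibre A x" "v \<notin> tangent_space A x"
  shows "contract v \<alpha> = (\<lambda>vs. 0)"
  using assms by (auto simp: contract_def fun_eq_iff intro: ext_fibre_outside)

lemma contract_tcomb:
  assumes "\<alpha> \<in> ext_fibre A x" "v \<in> tangent_space A x" "w \<in> tangent_space A x"
  shows "contract (tcomb a v b w) \<alpha> = (\<lambda>vs. a * contract v \<alpha> vs + b * contract w \<alpha> vs)"
proof
  fix vs
  show "contract (tcomb a v b w) \<alpha> vs = a * contract v \<alpha> vs + b * contract w \<alpha> vs"
  proof (cases "set vs \<subseteq> tangent_space A x")
    case True
    then show ?thesis using ext_fibre_tcomb[OF assms(1), of "[]" v w vs a b] assms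
      by (simp add: contract_def)
  next
    case False
    then show ?thesis using assms(1) by (simp add: contract_def ext_fibre_outside)
  qed
qed

lemma ext_fibre_ext_prod:
  assumes "\<alpha> \<in> ext_fibre A x" "\<beta> \<in> ext_fibre A x"
  shows "ext_prod \<alpha> \<beta> \<in> ext_fibre A x"
  unfolding ext_fibre_iff
proof (intro conjI allI impI)
  fix vs :: "'a tvec list" assume "\<not> set vs \<subseteq> tangent_space A x"
  then show "ext_prod \<alpha> \<beta> vs = 0" using assms
  proof (induction vs arbitrary: \<alpha> \<beta>)
    case (Cons v vs)
    show ?case
    proof (cases "v \<in> tangent_space A x")
      case True
      then show ?thesis using Cons by (simp add: ext_fibre_contract ext_fibre_invol)
    next
      case False
      then show ?thesis
        using contract_outside[OF Cons.prems(2)] contract_outside[OF Cons.prems(3)]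
        by (simp add: ext_prod_left ext_prod_right)
    qed
  qed simp
next
  fix us ws :: "'a tvec list" and v w a b
  assume "set us \<subseteq> tangent_space A x" and *: "v \<in> tangent_space A x"
    "w \<in> tangent_space A x" "set ws \<subseteq> tangent_space A x"
  then show "ext_prod \<alpha> \<beta> (us @ tcomb a v b w # ws) =
      a * ext_prod \<alpha> \<beta> (us @ v # ws) + b * ext_prod \<alpha> \<beta> (us @ w # ws)"
    using assms
  proof (induction us arbitrary: \<alpha> \<beta>)
    case Nil
    then show ?case
      by (simp add: contract_tcomb[OF Nil(5)] contract_tcomb[OF Nil(6)]
          ext_prod_lincomb_left ext_prod_lincomb_right algebra_simps)
  next
    case (Cons y us)
    then have "contract y \<alpha> \<in> ext_fibre A x" "contract y \<beta> \<in> ext_fibre A x" "invol \<alpha> \<in> ext_fibre A x"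
      by (auto intro: ext_fibre_contract ext_fibre_invol)
    then show ?case using Cons.IH[of "contract y \<alpha>" \<beta>] Cons.IH[of "invol \<alpha>" "contract y \<beta>"] Cons.prems
      by (simp add: algebra_simps)
  qed
next
  fix vs :: "'a tvec list" assume "\<not> distinct vs"
  then show "ext_prod \<alpha> \<beta> vs = 0"
    by (rule adjacent_swap_not_distinct[rotated]) (rule ext_prod_swap[OF assms])
qed

text \<open>In contrast to \<open>of_degree\<close> this bounds the degrees of inhomogeneous forms.\<close>
definition vanishes_from :: "nat \<Rightarrow> ('v list \<Rightarrow> real) \<Rightarrow> bool" where
  "vanishes_from k \<alpha> \<longleftrightarrow> (\<forall>vs. k \<le> length vs \<longrightarrow> \<alpha> vs = 0)"

lemma vanishes_from_invol: "vanishes_from k \<alpha> \<Longrightarrow> vanishes_from k (invol \<alpha>)"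
  by (simp add: vanishes_from_def invol_def)

lemma vanishes_from_contract: "vanishes_from (Suc k) \<alpha> \<Longrightarrow> vanishes_from k (contract v \<alpha>)"
  by (simp add: vanishes_from_def contract_def)

lemma of_degree_vanishes_from: "of_degree k \<alpha> \<Longrightarrow> k < l \<Longrightarrow> vanishes_from l \<alpha>"
  by (auto simp: of_degree_def vanishes_from_def)

lemma signed_contracted_vanish_left:
  "vanishes_from l \<alpha> \<Longrightarrow> signed_contracted h b l \<alpha> \<beta> vs = 0"
proof (induction l arbitrary: \<alpha> \<beta>)
  case 0
  then have "\<alpha> = (\<lambda>vs. 0)" by (auto simp: vanishes_from_def)
  then show ?case by (simp add: ext_prod_left)
next
  case (Suc l)
  then show ?case by (simp add: vanishes_from_invol vanishes_from_contract)
qed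

lemma signed_contracted_vanish_right:
  "vanishes_from l \<beta> \<Longrightarrow> signed_contracted h b l \<alpha> \<beta> vs = 0"
proof (induction l arbitrary: \<alpha> \<beta>)
  case 0
  then have "\<beta> = (\<lambda>vs. 0)" by (auto simp: vanishes_from_def)
  then show ?case by (simp add: ext_prod_right)
next
  case (Suc l)
  then show ?case by (simp add: vanishes_from_contract)
qed

text \<open>The Graf product at a point for forms of mixed degree.  The bound \<open>N\<close> has to be at least the degree of
  one factor for this to be the whole sum; a common bound for all forms keeps the product
  bilinear.\<close>
definition graf :: "nat \<Rightarrow> ('n::finite \<Rightarrow> 'n \<Rightarrow> real) \<Rightarrow> ('n \<Rightarrow> 'v) \<Rightarrow> ('v list \<Rightarrow> real) \<Rightarrow>
    ('v list \<Rightarrow> real) \<Rightarrow> 'v list \<Rightarrow> real" where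
  "graf N h b \<alpha> \<beta> = (\<lambda>vs. \<Sum>l\<le>N. signed_contracted h b l \<alpha> \<beta> vs / fact l)"

lemma graf_lincomb_left:
  "graf N h b (\<lambda>vs. c * \<alpha> vs + d * \<alpha>' vs) \<beta> vs = c * graf N h b \<alpha> \<beta> vs + d * graf N h b \<alpha>' \<beta> vs"
  by (simp add: graf_def signed_contracted_lincomb_left add_divide_distrib sum.distrib sum_distrib_left)

lemma graf_lincomb_right:
  "graf N h b \<alpha> (\<lambda>vs. c * \<beta> vs + d * \<beta>' vs) vs = c * graf N h b \<alpha> \<beta> vs + d * graf N h b \<alpha> \<beta>' vs"
  by (simp add: graf_def signed_contracted_lincomb_right add_divide_distrib sum.distrib sum_distrib_left)

lemmas graf_left = linear_functional_rules[of "\<lambda>\<alpha>. graf N h b \<alpha> \<beta> vs" for N h b \<beta> vs, OF graf_lincomb_left]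
lemmas graf_right = linear_functional_rules[of "\<lambda>\<beta>. graf N h b \<alpha> \<beta> vs" for N h b \<alpha> vs, OF graf_lincomb_right]

lemma graf_bound_irrelevant:
  assumes "vanishes_from (Suc M) \<alpha>" "M \<le> N"
  shows "graf N h b \<alpha> \<beta> vs = graf M h b \<alpha> \<beta> vs"
  unfolding graf_def
proof (rule sum.mono_neutral_right)
  have "vanishes_from l \<alpha>" if "M < l" for l
    using assms(1) that by (auto simp: vanishes_from_def)
  then show "\<forall>l\<in>{..N} - {..M}. signed_contracted h b l \<alpha> \<beta> vs / fact l = 0"
    by (auto simp: signed_contracted_vanish_left)
qed (use assms in auto)

text \<open>Only the terms with \<open>l \<le> 1\<close> survive.\<close>
lemma graf_oneform_left:
  assumes \<theta>: "of_degree 1 \<theta>" and "N \<ge> 1"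
  shows "graf N h b \<theta> \<beta> vs = ext_prod \<theta> \<beta> vs + contract_form h b \<theta> \<beta> vs"
proof -
  have i: "invol (contract v \<theta>) = (\<lambda>vs. \<theta> [v] * unit_form vs)" for v
    by (auto simp: contract_form_degree_1[OF \<theta>] invol_def unit_form_def)
  have "graf N h b \<theta> \<beta> vs = graf 1 h b \<theta> \<beta> vs"
    by (rule graf_bound_irrelevant) (use assms of_degree_vanishes_from in auto)
  also have "\<dots> = ext_prod \<theta> \<beta> vs + contract_form h b \<theta> \<beta> vs"
    by (simp add: graf_def i ext_prod_left contract_form_def mult.assoc)
  finally show ?thesis .
qed

lemma graf_unit_left: "graf N h b unit_form \<beta> vs = \<beta> vs"
proof -
  have "graf N h b unit_form \<beta> vs = graf 0 h b unit_form \<beta> vs"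
    by (rule graf_bound_irrelevant) (auto simp: vanishes_from_def unit_form_def)
  then show ?thesis by (simp add: graf_def)
qed

lemma graf_unit_right:
  fixes \<alpha> :: "'v list \<Rightarrow> real"
  shows "graf N h b \<alpha> unit_form vs = \<alpha> vs"
proof -
  have "vanishes_from l (unit_form :: 'v list \<Rightarrow> real)" if "0 < l" for l
    using that by (auto simp: vanishes_from_def unit_form_def)
  then have "signed_contracted h b l \<alpha> unit_form vs = 0" if "l \<noteq> 0" for l
    using that by (simp add: signed_contracted_vanish_right)
  then have "graf N h b \<alpha> unit_form vs = (\<Sum>l\<le>0. signed_contracted h b l \<alpha> unit_form vs / fact l)"
    unfolding graf_def by (intro sum.mono_neutral_right) auto
  then show ?thesis by simp
qed

lemma contract_graf:
  assumes "\<alpha> \<in> ext_fibre A x" "\<beta> \<in> ext_fibre A x" and b: "\<And>i. b i \<in> tangent_space A x"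
  shows "contract v (graf N h b \<alpha> \<beta>) = (\<lambda>vs. graf N h b (contract v \<alpha>) \<beta> vs + graf N h b (invol \<alpha>) (contract v \<beta>) vs)"
proof -
  have "contract v (graf N h b \<alpha> \<beta>) = (\<lambda>vs. \<Sum>l\<le>N. contract v (signed_contracted h b l \<alpha> \<beta>) vs / fact l)"
    by (simp add: graf_def contract_def)
  then show ?thesis
    unfolding contract_signed_contracted[OF assms]
    by (simp add: graf_def add_divide_distrib sum.distrib)
qed

lemma contract_form_graf:
  assumes "\<alpha> \<in> ext_fibre A x" "\<beta> \<in> ext_fibre A x" and b: "\<And>i. b i \<in> tangent_space A x"
  shows "contract_form h b \<theta> (graf N h b \<alpha> \<beta>) vs =
    graf N h b (contract_form h b \<theta> \<alpha>) \<beta> vs + graf N h b (invol \<alpha>) (contract_form h b \<theta> \<beta>) vs"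
  by (simp add: contract_form_def contract_graf[OF assms] graf_left graf_right distrib_left sum.distrib)

text \<open>Summing \<open>signed_contracted_oneform\<close> shifts the index of the second summand by one; the hypothesis on
  \<open>\<alpha>\<close> makes the term lost at the upper end zero.\<close>
lemma graf_oneform_ext_prod:
  assumes \<alpha>: "\<alpha> \<in> ext_fibre A x" and \<beta>: "\<beta> \<in> ext_fibre A x"
    and b: "\<And>i. b i \<in> tangent_space A x" and \<theta>: "of_degree 1 \<theta>"
    and van: "vanishes_from N \<alpha>"
  shows "graf N h b (ext_prod \<theta> \<alpha>) \<beta> vs =
    ext_prod \<theta> (graf N h b \<alpha> \<beta>) vs + graf N h b (invol \<alpha>) (contract_form h b \<theta> \<beta>) vs"
proof -
  let ?W = "signed_contracted h b" let ?R = "\<lambda>l. ?W l (invol \<alpha>) (contract_form h b \<theta> \<beta>) vs"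
  have W: "?W l (ext_prod \<theta> \<alpha>) \<beta> vs / fact l =
      ext_prod \<theta> (?W l \<alpha> \<beta>) vs / fact l + (case l of 0 \<Rightarrow> 0 | Suc k \<Rightarrow> ?R k / fact k)" for l
  proof (cases l)
    case (Suc k)
    have "(1 + real k) \<noteq> 0" by (simp add: add_nonneg_eq_0_iff)
    then show ?thesis unfolding Suc
      by (simp add: signed_contracted_oneform[OF \<alpha> \<beta> b \<theta>] add_divide_distrib del: signed_contracted.simps(2))
  qed (simp add: ext_prod_assoc)
  have "graf N h b (ext_prod \<theta> \<alpha>) \<beta> vs = (\<Sum>l\<le>N. ext_prod \<theta> (?W l \<alpha> \<beta>) vs / fact l) +
      (\<Sum>l\<le>N. case l of 0 \<Rightarrow> 0 | Suc k \<Rightarrow> ?R k / fact k)"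
    by (simp only: graf_def W sum.distrib)
  also have "(\<Sum>l\<le>N. ext_prod \<theta> (?W l \<alpha> \<beta>) vs / fact l) = ext_prod \<theta> (graf N h b \<alpha> \<beta>) vs"
    using ext_prod_right(6)[of \<theta> "\<lambda>l vs. 1 / fact l * ?W l \<alpha> \<beta> vs" "{..N}" vs]
    by (simp only: ext_prod_right(5)) (simp add: graf_def)
  also have "(\<Sum>l\<le>N. case l of 0 \<Rightarrow> 0 | Suc k \<Rightarrow> ?R k / fact k) = (\<Sum>k<N. ?R k / fact k)"
    by (simp only: sum.atMost_shift) simp
  also have "\<dots> = (\<Sum>k\<le>N. ?R k / fact k)"
    using signed_contracted_vanish_left[OF vanishes_from_invol[OF van], of h b "contract_form h b \<theta> \<beta>" vs]
    by (simp add: lessThan_Suc_atMost[symmetric])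
  finally show ?thesis by (simp add: graf_def)
qed

text \<open>The contraction by the dual of \<open>\<theta>\<close> is an antiderivation of the Graf product.  Its term on the second
  factor is exactly what \<open>graf_oneform_ext_prod\<close> adds to \<open>(\<theta> \<and> \<alpha>) \<diamond> \<beta>\<close>.\<close>
lemma graf_oneform_assoc:
  assumes \<alpha>: "\<alpha> \<in> ext_fibre A x" and \<beta>: "\<beta> \<in> ext_fibre A x"
    and b: "\<And>i. b i \<in> tangent_space A x" and \<theta>: "of_degree 1 \<theta>"
    and van: "vanishes_from N \<alpha>" and N: "N \<ge> 1"
  shows "graf N h b (graf N h b \<theta> \<alpha>) \<beta> vs = graf N h b \<theta> (graf N h b \<alpha> \<beta>) vs"
proof -
  have "graf N h b \<theta> \<alpha> = (\<lambda>vs. ext_prod \<theta> \<alpha> vs + contract_form h b \<theta> \<alpha> vs)"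
    using graf_oneform_left[OF \<theta> N] by blast
  then show ?thesis
    by (simp add: graf_left graf_oneform_ext_prod[OF \<alpha> \<beta> b \<theta> van] graf_oneform_left[OF \<theta> N]
        contract_form_graf[OF \<alpha> \<beta> b])
qed

text \<open>The contracted wedge product of the definition of \<open>\<diamond>\<close>, at a point.\<close>
primrec plain_contracted ::
    "('n::finite \<Rightarrow> 'n \<Rightarrow> real) \<Rightarrow> ('n \<Rightarrow> 'v) \<Rightarrow> nat \<Rightarrow> ('v list \<Rightarrow> real) \<Rightarrow> ('v list \<Rightarrow> real) \<Rightarrow>
      'v list \<Rightarrow> real" where
  "plain_contracted h b 0 = ext_prod"
| "plain_contracted h b (Suc l) = (\<lambda>\<alpha> \<beta> vs. \<Sum>i\<in>UNIV. \<Sum>j\<in>UNIV.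
     h i j * plain_contracted h b l (contract (b i) \<alpha>) (contract (b j) \<beta>) vs)"

lemma sign_eqI: "even a = even b \<Longrightarrow> (-1 :: real) ^ a = (-1) ^ b"
  by (cases "even a") auto

lemma signed_contracted_sign:
  assumes "of_degree r \<alpha>" "l \<le> r"
  shows "signed_contracted h b l \<alpha> \<beta> vs =
    (-1) ^ (l * (r - l) + l div 2) * plain_contracted h b l \<alpha> \<beta> vs"
  using assms
proof (induction l arbitrary: \<alpha> \<beta> r)
  case (Suc l)
  obtain m where r: "r = Suc l + m" using Suc.prems(2) le_Suc_ex by blast
  have d: "of_degree (l + m) (contract (b i) \<alpha>)" for i
    using contract_of_degree[OF Suc.prems(1), of "b i"] r by simp
  have "even ((l + m) + (l * m + l div 2)) = even (Suc l * m + Suc l div 2)"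
  proof (cases "even l")
    case True
    then obtain k where "l = 2 * k" by (rule evenE)
    then show ?thesis by auto
  next
    case False
    then obtain k where "l = 2 * k + 1" by (rule oddE)
    then show ?thesis by auto
  qed
  then have s: "(-1 :: real) ^ (l + m) * (-1) ^ (l * m + l div 2) = (-1) ^ (Suc l * m + Suc l div 2)"
    unfolding power_add[symmetric] by (rule sign_eqI)
  have "signed_contracted h b l (invol (contract (b i) \<alpha>)) (contract (b j) \<beta>) vs =
      (-1) ^ (Suc l * m + Suc l div 2) * plain_contracted h b l (contract (b i) \<alpha>) (contract (b j) \<beta>) vs"
    for i j
    unfolding invol_of_degree[OF d] signed_contracted_left Suc.IH[OF d le_add1]
    by (simp only: diff_add_inverse mult.assoc[symmetric] s)
  then show ?case by (simp add: r sum_distrib_left algebra_simps)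
qed simp

lemma plain_contracted_commute:
  assumes h: "\<And>i j. h i j = h j i"
    and "of_degree r \<alpha>" "of_degree s \<beta>" "l \<le> r" "l \<le> s"
  shows "plain_contracted h b l \<alpha> \<beta> vs =
    (-1) ^ ((r - l) * (s - l)) * plain_contracted h b l \<beta> \<alpha> vs"
  using assms(2-)
proof (induction l arbitrary: \<alpha> \<beta> r s)
  case 0
  then show ?case using ext_prod_commute[OF 0(1,2)] by simp
next
  case (Suc l)
  have d: "of_degree (r - 1) (contract v \<alpha>)" "of_degree (s - 1) (contract v \<beta>)" for v
    by (rule contract_of_degree[OF Suc.prems(1)], rule contract_of_degree[OF Suc.prems(2)])
  have "l \<le> r - 1" "l \<le> s - 1" using Suc.prems by auto
  note IH = Suc.IH[OF d this]
  have "h i j * plain_contracted h b l (contract (b i) \<alpha>) (contract (b j) \<beta>) vs =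
      (-1) ^ ((r - Suc l) * (s - Suc l)) * (h j i * plain_contracted h b l (contract (b j) \<beta>) (contract (b i) \<alpha>) vs)"
    for i j unfolding h[of i j] IH[of "b i" "b j"] by simp
  then have "plain_contracted h b (Suc l) \<alpha> \<beta> vs = (\<Sum>i\<in>UNIV. \<Sum>j\<in>UNIV.
      (-1) ^ ((r - Suc l) * (s - Suc l)) * (h j i * plain_contracted h b l (contract (b j) \<beta>) (contract (b i) \<alpha>) vs))"
    unfolding plain_contracted.simps by presburger
  also have "\<dots> = (-1) ^ ((r - Suc l) * (s - Suc l)) * plain_contracted h b (Suc l) \<beta> \<alpha> vs"
    by (subst sum.swap) (simp add: sum_distrib_left)
  finally show ?case .
qed

text \<open>Graf's two cases agree: exchanging the factors of the \<open>l\<close>-th term costs the sign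
  \<open>(-1)\<^bsup>(r - l)(s - l)\<^esup>\<close>, and modulo 2 the exponents differ by just this.\<close>
lemma graf_of_degree:
  assumes h: "\<And>i j. h i j = h j i" and d: "of_degree r \<alpha>" "of_degree s \<beta>"
    and N: "min r s \<le> N"
  shows "(if r \<le> s
     then \<Sum>l\<le>r. (-1) ^ (l * (r - l) + l div 2) / fact l * plain_contracted h b l \<alpha> \<beta> vs
     else (-1) ^ (r * s) *
       (\<Sum>l\<le>s. (-1) ^ (l * (s - l + 1) + l div 2) / fact l * plain_contracted h b l \<beta> \<alpha> vs)) =
     graf N h b \<alpha> \<beta> vs" (is "?L = _")
proof -
  have "?L = (\<Sum>l\<le>min r s. signed_contracted h b l \<alpha> \<beta> vs / fact l)"
  proof (cases "r \<le> s")
    case True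
    then show ?thesis by (auto simp: signed_contracted_sign[OF d(1)] min_def intro!: sum.cong)
  next
    case False
    have "(-1) ^ (r * s) * ((-1) ^ (l * (s - l + 1) + l div 2) / fact l * plain_contracted h b l \<beta> \<alpha> vs) =
        signed_contracted h b l \<alpha> \<beta> vs / fact l" if l: "l \<le> s" for l
    proof -
      obtain m where "r = l + m" using le_Suc_ex[of l r] l False by (metis nat_le_linear le_trans)
      moreover obtain k where "s = l + k" using le_Suc_ex[OF l] by blast
      ultimately have rs: "r = l + m" "s = l + k" .
      have "even (((l + m) * (l + k) + (l * (k + 1) + l div 2)) + k * m) = even (l * m + l div 2)"
        by (cases "even l"; cases "even m"; cases "even k"; simp)
      then have s: "(-1 :: real) ^ (r * s) * (-1) ^ (l * (s - l + 1) + l div 2) * (-1) ^ ((s - l) * (r - l)) =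
          (-1) ^ (l * (r - l) + l div 2)"
        unfolding power_add[symmetric] rs diff_add_inverse by (rule sign_eqI)
      have "l \<le> r" using rs by simp
      note comm = plain_contracted_commute[where b = b and vs = vs, OF h d(2) d(1) l this]
      have "(-1) ^ (r * s) * ((-1) ^ (l * (s - l + 1) + l div 2) / fact l * plain_contracted h b l \<beta> \<alpha> vs) =
        ((-1) ^ (r * s) * (-1) ^ (l * (s - l + 1) + l div 2) * (-1) ^ ((s - l) * (r - l))) *
          plain_contracted h b l \<alpha> \<beta> vs / fact l"
        by (simp only: comm mult_ac times_divide_eq_left times_divide_eq_right)
      also have "\<dots> = signed_contracted h b l \<alpha> \<beta> vs / fact l"
        unfolding s signed_contracted_sign[OF d(1) \<open>l \<le> r\<close>] ..
      finally show ?thesis .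
    qed
    then show ?thesis using False by (simp add: sum_distrib_left min_def)
  qed
  also have "\<dots> = graf N h b \<alpha> \<beta> vs"
    unfolding graf_def
  proof (rule sum.mono_neutral_left)
    show "\<forall>l\<in>{..N} - {..min r s}. signed_contracted h b l \<alpha> \<beta> vs / fact l = 0"
    proof
      fix l assume "l \<in> {..N} - {..min r s}"
      then have "r < l \<or> s < l" by auto
      then show "signed_contracted h b l \<alpha> \<beta> vs / fact l = 0"
        using signed_contracted_vanish_left[OF of_degree_vanishes_from[OF d(1)]]
          signed_contracted_vanish_right[OF of_degree_vanishes_from[OF d(2)]] by auto
    qed
  qed (use N in auto)
  finally show ?thesis .
qed

lemma contraction_eq: "contraction X \<omega> x = contract (X x) (\<omega> x)"
  by (simp add: contraction_def contract_def)

lemma contracted_wedge_eq: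
  "contracted_wedge A g e l \<alpha> \<beta> x =
    plain_contracted (\<lambda>i j. cometric A g x (coframe A e i x) (coframe A e j x)) (\<lambda>i. e i x) l (\<alpha> x) (\<beta> x)"
  by (induction l arbitrary: \<alpha> \<beta>) (simp_all add: wedge_eq_ext_prod contraction_eq fun_eq_iff)

section \<open>Smooth forms and their Graf product\<close>

context framed_manifold
begin

abbreviation function_ring :: "('m \<Rightarrow> real) ring" where
  "function_ring \<equiv> smooth_function_ring A U"

abbreviation forms :: "('m \<Rightarrow> 'm multiform) set" where
  "forms \<equiv> form_sections A U"

abbreviation graf_mult :: "('m \<Rightarrow> 'm multiform) \<Rightarrow> ('m \<Rightarrow> 'm multiform) \<Rightarrow> 'm \<Rightarrow> 'm multiform" where
  "graf_mult \<equiv> graf_product A g e"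

abbreviation frame_at :: "'m \<Rightarrow> 'n \<Rightarrow> 'm tvec" where
  "frame_at x \<equiv> (\<lambda>i. e i x)"

lemma ext_fibre_expand:
  assumes x: "x \<in> U" and \<alpha>: "\<alpha> \<in> ext_fibre A x" and v: "v \<in> tangent_space A x"
  shows "\<alpha> (v # vs) = (\<Sum>i\<in>UNIV. coeff x v i * \<alpha> (e i x # vs))"
proof (cases "set vs \<subseteq> tangent_space A x")
  case True
  then show ?thesis
    using ext_fibre_lincomb[OF \<alpha>, of "[]" vs UNIV "\<lambda>i. e i x" "coeff x v"] x
    by (simp add: coeff_expand[OF x v])
next
  case False
  then show ?thesis using \<alpha> by (simp add: ext_fibre_outside)
qed

text \<open>Multilinearity lets the arguments be replaced by frame vectors one after the other.\<close>
lemma ext_fibre_zero_on_frame: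
  assumes x: "x \<in> U" and "\<alpha> \<in> ext_fibre A x"
    and "\<And>is. length is = length vs \<Longrightarrow> \<alpha> (map (frame_at x) is) = 0"
  shows "\<alpha> vs = 0"
  using assms(2,3)
proof (induction vs arbitrary: \<alpha>)
  case (Cons v vs)
  show ?case
  proof (cases "v \<in> tangent_space A x")
    case True
    have "contract (e i x) \<alpha> vs = 0" for i
    proof (rule Cons.IH)
      show "contract (e i x) \<alpha> \<in> ext_fibre A x" using Cons.prems x by (simp add: ext_fibre_contract)
      show "contract (e i x) \<alpha> (map (frame_at x) is) = 0" if "length is = length vs" for "is"
        using Cons.prems(2)[of "i # is"] that by (simp add: contract_def)
    qed
    then show ?thesis by (simp add: ext_fibre_expand[OF x Cons.prems(1) True] contract_def)
  next
    case False
    then show ?thesis using Cons.prems by (simp add: ext_fibre_outside)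
  qed
qed simp

text \<open>More than \<open>CARD('n)\<close> frame vectors contain a repetition.\<close>
lemma ext_fibre_vanishes:
  assumes x: "x \<in> U" and \<alpha>: "\<alpha> \<in> ext_fibre A x"
  shows "vanishes_from (Suc CARD('n)) \<alpha>"
  unfolding vanishes_from_def
proof (intro allI impI)
  fix vs :: "'m tvec list" assume l: "Suc CARD('n) \<le> length vs"
  show "\<alpha> vs = 0"
  proof (rule ext_fibre_zero_on_frame[OF x \<alpha>])
    fix "is" :: "'n list" assume "length is = length vs"
    moreover have "card (set is) \<le> CARD('n)" by (rule card_mono) auto
    ultimately have "\<not> distinct is" using l distinct_card[of "is"] by linarith
    then have "\<not> distinct (map (frame_at x) is)" by (simp add: distinct_map)
    then show "\<alpha> (map (frame_at x) is) = 0" by (rule ext_fibre_not_distinct[OF \<alpha>])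
  qed
qed

text \<open>Contracting the left-hand side by \<open>v\<close> gives \<open>\<Sum>i. e\<^sup>i(v) (e\<^sub>i \<rfloor> \<alpha>)\<close>, which is \<open>v \<rfloor> \<alpha>\<close>, and the same sum
  for the form \<open>v \<rfloor> \<alpha>\<close>, which has one argument less.\<close>
lemma euler_identity:
  assumes x: "x \<in> U" and "\<alpha> \<in> ext_fibre A x"
  shows "(\<Sum>i\<in>UNIV. ext_prod (coframe A e i x) (contract (e i x) \<alpha>) vs) = real (length vs) * \<alpha> vs"
  using assms(2)
proof (induction vs arbitrary: \<alpha>)
  case Nil
  then show ?case using x by (simp add: coframe_eq)
next
  case (Cons v vs)
  have d: "of_degree 1 (coframe A e i x)" for i using x by (simp add: coframe_eq of_degree_def)
  have "ext_prod (coframe A e i x) (contract (e i x) \<alpha>) (v # vs) =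
      coframe A e i x [v] * contract (e i x) \<alpha> vs -
      ext_prod (coframe A e i x) (contract v (contract (e i x) \<alpha>)) vs" for i
    using fun_cong[OF contract_oneform_ext_prod[OF d], of v i "contract (e i x) \<alpha>" vs]
    by (simp add: contract_def[of v "ext_prod a b" for a b])
  also have "\<dots> i = coframe A e i x [v] * contract (e i x) \<alpha> vs +
      ext_prod (coframe A e i x) (contract (e i x) (contract v \<alpha>)) vs" for i
    unfolding contract_swap[OF Cons.prems, of v] by (simp add: ext_prod_right)
  finally have *: "(\<Sum>i\<in>UNIV. ext_prod (coframe A e i x) (contract (e i x) \<alpha>) (v # vs)) =
      (\<Sum>i\<in>UNIV. coframe A e i x [v] * contract (e i x) \<alpha> vs) +
      (\<Sum>i\<in>UNIV. ext_prod (coframe A e i x) (contract (e i x) (contract v \<alpha>)) vs)"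
    by (simp only: sum.distrib)
  show ?case
  proof (cases "v \<in> tangent_space A x")
    case True
    have "(\<Sum>i\<in>UNIV. coframe A e i x [v] * contract (e i x) \<alpha> vs) = \<alpha> (v # vs)"
      using x True by (simp add: coframe_eq ext_fibre_expand[OF x Cons.prems True] contract_def)
    then show ?thesis
      unfolding * using Cons.IH[OF ext_fibre_contract[OF Cons.prems True]]
      by (simp add: contract_def algebra_simps)
  next
    case False
    then have "contract v \<alpha> = (\<lambda>vs. 0)" using contract_outside[OF Cons.prems] by blast
    moreover have "contract w (\<lambda>vs. 0) = (\<lambda>vs. 0)" for w :: "'m tvec" by (simp add: contract_def)
    ultimately show ?thesis
      unfolding * using x False Cons.prems
      by (simp add: coframe_eq ext_prod_right ext_fibre_outside)
  qed
qed

lemma form_in: "\<alpha> \<in> forms \<Longrightarrow> x \<in> U \<Longrightarrow> \<alpha> x \<in> ext_fibre A x"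
  by (simp add: form_sections_def)

lemma form_outside: "\<alpha> \<in> forms \<Longrightarrow> x \<notin> U \<Longrightarrow> \<alpha> x = (\<lambda>vs. 0)"
  by (simp add: form_sections_def)

lemma form_smooth:
  "\<alpha> \<in> forms \<Longrightarrow> c \<in> A \<Longrightarrow> smooth_fun_on A (U \<inter> fst c) (\<lambda>x. \<alpha> x (map (\<lambda>i. coord_vec A c i x) is))"
  by (simp add: form_sections_def)

lemma formI:
  assumes "\<And>x. x \<in> U \<Longrightarrow> \<alpha> x \<in> ext_fibre A x" "\<And>x. x \<notin> U \<Longrightarrow> \<alpha> x = (\<lambda>vs. 0)"
    "\<And>c is. c \<in> A \<Longrightarrow> smooth_fun_on A (U \<inter> fst c) (\<lambda>x. \<alpha> x (map (\<lambda>i. coord_vec A c i x) is))"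
  shows "\<alpha> \<in> forms"
  using assms by (simp add: form_sections_def)

lemma form_scale_add:
  assumes "\<And>c. c \<in> A \<Longrightarrow> smooth_fun_on A (U \<inter> fst c) f"
    "\<And>c. c \<in> A \<Longrightarrow> smooth_fun_on A (U \<inter> fst c) h" "\<alpha> \<in> forms" "\<beta> \<in> forms"
  shows "(\<lambda>x vs. f x * \<alpha> x vs + h x * \<beta> x vs) \<in> forms"
proof (rule formI)
  fix c "is" assume "c \<in> A"
  then show "smooth_fun_on A (U \<inter> fst c) (\<lambda>x. f x * \<alpha> x (map (\<lambda>i. coord_vec A c i x) is) +
      h x * \<beta> x (map (\<lambda>i. coord_vec A c i x) is))"
    by (intro smooth_add smooth_mult open_chart_dom assms form_smooth)
qed (simp_all add: ext_fibre_scale_add form_in form_outside assms)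

lemma form_zero: "(\<lambda>x vs. 0) \<in> forms"
  by (rule formI) (auto simp: ext_fibre_zero smooth_const)

lemma form_scale:
  assumes "\<And>c. c \<in> A \<Longrightarrow> smooth_fun_on A (U \<inter> fst c) f" "\<alpha> \<in> forms"
  shows "(\<lambda>x vs. f x * \<alpha> x vs) \<in> forms"
  using form_scale_add[of f "\<lambda>x. 0", OF assms(1) smooth_const assms(2) form_zero] by simp

lemma form_add: "\<alpha> \<in> forms \<Longrightarrow> \<beta> \<in> forms \<Longrightarrow> (\<lambda>x vs. \<alpha> x vs + \<beta> x vs) \<in> forms"
  using form_scale_add[of "\<lambda>x. 1" "\<lambda>x. 1" \<alpha> \<beta>] by (simp add: smooth_const)

lemma form_sum: "(\<And>i. i \<in> I \<Longrightarrow> \<alpha> i \<in> forms) \<Longrightarrow> (\<lambda>x vs. \<Sum>i\<in>I. \<alpha> i x vs) \<in> forms"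
  by (induction I rule: infinite_finite_induct) (auto simp: form_zero intro: form_add)

lemma form_degree_part:
  assumes "\<alpha> \<in> forms" shows "degree_part k \<alpha> \<in> forms"
proof (rule formI)
  fix x assume "x \<in> U"
  from form_in[OF assms this] show "degree_part k \<alpha> x \<in> ext_fibre A x"
    unfolding ext_fibre_iff degree_part_def by auto
next
  fix c "is" assume "c \<in> A"
  then show "smooth_fun_on A (U \<inter> fst c) (\<lambda>x. degree_part k \<alpha> x (map (\<lambda>i. coord_vec A c i x) is))"
    by (cases "length is = k") (simp_all add: degree_part_def smooth_const form_smooth[OF assms])
qed (simp add: degree_part_def form_outside[OF assms] fun_eq_iff)

lemma form_wedge:
  assumes \<alpha>: "\<alpha> \<in> forms" and \<beta>: "\<beta> \<in> forms" shows "wedge \<alpha> \<beta> \<in> forms"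
proof (rule formI)
  fix c "is" assume "c \<in> A"
  then show "smooth_fun_on A (U \<inter> fst c) (\<lambda>x. wedge \<alpha> \<beta> x (map (\<lambda>i. coord_vec A c i x) is))"
    unfolding wedge_def length_map nths_map
    by (intro smooth_sum smooth_mult smooth_const open_chart_dom form_smooth \<alpha> \<beta>)
next
  fix x assume "x \<notin> U"
  then show "wedge \<alpha> \<beta> x = (\<lambda>vs. 0)"
    by (intro ext) (simp add: wedge_eq_ext_prod form_outside assms ext_prod_left)
qed (simp add: wedge_eq_ext_prod ext_fibre_ext_prod form_in assms)

text \<open>In a chart the frame vector is a combination of coordinate vectors with smooth coefficients.\<close>
lemma form_contraction:
  assumes \<alpha>: "\<alpha> \<in> forms" shows "contraction (e j) \<alpha> \<in> forms"
proof (rule formI)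
  fix x assume "x \<in> U"
  then show "contraction (e j) \<alpha> x \<in> ext_fibre A x"
    by (simp add: contraction_eq ext_fibre_contract form_in[OF \<alpha>])
next
  fix x assume "x \<notin> U"
  then show "contraction (e j) \<alpha> x = (\<lambda>vs. 0)"
    by (simp add: contraction_def form_outside[OF \<alpha>])
next
  fix c "is" assume c: "c \<in> A"
  note o = open_chart_dom[OF c]
  have "smooth_fun_on A (U \<inter> fst c) (\<lambda>x. \<Sum>a\<in>UNIV. e j x (\<lambda>y. snd c y $ a) *
      \<alpha> x (map (\<lambda>i. coord_vec A c i x) (a # is)))"
    by (intro smooth_sum smooth_mult frame_component_smooth form_smooth \<alpha> o c)
  then show "smooth_fun_on A (U \<inter> fst c) (\<lambda>x. contraction (e j) \<alpha> x (map (\<lambda>i. coord_vec A c i x) is))"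
  proof (rule smooth_cong[OF o, rotated])
    fix x assume "x \<in> U \<inter> fst c"
    then have x: "x \<in> U" "x \<in> fst c" by auto
    note cv = coord_vec_in_tangent_space[OF c x(2)]
    have "\<alpha> x ([] @ (\<lambda>f. \<Sum>a\<in>UNIV. e j x (\<lambda>y. snd c y $ a) * coord_vec A c a x f) #
        map (\<lambda>i. coord_vec A c i x) is) =
      (\<Sum>a\<in>UNIV. e j x (\<lambda>y. snd c y $ a) * \<alpha> x ([] @ coord_vec A c a x # map (\<lambda>i. coord_vec A c i x) is))"
      by (rule ext_fibre_lincomb[OF form_in[OF \<alpha> x(1)]]) (use cv in auto)
    then show "(\<Sum>a\<in>UNIV. e j x (\<lambda>y. snd c y $ a) * \<alpha> x (map (\<lambda>i. coord_vec A c i x) (a # is))) =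
        contraction (e j) \<alpha> x (map (\<lambda>i. coord_vec A c i x) is)"
      by (simp only: frame_coord(2)[OF x(1) c x(2), of j, symmetric]) (simp add: contraction_def)
  qed
qed

text \<open>\<open>coframe\<close> is meaningless off \<open>U\<close>, whereas sections have to vanish there.\<close>
definition coframe_section :: "'n \<Rightarrow> 'm \<Rightarrow> 'm multiform" where
  "coframe_section i = (\<lambda>x. if x \<in> U then coframe A e i x else (\<lambda>vs. 0))"

lemma coframe_section_eq: "x \<in> U \<Longrightarrow> coframe_section i x = coframe A e i x"
  by (simp add: coframe_section_def)

lemma form_coframe: "coframe_section i \<in> forms"
proof (rule formI)
  fix c "is" assume c: "c \<in> A"
  note o = open_chart_dom[OF c]
  show "smooth_fun_on A (U \<inter> fst c) (\<lambda>x. coframe_section i x (map (\<lambda>i. coord_vec A c i x) is))"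
  proof (cases "length is = 1")
    case True
    then obtain a where a: "is = [a]" by (cases "is") auto
    show ?thesis
      by (rule smooth_cong[OF o _ coframe_component_smooth[OF c, of a i]])
         (use coord_vec_in_tangent_space[OF c] in \<open>auto simp: a coframe_section_def coframe_eq\<close>)
  next
    case False
    show ?thesis
      by (rule smooth_cong[OF o _ smooth_const[of _ 0]])
         (use False in \<open>auto simp: coframe_section_def coframe_eq\<close>)
  qed
qed (simp_all add: coframe_section_def coframe_in)

lemma coframe_section_degree: "of_degree 1 (coframe_section i x)"
  by (simp add: coframe_section_def coframe_eq of_degree_def)

text \<open>The unit \<open>1\<^sub>\<Gamma>\<close> of the exterior algebra over \<open>U\<close>.\<close>
definition one_section :: "'m \<Rightarrow> 'm multiform" where
  "one_section = (\<lambda>x vs. if x \<in> U \<and> vs = [] then 1 else 0)"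

lemma one_section_eq: "x \<in> U \<Longrightarrow> one_section x = unit_form"
  by (auto simp: one_section_def unit_form_def)

lemma form_one: "one_section \<in> forms"
proof (rule formI)
  fix x assume "x \<in> U"
  then show "one_section x \<in> ext_fibre A x"
    unfolding ext_fibre_iff one_section_def by auto
next
  fix c "is" assume c: "c \<in> A"
  show "smooth_fun_on A (U \<inter> fst c) (\<lambda>x. one_section x (map (\<lambda>i. coord_vec A c i x) is))"
    by (rule smooth_cong[OF open_chart_dom[OF c] _ smooth_const[of _ "if is = [] then 1 else 0"]])
       (auto simp: one_section_def)
qed (auto simp: one_section_def)

lemma form_contracted_wedge:
  "\<alpha> \<in> forms \<Longrightarrow> \<beta> \<in> forms \<Longrightarrow> contracted_wedge A g e l \<alpha> \<beta> \<in> forms"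
proof (induction l arbitrary: \<alpha> \<beta>)
  case 0
  then show ?case by (simp add: form_wedge)
next
  case (Suc l)
  then show ?case unfolding contracted_wedge.simps ginv_def[symmetric]
    by (intro form_sum form_scale ginv_smooth form_contraction Suc.IH) auto
qed

lemma form_const_scale: "\<alpha> \<in> forms \<Longrightarrow> (\<lambda>x vs. a * \<alpha> x vs) \<in> forms"
  by (intro form_scale smooth_const)

lemma form_graf_mult:
  assumes "\<alpha> \<in> forms" "\<beta> \<in> forms" shows "graf_mult \<alpha> \<beta> \<in> forms"
proof -
  have gh: "graf_homogeneous A g e r s \<alpha> \<beta> \<in> forms" if "\<alpha> \<in> forms" "\<beta> \<in> forms" for r s \<alpha> \<beta>
    unfolding graf_homogeneous_def
    by (cases "r \<le> s") (auto intro!: form_sum form_const_scale form_contracted_wedge that simp only: if_True if_False)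
  show ?thesis unfolding graf_product_def
    by (intro form_sum gh form_degree_part assms)
qed

lemma graf_mult_outside: "\<alpha> \<in> forms \<Longrightarrow> \<beta> \<in> forms \<Longrightarrow> x \<notin> U \<Longrightarrow> graf_mult \<alpha> \<beta> x = (\<lambda>vs. 0)"
  using form_outside[OF form_graf_mult] by blast

text \<open>Every form over \<open>U\<close> is the sum of its components of degree at most \<open>CARD('n)\<close>, so the sum over pairs of
  degrees collapses by bilinearity.  The bound is one more than the dimension because the
  associativity argument needs \<open>vanishes_from\<close> at the bound itself.\<close>
lemma graf_mult_eq:
  assumes \<alpha>: "\<alpha> \<in> forms" and \<beta>: "\<beta> \<in> forms" and x: "x \<in> U"
  shows "graf_mult \<alpha> \<beta> x = graf (Suc CARD('n)) (ginv x) (frame_at x) (\<alpha> x) (\<beta> x)"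
proof
  fix vs
  let ?G = "graf (Suc CARD('n)) (ginv x) (frame_at x)"
  have d: "of_degree r (degree_part r \<gamma> x)" for r and \<gamma> :: "'m \<Rightarrow> 'm multiform"
    by (simp add: of_degree_def degree_part_def)
  have sum: "\<gamma> x = (\<lambda>vs. \<Sum>r\<le>CARD('n). degree_part r \<gamma> x vs)" if "\<gamma> \<in> forms" for \<gamma>
  proof
    fix vs
    show "\<gamma> x vs = (\<Sum>r\<le>CARD('n). degree_part r \<gamma> x vs)"
    proof (cases "length vs \<le> CARD('n)")
      case True
      then show ?thesis by (simp add: degree_part_def)
    next
      case False
      then show ?thesis
        using ext_fibre_vanishes[OF x form_in[OF that x]]
        by (auto simp: degree_part_def vanishes_from_def intro!: sum.neutral)
    qed
  qed
  have "graf_homogeneous A g e r s (degree_part r \<alpha>) (degree_part s \<beta>) x vs =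
      ?G (degree_part r \<alpha> x) (degree_part s \<beta> x) vs" if "r \<le> CARD('n)" for r s
    unfolding graf_homogeneous_def contracted_wedge_eq ginv_def[symmetric]
    by (rule graf_of_degree) (use that ginv_sym[OF x] d in auto)
  then have "graf_mult \<alpha> \<beta> x vs = (\<Sum>r\<le>CARD('n). \<Sum>s\<le>CARD('n).
      ?G (degree_part r \<alpha> x) (degree_part s \<beta> x) vs)"
    by (simp add: graf_product_def)
  also have "\<dots> = ?G (\<alpha> x) (\<beta> x) vs"
  proof -
    have "?G (\<alpha> x) (\<beta> x) vs = ?G (\<lambda>vs. \<Sum>r\<le>CARD('n). degree_part r \<alpha> x vs)
        (\<lambda>vs. \<Sum>s\<le>CARD('n). degree_part s \<beta> x vs) vs"
      by (simp only: sum[OF \<alpha>, symmetric] sum[OF \<beta>, symmetric])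
    then show ?thesis by (simp only: graf_left graf_right)
  qed
  finally show "graf_mult \<alpha> \<beta> x vs = ?G (\<alpha> x) (\<beta> x) vs" .
qed

lemma forms_eqI:
  assumes "\<alpha> \<in> forms" "\<beta> \<in> forms" "\<And>x vs. x \<in> U \<Longrightarrow> \<alpha> x vs = \<beta> x vs"
  shows "\<alpha> = \<beta>"
  using assms form_outside by (metis ext)

lemma smooth_fun_local:
  assumes "\<And>c. c \<in> A \<Longrightarrow> smooth_fun_on A (U \<inter> fst c) f"
  shows "smooth_fun_on A U f"
  unfolding smooth_fun_on_def
proof
  fix c assume c: "c \<in> A"
  then have "smooth_on (snd c ` (U \<inter> fst c \<inter> fst c)) (f \<circ> chart_inv c)"
    using assms[OF c] unfolding smooth_fun_on_def by blast
  then show "smooth_on (snd c ` (U \<inter> fst c)) (f \<circ> chart_inv c)" by (simp add: Int_assoc)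
qed

lemma form_scalar_part:
  assumes "\<alpha> \<in> forms" shows "(\<lambda>x. \<alpha> x []) \<in> carrier function_ring"
proof -
  have "smooth_fun_on A (U \<inter> fst c) (\<lambda>x. \<alpha> x [])" if "c \<in> A" for c
    using form_smooth[OF assms that, of "[]"] by simp
  then have "smooth_fun_on A U (\<lambda>x. \<alpha> x [])"
    by (rule smooth_fun_local)
  then show ?thesis by (simp add: smooth_function_ring_def form_outside[OF assms])
qed

lemma carrier_smooth:
  "f \<in> carrier function_ring \<Longrightarrow> smooth_fun_on A (U \<inter> W) f"
  by (rule smooth_fun_on_subset[of _ U]) (auto simp: smooth_function_ring_def)

lemma carrierI:
  assumes "\<And>c. c \<in> A \<Longrightarrow> smooth_fun_on A (U \<inter> fst c) f" "\<And>x. x \<notin> U \<Longrightarrow> f x = 0"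
  shows "f \<in> carrier function_ring"
  using assms smooth_fun_local[of f] by (simp add: smooth_function_ring_def)

abbreviation oneforms :: "('m \<Rightarrow> 'm multiform) set" where
  "oneforms \<equiv> {\<alpha> \<in> forms. \<forall>x. of_degree 1 (\<alpha> x)}"

text \<open>Contraction by the vector field metrically dual to \<open>\<theta>\<close>, built from the frame so that its smoothness
  is visible.\<close>
definition contract_oneform :: "('m \<Rightarrow> 'm multiform) \<Rightarrow> ('m \<Rightarrow> 'm multiform) \<Rightarrow> 'm \<Rightarrow> 'm multiform" where
  "contract_oneform \<theta> \<alpha> = (\<lambda>x. contract_form (ginv x) (frame_at x) (\<theta> x) (\<alpha> x))"

lemma form_component_smooth:
  assumes "\<theta> \<in> forms" "c \<in> A" shows "smooth_fun_on A (U \<inter> fst c) (\<lambda>x. \<theta> x [e i x])"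
  using form_smooth[OF form_contraction[OF assms(1)] assms(2), of i "[]"] by (simp add: contraction_def)

lemma form_contract_oneform:
  assumes "\<theta> \<in> forms" "\<alpha> \<in> forms" shows "contract_oneform \<theta> \<alpha> \<in> forms"
  unfolding contract_oneform_def contract_form_def contraction_eq[symmetric, of "e j" for j]
  by (intro form_sum form_scale smooth_mult ginv_smooth form_component_smooth form_contraction
      open_chart_dom assms)

lemma graf_mult_oneform:
  assumes \<theta>: "\<theta> \<in> oneforms" and \<alpha>: "\<alpha> \<in> forms"
  shows "graf_mult \<theta> \<alpha> = (\<lambda>x vs. wedge \<theta> \<alpha> x vs + contract_oneform \<theta> \<alpha> x vs)"
    (is "_ = ?R")
proof (rule forms_eqI)
  have t: "\<theta> \<in> forms" using \<theta> by simp
  show "graf_mult \<theta> \<alpha> \<in> forms" by (rule form_graf_mult[OF t \<alpha>])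
  show "?R \<in> forms"
    by (intro form_add form_wedge form_contract_oneform t \<alpha>)
  fix x vs assume "x \<in> U"
  then show "graf_mult \<theta> \<alpha> x vs = ?R x vs"
    using \<theta> by (simp add: graf_mult_eq[OF t \<alpha>] graf_oneform_left wedge_eq_ext_prod contract_oneform_def)
qed

lemma graf_mult_oneform_assoc:
  assumes \<theta>: "\<theta> \<in> oneforms" and \<alpha>: "\<alpha> \<in> forms" and \<beta>: "\<beta> \<in> forms"
  shows "graf_mult (graf_mult \<theta> \<alpha>) \<beta> = graf_mult \<theta> (graf_mult \<alpha> \<beta>)" (is "?L = ?R")
proof (rule forms_eqI)
  have t: "\<theta> \<in> forms" using \<theta> by simp
  show "?L \<in> forms" "?R \<in> forms"
    by (intro form_graf_mult t \<alpha> \<beta>)+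
  fix x vs assume x: "x \<in> U"
  show "?L x vs = ?R x vs"
    unfolding graf_mult_eq[OF form_graf_mult[OF t \<alpha>] \<beta> x] graf_mult_eq[OF t form_graf_mult[OF \<alpha> \<beta>] x]
      graf_mult_eq[OF t \<alpha> x] graf_mult_eq[OF \<alpha> \<beta> x]
    by (rule graf_oneform_assoc[OF form_in[OF \<alpha> x] form_in[OF \<beta> x]])
       (use x \<theta> ext_fibre_vanishes[OF x form_in[OF \<alpha> x]] in auto)
qed

lemma graf_mult_lincomb_left:
  assumes "\<alpha> \<in> forms" "\<alpha>' \<in> forms" "\<beta> \<in> forms"
    "\<And>c. c \<in> A \<Longrightarrow> smooth_fun_on A (U \<inter> fst c) f" "\<And>c. c \<in> A \<Longrightarrow> smooth_fun_on A (U \<inter> fst c) h"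
  shows "graf_mult (\<lambda>x vs. f x * \<alpha> x vs + h x * \<alpha>' x vs) \<beta> =
    (\<lambda>x vs. f x * graf_mult \<alpha> \<beta> x vs + h x * graf_mult \<alpha>' \<beta> x vs)" (is "?L = ?R")
proof (rule forms_eqI)
  have l: "(\<lambda>x vs. f x * \<alpha> x vs + h x * \<alpha>' x vs) \<in> forms" by (intro form_scale_add assms)
  show "?L \<in> forms"
    by (intro form_graf_mult l assms)
  show "?R \<in> forms"
    by (intro form_scale_add form_graf_mult assms)
  fix x vs assume "x \<in> U"
  then show "?L x vs = ?R x vs"
    by (simp add: graf_mult_eq l assms graf_lincomb_left)
qed

lemma graf_mult_lincomb_right:
  assumes "\<alpha> \<in> forms" "\<beta> \<in> forms" "\<beta>' \<in> forms"
    "\<And>c. c \<in> A \<Longrightarrow> smooth_fun_on A (U \<inter> fst c) f" "\<And>c. c \<in> A \<Longrightarrow> smooth_fun_on A (U \<inter> fst c) h"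
  shows "graf_mult \<alpha> (\<lambda>x vs. f x * \<beta> x vs + h x * \<beta>' x vs) =
    (\<lambda>x vs. f x * graf_mult \<alpha> \<beta> x vs + h x * graf_mult \<alpha> \<beta>' x vs)" (is "?L = ?R")
proof (rule forms_eqI)
  have l: "(\<lambda>x vs. f x * \<beta> x vs + h x * \<beta>' x vs) \<in> forms" by (intro form_scale_add assms)
  show "?L \<in> forms"
    by (intro form_graf_mult l assms)
  show "?R \<in> forms"
    by (intro form_scale_add form_graf_mult assms)
  fix x vs assume "x \<in> U"
  then show "?L x vs = ?R x vs"
    by (simp add: graf_mult_eq l assms graf_lincomb_right)
qed

lemma graf_mult_add_left:
  "\<alpha> \<in> forms \<Longrightarrow> \<alpha>' \<in> forms \<Longrightarrow> \<beta> \<in> forms \<Longrightarrow>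
   graf_mult (\<lambda>x vs. \<alpha> x vs + \<alpha>' x vs) \<beta> = (\<lambda>x vs. graf_mult \<alpha> \<beta> x vs + graf_mult \<alpha>' \<beta> x vs)"
  using graf_mult_lincomb_left[of \<alpha> \<alpha>' \<beta> "\<lambda>x. 1" "\<lambda>x. 1"] by (simp add: smooth_const)

lemma graf_mult_add_right:
  "\<alpha> \<in> forms \<Longrightarrow> \<beta> \<in> forms \<Longrightarrow> \<beta>' \<in> forms \<Longrightarrow>
   graf_mult \<alpha> (\<lambda>x vs. \<beta> x vs + \<beta>' x vs) = (\<lambda>x vs. graf_mult \<alpha> \<beta> x vs + graf_mult \<alpha> \<beta>' x vs)"
  using graf_mult_lincomb_right[of \<alpha> \<beta> \<beta>' "\<lambda>x. 1" "\<lambda>x. 1"] by (simp add: smooth_const)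

lemma graf_mult_scale_left:
  "\<alpha> \<in> forms \<Longrightarrow> \<beta> \<in> forms \<Longrightarrow> (\<And>c. c \<in> A \<Longrightarrow> smooth_fun_on A (U \<inter> fst c) f) \<Longrightarrow>
   graf_mult (\<lambda>x vs. f x * \<alpha> x vs) \<beta> = (\<lambda>x vs. f x * graf_mult \<alpha> \<beta> x vs)"
  using graf_mult_lincomb_left[of \<alpha> \<alpha> \<beta> f "\<lambda>x. 0"] by (simp add: smooth_const)

lemma graf_mult_scale_right:
  "\<alpha> \<in> forms \<Longrightarrow> \<beta> \<in> forms \<Longrightarrow> (\<And>c. c \<in> A \<Longrightarrow> smooth_fun_on A (U \<inter> fst c) f) \<Longrightarrow>
   graf_mult \<alpha> (\<lambda>x vs. f x * \<beta> x vs) = (\<lambda>x vs. f x * graf_mult \<alpha> \<beta> x vs)"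
  using graf_mult_lincomb_right[of \<alpha> \<beta> \<beta> f "\<lambda>x. 0"] by (simp add: smooth_const)

lemma graf_mult_one_left:
  assumes "\<alpha> \<in> forms" shows "graf_mult one_section \<alpha> = \<alpha>"
  by (rule forms_eqI)
     (simp_all add: assms form_graf_mult form_one graf_mult_eq one_section_eq graf_unit_left)

lemma graf_mult_one_right:
  assumes "\<alpha> \<in> forms" shows "graf_mult \<alpha> one_section = \<alpha>"
  by (rule forms_eqI)
     (simp_all add: assms form_graf_mult form_one graf_mult_eq one_section_eq graf_unit_right)

lemma coframe_in_oneforms: "coframe_section i \<in> oneforms"
  using form_coframe coframe_section_degree by blast

lemma contract_oneform_coframe:
  assumes "x \<in> U"
  shows "contract_oneform (coframe_section i) \<alpha> x = (\<lambda>vs. \<Sum>j\<in>UNIV. ginv x i j * contract (e j x) (\<alpha> x) vs)"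
proof
  fix vs
  have "contract_oneform (coframe_section i) \<alpha> x vs =
      (\<Sum>k\<in>UNIV. if i = k then \<Sum>j\<in>UNIV. ginv x k j * contract (e j x) (\<alpha> x) vs else 0)"
    unfolding contract_oneform_def contract_form_def
    by (intro sum.cong refl) (auto simp: coframe_section_def assms coframe_frame)
  then show "contract_oneform (coframe_section i) \<alpha> x vs = (\<Sum>j\<in>UNIV. ginv x i j * contract (e j x) (\<alpha> x) vs)"
    by simp
qed

text \<open>Replacing \<open>\<and>\<close> by \<open>\<diamond>\<close> in Euler's identity adds \<open>\<Sum>i j. g\<^sup>i\<^sup>j e\<^sub>j \<rfloor> e\<^sub>i \<rfloor> \<alpha>\<close>, the trace of
  an antisymmetric against a symmetric matrix.\<close>
lemma euler_graf:
  assumes \<alpha>: "\<alpha> \<in> forms"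
  shows "(\<lambda>x vs. \<Sum>i\<in>UNIV. graf_mult (coframe_section i) (contraction (e i) \<alpha>) x vs) =
    (\<lambda>x vs. real (length vs) * \<alpha> x vs)" (is "?L = ?R")
proof (intro ext)
  fix x vs
  show "?L x vs = ?R x vs"
  proof (cases "x \<in> U")
    case True
    let ?c = "\<lambda>i j. ginv x i j * contract (e j x) (contract (e i x) (\<alpha> x)) vs"
    have "(\<Sum>i\<in>UNIV. \<Sum>j\<in>UNIV. ?c i j) = (\<Sum>i\<in>UNIV. \<Sum>j\<in>UNIV. ?c j i)"
      by (rule sum.swap)
    also have "\<dots> = (\<Sum>i\<in>UNIV. \<Sum>j\<in>UNIV. - ?c i j)"
    proof (intro sum.cong refl)
      fix i j
      have "contract (e i x) (contract (e j x) (\<alpha> x)) vs = - contract (e j x) (contract (e i x) (\<alpha> x)) vs"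
        using contract_swap[OF form_in[OF \<alpha> True]] by metis
      then show "?c j i = - ?c i j" using ginv_sym[OF True, of i j] by simp
    qed
    finally have z: "(\<Sum>i\<in>UNIV. \<Sum>j\<in>UNIV. ?c i j) = 0" by (simp add: sum_negf)
    have "?L x vs =
        (\<Sum>i\<in>UNIV. ext_prod (coframe A e i x) (contract (e i x) (\<alpha> x)) vs) + (\<Sum>i\<in>UNIV. \<Sum>j\<in>UNIV. ?c i j)"
      using True
      by (simp only: graf_mult_oneform[OF coframe_in_oneforms form_contraction[OF \<alpha>]] wedge_eq_ext_prod
          contract_oneform_coframe contraction_eq sum.distrib coframe_section_eq)
    then show ?thesis using z euler_identity[OF True form_in[OF \<alpha> True]] by simp
  next
    case False
    then show ?thesis
      using graf_mult_outside[OF form_coframe form_contraction[OF \<alpha>] False] form_outside[OF \<alpha> False] by simp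
  qed
qed

text \<open>The induction principle behind all global statements.  A form is the sum of its homogeneous parts,
  and \<open>euler_graf\<close> expresses a \<open>(k + 1)\<close>-form through products of one-forms with \<open>k\<close>-forms.\<close>
lemma form_induct:
  assumes \<alpha>: "\<alpha> \<in> forms"
    and one: "one_section \<in> S"
    and add: "\<And>\<alpha> \<beta>. \<alpha> \<in> S \<Longrightarrow> \<beta> \<in> S \<Longrightarrow> (\<lambda>x vs. \<alpha> x vs + \<beta> x vs) \<in> S"
    and scale: "\<And>f \<alpha>. f \<in> carrier function_ring \<Longrightarrow> \<alpha> \<in> S \<Longrightarrow> (\<lambda>x vs. f x * \<alpha> x vs) \<in> S"
    and mult: "\<And>\<theta> \<alpha>. \<theta> \<in> oneforms \<Longrightarrow> \<alpha> \<in> S \<Longrightarrow> graf_mult \<theta> \<alpha> \<in> S"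
  shows "\<alpha> \<in> S"
proof -
  have "(\<lambda>x. 0) \<in> carrier function_ring" by (rule carrierI) (auto simp: smooth_const)
  from scale[OF this one] have zero: "(\<lambda>x vs. 0) \<in> S" by simp
  have sum: "(\<lambda>x vs. \<Sum>i\<in>I. \<gamma> i x vs) \<in> S" if "\<And>i. i \<in> I \<Longrightarrow> \<gamma> i \<in> S" for I and \<gamma> :: "'i \<Rightarrow> _"
    using that by (induction I rule: infinite_finite_induct) (auto simp: zero intro: add)
  have hom: "\<alpha> \<in> S" if "\<alpha> \<in> forms" "\<And>x. of_degree k (\<alpha> x)" for k \<alpha>
    using that
  proof (induction k arbitrary: \<alpha>)
    case 0
    have "\<alpha> = (\<lambda>x vs. \<alpha> x [] * one_section x vs)"
      using 0 by (auto simp: fun_eq_iff one_section_def of_degree_def form_outside)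
    then show ?case using scale[OF form_scalar_part[OF 0(1)] one] by simp
  next
    case (Suc k)
    have "of_degree k (contraction (e i) \<alpha> x)" for i x
      using contract_of_degree[OF Suc.prems(2)] by (simp add: contraction_eq)
    then have S: "(\<lambda>x vs. \<Sum>i\<in>UNIV. graf_mult (coframe_section i) (contraction (e i) \<alpha>) x vs) \<in> S"
      by (intro sum mult coframe_in_oneforms Suc.IH form_contraction Suc.prems(1))
    \<comment> \<open>Euler's identity is divided by the degree within the function ring.\<close>
    let ?f = "\<lambda>x. if x \<in> U then 1 / real (Suc k) else 0"
    have f: "?f \<in> carrier function_ring"
    proof (rule carrierI)
      show "smooth_fun_on A (U \<inter> fst c) ?f" if "c \<in> A" for c
        by (rule smooth_cong[OF open_chart_dom[OF that] _ smooth_const[of _ "1 / real (Suc k)"]]) auto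
    qed auto
    have eq: "?f x * (real (length vs) * \<alpha> x vs) = \<alpha> x vs" for x vs
      using Suc.prems(2)[of x] form_outside[OF Suc.prems(1), of x]
      by (cases "length vs = Suc k") (auto simp: of_degree_def)
    from scale[OF f S[unfolded euler_graf[OF Suc.prems(1)]]] show ?case
      by (simp only: eq)
  qed
  have "\<alpha> = (\<lambda>x vs. \<Sum>k\<le>CARD('n). degree_part k \<alpha> x vs)" (is "_ = ?R")
  proof (rule forms_eqI[OF \<alpha>])
    show "?R \<in> forms"
      by (intro form_sum form_degree_part \<alpha>)
    fix x vs assume x: "x \<in> U"
    show "\<alpha> x vs = ?R x vs"
      using ext_fibre_vanishes[OF x form_in[OF \<alpha> x]]
      by (cases "length vs \<le> CARD('n)") (auto simp: degree_part_def vanishes_from_def)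
  qed
  moreover have "degree_part k \<alpha> \<in> S" for k
    by (rule hom[of _ k, OF form_degree_part[OF \<alpha>]]) (simp add: degree_part_def of_degree_def)
  then have "?R \<in> S" by (rule sum)
  ultimately show ?thesis by simp
qed

text \<open>The forms that associate from the left with all others are stable under left multiplication by
  one-forms: \<open>((\<theta>\<alpha>)\<beta>)\<gamma> = (\<theta>(\<alpha>\<beta>))\<gamma> = \<theta>((\<alpha>\<beta>)\<gamma>) = \<theta>(\<alpha>(\<beta>\<gamma>)) = (\<theta>\<alpha>)(\<beta>\<gamma>)\<close>.\<close>
lemma graf_mult_assoc:
  assumes "\<alpha> \<in> forms" "\<beta> \<in> forms" "\<gamma> \<in> forms"
  shows "graf_mult (graf_mult \<alpha> \<beta>) \<gamma> = graf_mult \<alpha> (graf_mult \<beta> \<gamma>)"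
proof -
  let ?S = "{\<alpha> \<in> forms. \<forall>\<beta>\<in>forms. \<forall>\<gamma>\<in>forms. graf_mult (graf_mult \<alpha> \<beta>) \<gamma> = graf_mult \<alpha> (graf_mult \<beta> \<gamma>)}"
  have "\<alpha> \<in> ?S" using assms(1)
  proof (rule form_induct)
    show "one_section \<in> ?S" by (simp add: form_one graf_mult_one_left form_graf_mult)
  next
    fix \<alpha> \<beta> assume "\<alpha> \<in> ?S" "\<beta> \<in> ?S"
    then show "(\<lambda>x vs. \<alpha> x vs + \<beta> x vs) \<in> ?S"
      by (simp add: form_add graf_mult_add_left form_graf_mult)
  next
    fix f \<alpha> assume "f \<in> carrier function_ring" "\<alpha> \<in> ?S"
    then show "(\<lambda>x vs. f x * \<alpha> x vs) \<in> ?S"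
      by (simp add: form_scale graf_mult_scale_left form_graf_mult carrier_smooth)
  next
    fix \<theta> \<alpha> assume t: "\<theta> \<in> oneforms" and a: "\<alpha> \<in> ?S"
    then have "\<theta> \<in> forms" "\<alpha> \<in> forms" by auto
    moreover have "graf_mult (graf_mult (graf_mult \<theta> \<alpha>) \<beta>) \<gamma> = graf_mult (graf_mult \<theta> \<alpha>) (graf_mult \<beta> \<gamma>)"
      if "\<beta> \<in> forms" "\<gamma> \<in> forms" for \<beta> \<gamma>
      using a that by (simp add: graf_mult_oneform_assoc[OF t] form_graf_mult)
    ultimately show "graf_mult \<theta> \<alpha> \<in> ?S" by (simp add: form_graf_mult)
  qed
  then show ?thesis using assms by blast
qed

lemma cometric_on_eq:
  assumes "\<theta> \<in> oneforms" "\<phi> \<in> oneforms" "x \<in> U"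
  shows "cometric_on A g U \<theta> \<phi> x = (\<Sum>i\<in>UNIV. \<Sum>j\<in>UNIV. ginv x i j * \<theta> x [e i x] * \<phi> x [e j x])"
  using assms by (simp add: cometric_on_def cometric_eq form_in)

text \<open>The wedge square of a one-form is zero by graded commutativity; what remains is the contraction of
  \<open>\<theta>\<close> by its own dual vector.\<close>
lemma graf_mult_square:
  assumes \<theta>: "\<theta> \<in> oneforms"
  shows "graf_mult \<theta> \<theta> = (\<lambda>x vs. cometric_on A g U \<theta> \<theta> x * one_section x vs)"
proof (intro ext)
  fix x vs
  have t: "\<theta> \<in> forms" and d: "of_degree 1 (\<theta> x)" using \<theta> by auto
  show "graf_mult \<theta> \<theta> x vs = cometric_on A g U \<theta> \<theta> x * one_section x vs"
  proof (cases "x \<in> U")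
    case True
    have "ext_prod (\<theta> x) (\<theta> x) vs = 0" using ext_prod_commute[OF d d, of vs] by simp
    then show ?thesis
      using True
      by (simp add: graf_mult_oneform[OF \<theta> t] wedge_eq_ext_prod contract_oneform_def contract_form_def
          contract_form_degree_1[OF d] cometric_on_eq[OF \<theta> \<theta>] one_section_eq sum_distrib_right mult.assoc)
  next
    case False
    then show ?thesis using graf_mult_outside[OF t t] by (simp add: one_section_def)
  qed
qed

section \<open>The algebra of forms over the ring of functions\<close>

lemma function_ring_simps:
  "f \<otimes>\<^bsub>function_ring\<^esub> h = (\<lambda>x. f x * h x)"
  "f \<oplus>\<^bsub>function_ring\<^esub> h = (\<lambda>x. f x + h x)"
  "\<one>\<^bsub>function_ring\<^esub> = (\<lambda>x. if x \<in> U then 1 else 0)"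
  "\<zero>\<^bsub>function_ring\<^esub> = (\<lambda>x. 0)"
  by (simp_all add: smooth_function_ring_def)

lemma function_ring_outside: "f \<in> carrier function_ring \<Longrightarrow> x \<notin> U \<Longrightarrow> f x = 0"
  by (simp add: smooth_function_ring_def)

lemma function_ring_smooth: "f \<in> carrier function_ring \<Longrightarrow> smooth_fun_on A U f"
  by (simp add: smooth_function_ring_def)

lemma function_ringI:
  "smooth_fun_on A U f \<Longrightarrow> (\<And>x. x \<notin> U \<Longrightarrow> f x = 0) \<Longrightarrow> f \<in> carrier function_ring"
  by (simp add: smooth_function_ring_def)

definition const_fun :: "real \<Rightarrow> 'm \<Rightarrow> real" where
  "const_fun a = (\<lambda>x. if x \<in> U then a else 0)"

lemma const_fun_in: "const_fun a \<in> carrier function_ring"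
proof (rule function_ringI)
  show "smooth_fun_on A U (const_fun a)"
    by (rule smooth_cong[OF open_U _ smooth_const[of _ a]]) (simp add: const_fun_def)
qed (simp add: const_fun_def)

lemma function_ring_mult: "f \<in> carrier function_ring \<Longrightarrow> h \<in> carrier function_ring \<Longrightarrow> (\<lambda>x. f x * h x) \<in> carrier function_ring"
  by (intro function_ringI smooth_mult open_U) (simp_all add: function_ring_smooth function_ring_outside)

lemma function_ring_add: "f \<in> carrier function_ring \<Longrightarrow> h \<in> carrier function_ring \<Longrightarrow> (\<lambda>x. f x + h x) \<in> carrier function_ring"
  by (intro function_ringI smooth_add open_U) (simp_all add: function_ring_smooth function_ring_outside)

lemma function_ring_cring: "cring function_ring"
proof (rule cringI)
  show "abelian_group function_ring"
  proof (rule abelian_groupI)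
    fix f assume f: "f \<in> carrier function_ring"
    show "\<exists>h\<in>carrier function_ring. h \<oplus>\<^bsub>function_ring\<^esub> f = \<zero>\<^bsub>function_ring\<^esub>"
      using function_ring_mult[OF const_fun_in[of "-1"] f]
      by (rule bexI[rotated]) (auto simp: function_ring_simps const_fun_def function_ring_outside[OF f])
  next
    show "\<zero>\<^bsub>function_ring\<^esub> \<in> carrier function_ring"
      using const_fun_in[of 0] by (simp add: function_ring_simps const_fun_def)
  qed (simp_all add: function_ring_simps function_ring_add algebra_simps)
  show "comm_monoid function_ring"
  proof (rule comm_monoidI)
    show "\<one>\<^bsub>function_ring\<^esub> \<in> carrier function_ring"
      using const_fun_in[of 1] by (simp add: function_ring_simps const_fun_def)
    fix f assume "f \<in> carrier function_ring"
    then show "\<one>\<^bsub>function_ring\<^esub> \<otimes>\<^bsub>function_ring\<^esub> f = f"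
      by (auto simp: function_ring_simps function_ring_outside)
  qed (simp_all add: function_ring_simps function_ring_mult algebra_simps)
qed (simp add: function_ring_simps algebra_simps)

abbreviation form_algebra :: "('m \<Rightarrow> real, 'm \<Rightarrow> 'm multiform) module" where
  "form_algebra \<equiv> graf_algebra A g U e"

abbreviation oneform_module :: "('m \<Rightarrow> real, 'm \<Rightarrow> 'm multiform) module" where
  "oneform_module \<equiv> one_forms A g U e"

lemma form_algebra_simps:
  "carrier form_algebra = forms"
  "\<alpha> \<otimes>\<^bsub>form_algebra\<^esub> \<beta> = graf_mult \<alpha> \<beta>"
  "\<alpha> \<oplus>\<^bsub>form_algebra\<^esub> \<beta> = (\<lambda>x vs. \<alpha> x vs + \<beta> x vs)"
  "\<one>\<^bsub>form_algebra\<^esub> = one_section"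
  "\<zero>\<^bsub>form_algebra\<^esub> = (\<lambda>x vs. 0)"
  "f \<odot>\<^bsub>form_algebra\<^esub> \<alpha> = (\<lambda>x vs. f x * \<alpha> x vs)"
  by (simp_all add: graf_algebra_def one_section_def)

lemma oneform_module_simps:
  "carrier oneform_module = oneforms"
  "\<alpha> \<oplus>\<^bsub>oneform_module\<^esub> \<beta> = (\<lambda>x vs. \<alpha> x vs + \<beta> x vs)"
  "\<zero>\<^bsub>oneform_module\<^esub> = (\<lambda>x vs. 0)"
  "f \<odot>\<^bsub>oneform_module\<^esub> \<alpha> = (\<lambda>x vs. f x * \<alpha> x vs)"
  by (simp_all add: one_forms_def graf_algebra_def)

lemma form_smult: "f \<in> carrier function_ring \<Longrightarrow> \<alpha> \<in> forms \<Longrightarrow> (\<lambda>x vs. f x * \<alpha> x vs) \<in> forms"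
  by (intro form_scale carrier_smooth)

lemma oneform_add: "\<alpha> \<in> oneforms \<Longrightarrow> \<beta> \<in> oneforms \<Longrightarrow> (\<lambda>x vs. \<alpha> x vs + \<beta> x vs) \<in> oneforms"
  by (simp add: form_add of_degree_def)

lemma oneform_smult: "f \<in> carrier function_ring \<Longrightarrow> \<alpha> \<in> oneforms \<Longrightarrow> (\<lambda>x vs. f x * \<alpha> x vs) \<in> oneforms"
  by (simp add: form_smult of_degree_def)

lemma form_unit_smult: "\<alpha> \<in> forms \<Longrightarrow> (\<lambda>x vs. (if x \<in> U then 1 else 0) * \<alpha> x vs) = \<alpha>"
  by (auto simp: fun_eq_iff form_outside)

lemma form_algebra_abelian_group: "abelian_group form_algebra"
proof (rule abelian_groupI)
  fix \<alpha> assume "\<alpha> \<in> carrier form_algebra"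
  then have "\<alpha> \<in> forms" by (simp add: form_algebra_simps)
  from form_const_scale[OF this, of "-1"]
  show "\<exists>\<beta>\<in>carrier form_algebra. \<beta> \<oplus>\<^bsub>form_algebra\<^esub> \<alpha> = \<zero>\<^bsub>form_algebra\<^esub>"
    unfolding form_algebra_simps by (rule bexI[rotated]) simp
qed (simp_all add: form_algebra_simps form_add form_zero algebra_simps)

lemma oneform_abelian_group: "abelian_group oneform_module"
proof (rule abelian_groupI)
  fix \<alpha> assume "\<alpha> \<in> carrier oneform_module"
  then have "(\<lambda>x vs. -1 * \<alpha> x vs) \<in> oneforms"
    using form_const_scale[of \<alpha> "-1"] by (simp add: oneform_module_simps of_degree_def)
  then show "\<exists>\<beta>\<in>carrier oneform_module. \<beta> \<oplus>\<^bsub>oneform_module\<^esub> \<alpha> = \<zero>\<^bsub>oneform_module\<^esub>"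
    unfolding oneform_module_simps by (rule bexI[rotated]) simp
qed (simp_all add: oneform_module_simps form_add form_zero of_degree_def algebra_simps)

lemma form_algebra_ring: "ring form_algebra"
proof (rule ringI)
  show "abelian_group form_algebra" by (rule form_algebra_abelian_group)
  show "monoid form_algebra"
    by (rule monoidI)
       (simp_all add: form_algebra_simps form_graf_mult form_one graf_mult_assoc
         graf_mult_one_left graf_mult_one_right)
qed (simp_all add: form_algebra_simps graf_mult_add_left graf_mult_add_right)

lemma form_algebra_module: "module function_ring form_algebra"
proof (rule moduleI[OF function_ring_cring form_algebra_abelian_group])
  fix \<alpha> assume "\<alpha> \<in> carrier form_algebra"
  then show "\<one>\<^bsub>function_ring\<^esub> \<odot>\<^bsub>form_algebra\<^esub> \<alpha> = \<alpha>"
    by (simp only: form_algebra_simps function_ring_simps form_unit_smult)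
qed (simp_all add: form_algebra_simps function_ring_simps form_smult algebra_simps)

lemma form_algebra_assoc_algebra: "assoc_algebra function_ring form_algebra"
proof (intro assoc_algebra.intro assoc_algebra_axioms.intro)
  show "module function_ring form_algebra" by (rule form_algebra_module)
  show "ring form_algebra" by (rule form_algebra_ring)
qed (simp_all add: form_algebra_simps graf_mult_scale_left graf_mult_scale_right carrier_smooth)

lemma oneform_is_module: "module function_ring oneform_module"
proof (rule moduleI[OF function_ring_cring oneform_abelian_group])
  fix \<alpha> assume "\<alpha> \<in> carrier oneform_module"
  then have "\<alpha> \<in> forms" by (simp add: oneform_module_simps)
  then show "\<one>\<^bsub>function_ring\<^esub> \<odot>\<^bsub>oneform_module\<^esub> \<alpha> = \<alpha>"
    by (simp add: oneform_module_simps function_ring_simps form_unit_smult)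
next
  fix f \<alpha> assume "f \<in> carrier function_ring" "\<alpha> \<in> carrier oneform_module"
  then show "f \<odot>\<^bsub>oneform_module\<^esub> \<alpha> \<in> carrier oneform_module"
    using oneform_smult by (simp add: oneform_module_simps)
qed (simp_all add: oneform_module_simps function_ring_simps algebra_simps)

lemma cometric_on_in:
  assumes "\<theta> \<in> oneforms" "\<phi> \<in> oneforms"
  shows "cometric_on A g U \<theta> \<phi> \<in> carrier function_ring"
proof (rule carrierI)
  fix c assume c: "c \<in> A"
  have "smooth_fun_on A (U \<inter> fst c) (\<lambda>x. \<Sum>i\<in>UNIV. \<Sum>j\<in>UNIV. ginv x i j * \<theta> x [e i x] * \<phi> x [e j x])"
    using assms by (intro smooth_sum smooth_mult ginv_smooth form_component_smooth open_chart_dom c) auto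
  then show "smooth_fun_on A (U \<inter> fst c) (cometric_on A g U \<theta> \<phi>)"
    by (rule smooth_cong[OF open_chart_dom[OF c], rotated]) (simp add: cometric_on_eq[OF assms])
qed (simp add: cometric_on_def)

lemma cometric_on_sym:
  assumes "\<theta> \<in> oneforms" "\<phi> \<in> oneforms"
  shows "cometric_on A g U \<theta> \<phi> = cometric_on A g U \<phi> \<theta>"
proof
  fix x
  show "cometric_on A g U \<theta> \<phi> x = cometric_on A g U \<phi> \<theta> x"
  proof (cases "x \<in> U")
    case True
    have "(\<Sum>i\<in>UNIV. \<Sum>j\<in>UNIV. ginv x i j * \<theta> x [e i x] * \<phi> x [e j x]) =
        (\<Sum>j\<in>UNIV. \<Sum>i\<in>UNIV. ginv x i j * \<theta> x [e i x] * \<phi> x [e j x])"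
      by (rule sum.swap)
    also have "\<dots> = (\<Sum>j\<in>UNIV. \<Sum>i\<in>UNIV. ginv x j i * \<phi> x [e j x] * \<theta> x [e i x])"
      by (intro sum.cong refl) (use ginv_sym[OF True] in simp)
    finally show ?thesis
      by (simp only: cometric_on_eq[OF assms True] cometric_on_eq[OF assms(2,1) True])
  qed (simp add: cometric_on_def)
qed

lemma cometric_on_add:
  assumes "\<theta> \<in> oneforms" "\<theta>' \<in> oneforms" "\<phi> \<in> oneforms"
  shows "cometric_on A g U (\<lambda>x vs. \<theta> x vs + \<theta>' x vs) \<phi> =
    (\<lambda>x. cometric_on A g U \<theta> \<phi> x + cometric_on A g U \<theta>' \<phi> x)"
proof
  fix x
  show "cometric_on A g U (\<lambda>x vs. \<theta> x vs + \<theta>' x vs) \<phi> x =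
      cometric_on A g U \<theta> \<phi> x + cometric_on A g U \<theta>' \<phi> x"
    using cometric_on_eq[OF assms(1,3)] cometric_on_eq[OF assms(2,3)]
      cometric_on_eq[OF oneform_add[OF assms(1,2)] assms(3)]
    by (cases "x \<in> U") (simp_all add: algebra_simps sum.distrib, simp add: cometric_on_def)
qed

lemma cometric_on_smult:
  assumes "f \<in> carrier function_ring" "\<theta> \<in> oneforms" "\<phi> \<in> oneforms"
  shows "cometric_on A g U (\<lambda>x vs. f x * \<theta> x vs) \<phi> = (\<lambda>x. f x * cometric_on A g U \<theta> \<phi> x)"
proof
  fix x
  show "cometric_on A g U (\<lambda>x vs. f x * \<theta> x vs) \<phi> x = f x * cometric_on A g U \<theta> \<phi> x"
    using cometric_on_eq[OF assms(2,3)] cometric_on_eq[OF oneform_smult[OF assms(1,2)] assms(3)]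
    by (cases "x \<in> U") (simp_all add: algebra_simps sum_distrib_left, simp add: cometric_on_def)
qed

lemma oneform_symmetric_bilinear:
  "symmetric_bilinear_module function_ring oneform_module (cometric_on A g U)"
proof (intro symmetric_bilinear_module.intro symmetric_bilinear_module_axioms.intro)
  show "module function_ring oneform_module" by (rule oneform_is_module)
qed (simp_all only: oneform_module_simps function_ring_simps cometric_on_in cometric_on_add
    cometric_on_smult, rule cometric_on_sym)

lemma inclusion_clifford_map:
  "clifford_map function_ring oneform_module (cometric_on A g U) form_algebra (\<lambda>\<alpha>. \<alpha>)"
  unfolding clifford_map_def linear_maps_def
  by (auto simp: oneform_module_simps form_algebra_simps graf_mult_square)

lemma oneforms_generate:
  assumes "S \<subseteq> carrier form_algebra" "\<one>\<^bsub>form_algebra\<^esub> \<in> S"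
    "(\<lambda>\<alpha>. \<alpha>) ` carrier oneform_module \<subseteq> S"
    "\<And>x y. x \<in> S \<Longrightarrow> y \<in> S \<Longrightarrow> x \<oplus>\<^bsub>form_algebra\<^esub> y \<in> S"
    "\<And>x y. x \<in> S \<Longrightarrow> y \<in> S \<Longrightarrow> x \<otimes>\<^bsub>form_algebra\<^esub> y \<in> S"
    "\<And>a x. a \<in> carrier function_ring \<Longrightarrow> x \<in> S \<Longrightarrow> a \<odot>\<^bsub>form_algebra\<^esub> x \<in> S"
  shows "S = carrier form_algebra"
proof
  show "carrier form_algebra \<subseteq> S"
  proof
    fix \<alpha> assume "\<alpha> \<in> carrier form_algebra"
    then have "\<alpha> \<in> forms" by (simp add: form_algebra_simps)
    then show "\<alpha> \<in> S"
    proof (rule form_induct)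
      show "graf_mult \<theta> \<alpha> \<in> S" if "\<theta> \<in> oneforms" "\<alpha> \<in> S" for \<theta> \<alpha>
        using assms(3,5)[unfolded oneform_module_simps form_algebra_simps] that by blast
    qed (use assms(2,4,6)[unfolded form_algebra_simps] in auto)
  qed
qed (rule assms(1))

lemma oneform_expand:
  assumes \<theta>: "\<theta> \<in> oneforms"
  shows "\<theta> = (\<lambda>x vs. \<Sum>i\<in>UNIV. \<theta> x [e i x] * coframe_section i x vs)"
proof (intro ext)
  fix x vs
  have t: "\<theta> \<in> forms" and d: "of_degree 1 (\<theta> x)" using \<theta> by auto
  show "\<theta> x vs = (\<Sum>i\<in>UNIV. \<theta> x [e i x] * coframe_section i x vs)"
  proof (cases "x \<in> U \<and> length vs = 1")
    case True
    then obtain v where v: "vs = [v]" and x: "x \<in> U" by (cases vs) auto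
    show ?thesis
    proof (cases "v \<in> tangent_space A x")
      case True
      then show ?thesis
        using ext_fibre_expand[OF x form_in[OF t x] True, of "[]"] x
        by (simp add: v coframe_section_eq coframe_eq mult.commute)
    next
      case False
      then show ?thesis
        using ext_fibre_outside[OF form_in[OF t x], of "[v]"] x by (simp add: v coframe_section_eq coframe_eq)
    qed
  next
    case False
    then show ?thesis
      using d coframe_section_degree[of _ x] form_outside[OF t, of x]
      by (cases "x \<in> U") (auto simp: of_degree_def)
  qed
qed

lemma oneform_component_in: "\<theta> \<in> forms \<Longrightarrow> (\<lambda>x. \<theta> x [e i x]) \<in> carrier function_ring"
  by (intro carrierI form_component_smooth) (simp_all add: form_outside)

end

section \<open>The universal property\<close>

locale clifford_extension =
  framed_manifold A g p q U e + B: assoc_algebra "smooth_function_ring A U" B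
  for A :: "('m::t2_space, 'n::finite) chart set" and g p q U e and B :: "('m \<Rightarrow> real, 'd) module" (structure) +
  fixes f :: "('m \<Rightarrow> 'm multiform) \<Rightarrow> 'd"
  assumes clifford: "clifford_map function_ring oneform_module (cometric_on A g U) B f"
begin

lemma f_closed: "\<theta> \<in> oneforms \<Longrightarrow> f \<theta> \<in> carrier B"
  using clifford by (auto simp: clifford_map_def linear_maps_def oneform_module_simps)

lemma f_add: "\<theta> \<in> oneforms \<Longrightarrow> \<phi> \<in> oneforms \<Longrightarrow> f (\<lambda>x vs. \<theta> x vs + \<phi> x vs) = f \<theta> \<oplus> f \<phi>"
  using clifford unfolding clifford_map_def linear_maps_def oneform_module_simps by blast

lemma f_smult: "a \<in> carrier function_ring \<Longrightarrow> \<theta> \<in> oneforms \<Longrightarrow> f (\<lambda>x vs. a x * \<theta> x vs) = a \<odot> f \<theta>"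
  using clifford unfolding clifford_map_def linear_maps_def oneform_module_simps by blast

lemma f_square: "\<theta> \<in> oneforms \<Longrightarrow> f \<theta> \<otimes> f \<theta> = cometric_on A g U \<theta> \<theta> \<odot> \<one>"
  using clifford unfolding clifford_map_def oneform_module_simps by blast

lemma smult_add_left:
  "a \<in> carrier function_ring \<Longrightarrow> b \<in> carrier function_ring \<Longrightarrow> x \<in> carrier B \<Longrightarrow>
   (\<lambda>y. a y + b y) \<odot> x = a \<odot> x \<oplus> b \<odot> x"
  using B.smult_l_distr[of a b x] by (simp only: function_ring_simps)

lemma smult_mult:
  "a \<in> carrier function_ring \<Longrightarrow> b \<in> carrier function_ring \<Longrightarrow> x \<in> carrier B \<Longrightarrow>
   (\<lambda>y. a y * b y) \<odot> x = a \<odot> (b \<odot> x)"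
  using B.smult_assoc1[of a b x] by (simp only: function_ring_simps)

lemma smult_const_one: "x \<in> carrier B \<Longrightarrow> const_fun 1 \<odot> x = x"
  using B.smult_one[of x] by (simp only: function_ring_simps const_fun_def)

lemma smult_const_zero: "x \<in> carrier B \<Longrightarrow> const_fun 0 \<odot> x = \<zero>"
  using B.smult_l_null[of x] by (simp add: function_ring_simps const_fun_def)

lemma smult_const_add:
  "x \<in> carrier B \<Longrightarrow> const_fun (a + b) \<odot> x = const_fun a \<odot> x \<oplus> const_fun b \<odot> x"
  using smult_add_left[OF const_fun_in const_fun_in, of x a b]
  by (simp add: const_fun_def if_distrib[of "\<lambda>z. z + _"] cong: if_cong)

lemma smult_const_mult:
  "x \<in> carrier B \<Longrightarrow> const_fun (a * b) \<odot> x = const_fun a \<odot> (const_fun b \<odot> x)"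
  using smult_mult[OF const_fun_in const_fun_in, of x a b]
  by (simp add: const_fun_def if_distrib[of "\<lambda>z. z * _"] cong: if_cong)

lemma smult_const_cancel:
  assumes "a \<noteq> 0" "x \<in> carrier B" "y \<in> carrier B"
    and "const_fun a \<odot> x = const_fun a \<odot> y"
  shows "x = y"
proof -
  have "const_fun (inverse a) \<odot> (const_fun a \<odot> z) = z" if "z \<in> carrier B" for z
    using smult_const_mult[OF that, of "inverse a" a] smult_const_one[OF that] assms(1) by simp
  then show ?thesis using assms by metis
qed

text \<open>Polarisation of the Clifford relation.\<close>
lemma f_anticommutator:
  assumes t: "\<theta> \<in> oneforms" and p: "\<phi> \<in> oneforms"
  shows "f \<theta> \<otimes> f \<phi> \<oplus> f \<phi> \<otimes> f \<theta> =
    const_fun 2 \<odot> (cometric_on A g U \<theta> \<phi> \<odot> \<one>)"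
proof -
  let ?b = "cometric_on A g U" let ?s = "\<lambda>x vs. \<theta> x vs + \<phi> x vs"
  note s = oneform_add[OF t p]
  note c = f_closed[OF t] f_closed[OF p] cometric_on_in[OF t t] cometric_on_in[OF p p] cometric_on_in[OF t p]
  have "?b ?s ?s = (\<lambda>x. ?b \<theta> ?s x + ?b \<phi> ?s x)" by (rule cometric_on_add[OF t p s])
  also have "\<dots> = (\<lambda>x. (?b \<theta> \<theta> x + ?b \<phi> \<phi> x) + const_fun 2 x * ?b \<theta> \<phi> x)"
    unfolding cometric_on_sym[OF t s] cometric_on_sym[OF p s] cometric_on_add[OF t p t] cometric_on_add[OF t p p]
      cometric_on_sym[OF p t] by (auto simp: fun_eq_iff const_fun_def cometric_on_def)
  finally have b: "?b ?s ?s = (\<lambda>x. (?b \<theta> \<theta> x + ?b \<phi> \<phi> x) + const_fun 2 x * ?b \<theta> \<phi> x)" .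
  \<comment> \<open>The squares of \<open>f \<theta>\<close> and \<open>f \<phi>\<close> are kept together as \<open>?d\<close>, to be cancelled at the end.\<close>
  let ?d = "f \<theta> \<otimes> f \<theta> \<oplus> f \<phi> \<otimes> f \<phi>"
  have "?d \<oplus> (f \<theta> \<otimes> f \<phi> \<oplus> f \<phi> \<otimes> f \<theta>) = f ?s \<otimes> f ?s"
    using c by (simp add: f_add[OF t p] B.A.l_distr B.A.r_distr B.M.a_ac)
  also have "\<dots> = ?d \<oplus> const_fun 2 \<odot> (?b \<theta> \<phi> \<odot> \<one>)"
    unfolding f_square[OF s] f_square[OF t] f_square[OF p] b
    using c by (simp add: smult_add_left smult_mult function_ring_add function_ring_mult const_fun_in)
  finally show ?thesis using c by (simp add: const_fun_in)
qed

lemma f_sum: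
  assumes "finite I" "\<And>i. i \<in> I \<Longrightarrow> \<theta> i \<in> oneforms"
  shows "f (\<lambda>x vs. \<Sum>i\<in>I. \<theta> i x vs) = (\<Oplus>i\<in>I. f (\<theta> i))"
  using assms
proof (induction I)
  case empty
  have "f (\<lambda>x vs. 0) = const_fun 0 \<odot> f (coframe_section undefined)"
    using f_smult[OF const_fun_in coframe_in_oneforms, of 0] by (simp add: const_fun_def cong: if_cong)
  then show ?case by (simp add: smult_const_zero f_closed[OF coframe_in_oneforms])
next
  case (insert i I)
  have "(\<lambda>x vs. \<Sum>i\<in>I. \<theta> i x vs) \<in> oneforms"
    using insert.prems by (auto simp: of_degree_def intro!: form_sum)
  then have "f (\<lambda>x vs. \<theta> i x vs + (\<Sum>i\<in>I. \<theta> i x vs)) = f (\<theta> i) \<oplus> f (\<lambda>x vs. \<Sum>i\<in>I. \<theta> i x vs)"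
    by (intro f_add) (use insert.prems in auto)
  then show ?case using insert f_closed by (simp add: B.M.finsum_insert Pi_def)
qed

definition gen :: "'n \<Rightarrow> 'd" where
  "gen i = f (coframe_section i)"

lemma gen_closed [simp]: "gen i \<in> carrier B"
  unfolding gen_def by (rule f_closed[OF coframe_in_oneforms])

lemma f_expand:
  assumes \<theta>: "\<theta> \<in> oneforms"
  shows "f \<theta> = (\<Oplus>i\<in>UNIV. (\<lambda>x. \<theta> x [e i x]) \<odot> gen i)"
proof -
  have t: "\<theta> \<in> forms" using \<theta> by simp
  have "f \<theta> = f (\<lambda>x vs. \<Sum>i\<in>UNIV. \<theta> x [e i x] * coframe_section i x vs)"
    by (rule arg_cong[where f = f]) (rule oneform_expand[OF \<theta>])
  also have "\<dots> = (\<Oplus>i\<in>UNIV. f (\<lambda>x vs. \<theta> x [e i x] * coframe_section i x vs))"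
    by (rule f_sum) (rule finite, rule oneform_smult[OF oneform_component_in[OF t] coframe_in_oneforms])
  also have "\<dots> = (\<Oplus>i\<in>UNIV. (\<lambda>x. \<theta> x [e i x]) \<odot> gen i)"
    by (simp only: f_smult[OF oneform_component_in[OF t] coframe_in_oneforms] gen_def)
  finally show ?thesis .
qed

text \<open>On a \<open>k\<close>-form this is \<open>1/k!\<close> times the sum over all \<open>i\<^sub>1, \<dots>, i\<^sub>k\<close> of the component
  \<open>\<alpha>(e\<^bsub>i\<^sub>1\<^esub>, \<dots>, e\<^bsub>i\<^sub>k\<^esub>)\<close> times the product of the generators with these indices, in this order.  The recursive form
  copies \<open>euler_graf\<close>, which any multiplicative extension of \<open>f\<close> has to respect.\<close>
primrec ext_part :: "nat \<Rightarrow> ('m \<Rightarrow> 'm multiform) \<Rightarrow> 'd" where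
  "ext_part 0 \<alpha> = (\<lambda>x. \<alpha> x []) \<odot> \<one>"
| "ext_part (Suc k) \<alpha> = const_fun (1 / real (Suc k)) \<odot>
     (\<Oplus>i\<in>UNIV. gen i \<otimes> ext_part k (contraction (e i) \<alpha>))"

lemma ext_part_closed [simp]: "\<alpha> \<in> forms \<Longrightarrow> ext_part k \<alpha> \<in> carrier B"
  by (induction k arbitrary: \<alpha>)
     (simp_all add: form_scalar_part const_fun_in form_contraction Pi_def)

lemma ext_part_add:
  "\<alpha> \<in> forms \<Longrightarrow> \<beta> \<in> forms \<Longrightarrow>
   ext_part k (\<lambda>x vs. \<alpha> x vs + \<beta> x vs) = ext_part k \<alpha> \<oplus> ext_part k \<beta>"
proof (induction k arbitrary: \<alpha> \<beta>)
  case 0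
  then show ?case by (simp add: smult_add_left form_scalar_part)
next
  case (Suc k)
  have "contraction (e i) (\<lambda>x vs. \<alpha> x vs + \<beta> x vs) =
      (\<lambda>x vs. contraction (e i) \<alpha> x vs + contraction (e i) \<beta> x vs)" for i
    by (simp add: contraction_def)
  then show ?case using Suc
    by (simp add: form_contraction B.A.r_distr B.M.finsum_addf Pi_def B.smult_r_distr const_fun_in)
qed

lemma finsum_smult:
  assumes "a \<in> carrier function_ring" "\<And>i. X i \<in> carrier B"
  shows "a \<odot> (\<Oplus>i\<in>(UNIV::'n set). X i) = (\<Oplus>i\<in>UNIV. a \<odot> X i)"
  using assms by (intro B.finsum_smult_ldistr) auto

lemma ext_part_smult:
  "a \<in> carrier function_ring \<Longrightarrow> \<alpha> \<in> forms \<Longrightarrow>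
   ext_part k (\<lambda>x vs. a x * \<alpha> x vs) = a \<odot> ext_part k \<alpha>"
proof (induction k arbitrary: \<alpha>)
  case 0
  then show ?case by (simp add: smult_mult form_scalar_part)
next
  case (Suc k)
  let ?S = "\<Oplus>i\<in>UNIV. gen i \<otimes> ext_part k (contraction (e i) \<alpha>)"
  have S: "?S \<in> carrier B" by (simp add: form_contraction Suc.prems Pi_def)
  have "contraction (e i) (\<lambda>x vs. a x * \<alpha> x vs) = (\<lambda>x vs. a x * contraction (e i) \<alpha> x vs)" for i
    by (simp add: contraction_def)
  then have "ext_part (Suc k) (\<lambda>x vs. a x * \<alpha> x vs) = const_fun (1 / real (Suc k)) \<odot> (a \<odot> ?S)"
    using Suc by (simp add: form_contraction B.smult_mult_right finsum_smult)
  also have "\<dots> = a \<odot> (const_fun (1 / real (Suc k)) \<odot> ?S)"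
    using smult_mult[OF const_fun_in Suc.prems(1) S] smult_mult[OF Suc.prems(1) const_fun_in S]
    by (simp add: mult.commute)
  finally show ?case by simp
qed

lemma ext_part_vanish:
  "(\<And>x vs. length vs = k \<Longrightarrow> \<alpha> x vs = 0) \<Longrightarrow> ext_part k \<alpha> = \<zero>"
proof (induction k arbitrary: \<alpha>)
  case 0
  then show ?case using smult_const_zero[of "\<one>"] by (simp add: const_fun_def)
next
  case (Suc k)
  then have "ext_part k (contraction (e i) \<alpha>) = \<zero>" for i by (simp add: contraction_def)
  then show ?case by (simp add: const_fun_in)
qed

lemma ext_part_sum:
  assumes "finite I" "\<And>i. i \<in> I \<Longrightarrow> \<alpha> i \<in> forms"
  shows "ext_part k (\<lambda>x vs. \<Sum>i\<in>I. \<alpha> i x vs) = (\<Oplus>i\<in>I. ext_part k (\<alpha> i))"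
  using assms
proof (induction I)
  case empty
  then show ?case by (simp add: ext_part_vanish)
next
  case (insert i I)
  have "(\<lambda>x vs. \<Sum>i\<in>I. \<alpha> i x vs) \<in> forms"
    using insert.prems by (auto intro!: form_sum)
  then have "ext_part k (\<lambda>x vs. \<alpha> i x vs + (\<Sum>i\<in>I. \<alpha> i x vs)) =
      ext_part k (\<alpha> i) \<oplus> ext_part k (\<lambda>x vs. \<Sum>i\<in>I. \<alpha> i x vs)"
    by (intro ext_part_add) (use insert.prems in auto)
  then show ?case using insert by (simp add: B.M.finsum_insert Pi_def)
qed

lemma ext_part_Suc_scaled:
  assumes "\<alpha> \<in> forms"
  shows "const_fun (real (Suc k)) \<odot> ext_part (Suc k) \<alpha> =
    (\<Oplus>i\<in>UNIV. gen i \<otimes> ext_part k (contraction (e i) \<alpha>))" (is "_ = ?S")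
proof -
  have S: "?S \<in> carrier B" by (simp add: form_contraction assms Pi_def)
  have "real (Suc k) * (1 / real (Suc k)) = 1" by simp
  then show ?thesis
    using smult_const_mult[OF S, of "real (Suc k)" "1 / real (Suc k)"] smult_const_one[OF S]
    by (simp only: ext_part.simps)
qed

lemma gen_sum_add:
  assumes "\<And>i. X i \<in> carrier B" "\<And>i. Y i \<in> carrier B"
  shows "(\<Oplus>i\<in>UNIV. gen i \<otimes> X i) \<oplus> (\<Oplus>i\<in>UNIV. gen i \<otimes> Y i) =
    (\<Oplus>i\<in>UNIV. gen i \<otimes> (X i \<oplus> Y i))"
  using assms by (simp add: B.A.r_distr B.M.finsum_addf Pi_def)

lemma gen_sum_closed:
  "(\<And>i. X i \<in> carrier B) \<Longrightarrow> (\<Oplus>i\<in>UNIV. gen i \<otimes> X i) \<in> carrier B"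
  by (simp add: Pi_def)

lemma f_mult_expand:
  assumes \<theta>: "\<theta> \<in> oneforms" and z: "z \<in> carrier B"
  shows "f \<theta> \<otimes> z = (\<Oplus>i\<in>UNIV. gen i \<otimes> ((\<lambda>x. \<theta> x [e i x]) \<odot> z))"
proof -
  have c: "(\<lambda>x. \<theta> x [e i x]) \<in> carrier function_ring" for i
    using \<theta> by (intro oneform_component_in) simp
  have "f \<theta> \<otimes> z = (\<Oplus>i\<in>UNIV. ((\<lambda>x. \<theta> x [e i x]) \<odot> gen i) \<otimes> z)"
    unfolding f_expand[OF \<theta>] by (rule B.A.finsum_ldistr) (use c z in auto)
  then show ?thesis using c z by (simp add: B.smult_mult_left B.smult_mult_right)
qed

text \<open>This is the antiderivation rule for \<open>e\<^sub>i \<rfloor> (\<theta> \<and> \<alpha>)\<close>, transported to \<open>B\<close>; the difference in it is written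
  as a sum.\<close>
lemma ext_part_wedge:
  assumes \<theta>: "\<theta> \<in> oneforms" and \<alpha>: "\<alpha> \<in> forms"
  shows "const_fun (real (Suc m)) \<odot> ext_part (Suc m) (wedge \<theta> \<alpha>) \<oplus>
      (\<Oplus>i\<in>UNIV. gen i \<otimes> ext_part m (wedge \<theta> (contraction (e i) \<alpha>))) =
    f \<theta> \<otimes> ext_part m \<alpha>"
proof -
  have t: "\<theta> \<in> forms" and d: "\<And>x. of_degree 1 (\<theta> x)" using \<theta> by auto
  note w = form_wedge[OF t \<alpha>]
  have "(\<lambda>x vs. contraction (e i) (wedge \<theta> \<alpha>) x vs + wedge \<theta> (contraction (e i) \<alpha>) x vs) =
      (\<lambda>x vs. \<theta> x [e i x] * \<alpha> x vs)" for i
    by (simp add: contraction_eq wedge_eq_ext_prod contract_oneform_ext_prod[OF d])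
  then have i: "ext_part m (contraction (e i) (wedge \<theta> \<alpha>)) \<oplus> ext_part m (wedge \<theta> (contraction (e i) \<alpha>)) =
      (\<lambda>x. \<theta> x [e i x]) \<odot> ext_part m \<alpha>" for i
    using ext_part_add[OF form_contraction[OF w] form_wedge[OF t form_contraction[OF \<alpha>]], of m i i]
      ext_part_smult[OF oneform_component_in[OF t] \<alpha>, of m i] by simp
  show ?thesis
    unfolding ext_part_Suc_scaled[OF w] f_mult_expand[OF \<theta> ext_part_closed[OF \<alpha>]]
    by (subst gen_sum_add) (simp_all only: i ext_part_closed form_contraction form_wedge t \<alpha>)
qed

text \<open>The scalars \<open>g\<^sup>*(e\<^sup>i, \<theta>)\<close> are the components of the vector dual to \<open>\<theta>\<close>.\<close>
lemma contract_oneform_sum: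
  assumes \<theta>: "\<theta> \<in> oneforms" and \<alpha>: "\<alpha> \<in> forms"
  shows "(\<lambda>x vs. \<Sum>i\<in>UNIV. cometric_on A g U (coframe_section i) \<theta> x * contraction (e i) \<alpha> x vs) =
    contract_oneform \<theta> \<alpha>" (is "?L = ?R")
proof (rule forms_eqI)
  have t: "\<theta> \<in> forms" using \<theta> by simp
  show "?R \<in> forms" by (rule form_contract_oneform[OF t \<alpha>])
  show "?L \<in> forms"
    by (intro form_sum form_smult cometric_on_in coframe_in_oneforms \<theta> form_contraction \<alpha>)
  fix x vs assume x: "x \<in> U"
  have c: "cometric_on A g U (coframe_section i) \<theta> x = (\<Sum>j\<in>UNIV. ginv x j i * \<theta> x [e j x])" for i
  proof -
    have "cometric_on A g U (coframe_section i) \<theta> x =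
        (\<Sum>k\<in>UNIV. if i = k then \<Sum>j\<in>UNIV. ginv x k j * \<theta> x [e j x] else 0)"
      unfolding cometric_on_eq[OF coframe_in_oneforms \<theta> x]
      by (intro sum.cong refl) (auto simp: coframe_section_eq x coframe_frame)
    then show ?thesis using ginv_sym[OF x] by simp
  qed
  show "?L x vs = ?R x vs"
    unfolding c contract_oneform_def contract_form_def contraction_eq sum_distrib_right
    by (rule sum.swap)
qed

text \<open>Moving \<open>f \<theta>\<close> to the left of the generators by the anticommutation relation gives twice a contraction by
  the dual of \<open>\<theta>\<close> minus \<open>f \<theta>\<close> times the sum that defines \<open>ext_part (Suc k) \<alpha>\<close>.\<close>
lemma gen_f_sum:
  assumes \<theta>: "\<theta> \<in> oneforms" and \<alpha>: "\<alpha> \<in> forms"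
  shows "(\<Oplus>i\<in>UNIV. gen i \<otimes> (f \<theta> \<otimes> ext_part k (contraction (e i) \<alpha>))) \<oplus>
      const_fun (real (Suc k)) \<odot> (f \<theta> \<otimes> ext_part (Suc k) \<alpha>) =
    const_fun 2 \<odot> ext_part k (contract_oneform \<theta> \<alpha>)" (is "?Y \<oplus> ?a = _")
proof -
  let ?X = "\<lambda>i. ext_part k (contraction (e i) \<alpha>)"
  let ?b = "\<lambda>i. cometric_on A g U (coframe_section i) \<theta>"
  have X: "?X i \<in> carrier B" for i using \<alpha> by (simp add: form_contraction)
  note F = f_closed[OF \<theta>]
  have bc: "?b i \<in> carrier function_ring" for i by (rule cometric_on_in[OF coframe_in_oneforms \<theta>])
  have "?a = f \<theta> \<otimes> (const_fun (real (Suc k)) \<odot> ext_part (Suc k) \<alpha>)"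
    using F \<alpha> by (simp only: B.smult_mult_right const_fun_in ext_part_closed)
  also have "\<dots> = f \<theta> \<otimes> (\<Oplus>i\<in>UNIV. gen i \<otimes> ?X i)"
    by (simp only: ext_part_Suc_scaled[OF \<alpha>])
  also have "\<dots> = (\<Oplus>i\<in>UNIV. f \<theta> \<otimes> (gen i \<otimes> ?X i))"
    by (rule B.A.finsum_rdistr) (use F X in auto)
  finally have "?Y \<oplus> ?a =
      (\<Oplus>i\<in>UNIV. gen i \<otimes> (f \<theta> \<otimes> ?X i) \<oplus> f \<theta> \<otimes> (gen i \<otimes> ?X i))"
    using F X by (simp add: B.M.finsum_addf Pi_def)
  also have "(\<lambda>i. gen i \<otimes> (f \<theta> \<otimes> ?X i) \<oplus> f \<theta> \<otimes> (gen i \<otimes> ?X i)) =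
      (\<lambda>i. const_fun 2 \<odot> (?b i \<odot> ?X i))" (is "?l = ?r")
  proof
    fix i
    have "?l i = (gen i \<otimes> f \<theta> \<oplus> f \<theta> \<otimes> gen i) \<otimes> ?X i"
      using F X by (simp add: B.A.l_distr B.A.m_assoc)
    also have "\<dots> = const_fun 2 \<odot> (?b i \<odot> ?X i)"
      unfolding gen_def f_anticommutator[OF coframe_in_oneforms \<theta>]
      using X bc by (simp add: B.smult_mult_left const_fun_in)
    finally show "?l i = ?r i" .
  qed
  also have "(\<Oplus>i\<in>UNIV. const_fun 2 \<odot> (?b i \<odot> ?X i)) =
      const_fun 2 \<odot> (\<Oplus>i\<in>UNIV. ?b i \<odot> ?X i)"
    using X bc by (simp add: finsum_smult const_fun_in)
  also have "(\<Oplus>i\<in>UNIV. ?b i \<odot> ?X i) = ext_part k (contract_oneform \<theta> \<alpha>)"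
    unfolding contract_oneform_sum[OF \<theta> \<alpha>, symmetric]
    by (subst ext_part_sum)
       (simp_all add: form_smult bc form_contraction \<alpha> ext_part_smult)
  finally show ?thesis .
qed

text \<open>Contractions anticommute, so the first sum is the negative of the one that defines \<open>ext_part\<close> on the
  contraction of \<open>\<alpha>\<close>.\<close>
lemma gen_contract_sum:
  assumes \<theta>: "\<theta> \<in> oneforms" and \<alpha>: "\<alpha> \<in> forms"
  shows "(\<Oplus>i\<in>UNIV. gen i \<otimes> ext_part k (contract_oneform \<theta> (contraction (e i) \<alpha>))) \<oplus>
      const_fun (real (Suc k)) \<odot> ext_part (Suc k) (contract_oneform \<theta> \<alpha>) = \<zero>"
proof -
  have t: "\<theta> \<in> forms" using \<theta> by simp
  note c = form_contract_oneform[OF t \<alpha>]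
  have "contract_oneform \<theta> (contraction (e i) \<alpha>) x vs + contraction (e i) (contract_oneform \<theta> \<alpha>) x vs = 0"
    for i x vs
  proof (cases "x \<in> U")
    case True
    then show ?thesis
      by (simp add: contraction_eq contract_oneform_def contract_form_swap[OF form_in[OF \<alpha> True]])
  next
    case False
    then show ?thesis
      using form_outside[OF form_contract_oneform[OF t form_contraction[OF \<alpha>]] False]
        form_outside[OF form_contraction[OF c] False] by simp
  qed
  then have z: "ext_part k (contract_oneform \<theta> (contraction (e i) \<alpha>)) \<oplus>
      ext_part k (contraction (e i) (contract_oneform \<theta> \<alpha>)) = \<zero>" for i
    by (subst ext_part_add[symmetric])
       (simp_all add: form_contract_oneform form_contraction t \<alpha> ext_part_vanish)
  show ?thesis
    unfolding ext_part_Suc_scaled[OF c]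
    by (subst gen_sum_add)
       (simp_all only: z ext_part_closed form_contraction form_contract_oneform t \<alpha>
         B.A.r_null gen_closed B.M.finsum_zero)
qed

text \<open>The bookkeeping of the next lemma in the additive group of \<open>B\<close>, arranged so that no subtraction is
  needed.\<close>
lemma ext_part_cancel:
  assumes "P \<in> carrier B" "Z \<in> carrier B" "Q \<in> carrier B" "Y \<in> carrier B" "a \<in> carrier B"
    "a' \<in> carrier B" "G \<in> carrier B" "G' \<in> carrier B"
    and 1: "P \<oplus> Z = a" and 2: "Z \<oplus> Q = Y" and 3: "Y \<oplus> a' = G'" and 4: "Q \<oplus> G = \<zero>"
  shows "P \<oplus> (G \<oplus> G') = a \<oplus> a'"
proof -
  have "P \<oplus> (G \<oplus> G') = (P \<oplus> Z) \<oplus> (Q \<oplus> G) \<oplus> a'"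
    unfolding 3[symmetric] 2[symmetric] using assms(1-8) by (simp add: B.M.a_ac)
  then show ?thesis unfolding 1 4 using assms(1-8) by simp
qed

text \<open>The homogeneous form of the law \<open>F (\<theta> \<diamond> \<alpha>) = f \<theta> F \<alpha>\<close>.  The induction applies the law to the
  contractions \<open>e\<^sub>i \<rfloor> \<alpha>\<close>.  With \<open>W\<close> and \<open>C\<close> for the values at \<open>\<theta> \<and> \<alpha>\<close> and at the contraction
  of \<open>\<alpha>\<close> by the dual of \<open>\<theta>\<close>, and \<open>a\<close> for the right-hand side, the four auxiliary equations combine to
  \<open>(k + 2) W + (k + 2) C = (k + 2) a\<close>, and division by \<open>k + 2\<close> is possible
  because \<open>B\<close> is a module over smooth real functions.\<close>
lemma ext_part_oneform:
  assumes \<theta>: "\<theta> \<in> oneforms" and "\<alpha> \<in> forms"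
  shows "ext_part (Suc k) (wedge \<theta> \<alpha>) \<oplus>
      (case k of 0 \<Rightarrow> \<zero> | Suc j \<Rightarrow> ext_part j (contract_oneform \<theta> \<alpha>)) =
    f \<theta> \<otimes> ext_part k \<alpha>"
  using assms(2)
proof (induction k arbitrary: \<alpha>)
  have t: "\<theta> \<in> forms" and d: "\<And>x. of_degree 1 (\<theta> x)" using \<theta> by auto
  {
    case 0
    have "ext_part 0 (wedge \<theta> (contraction (e i) \<alpha>)) = \<zero>" for i
      by (rule ext_part_vanish) (use d in \<open>simp add: wedge_eq_ext_prod of_degree_def\<close>)
    then show ?case
      using ext_part_wedge[OF \<theta> 0, of 0] form_wedge[OF t 0] f_closed[OF \<theta>] 0
      by (simp add: smult_const_one del: ext_part.simps)
  next
    case (Suc k)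
    note \<alpha> = Suc.prems
    note c = form_contraction[OF \<alpha>]
    let ?tw = "\<lambda>\<beta>. case k of 0 \<Rightarrow> \<zero> | Suc j \<Rightarrow> ext_part j (contract_oneform \<theta> \<beta>)"
    have tw: "?tw \<beta> \<in> carrier B" if "\<beta> \<in> forms" for \<beta>
      using that t by (cases k) (simp_all add: form_contract_oneform)
    let ?P = "const_fun (real (Suc (Suc k))) \<odot> ext_part (Suc (Suc k)) (wedge \<theta> \<alpha>)"
    let ?Z = "\<Oplus>i\<in>UNIV. gen i \<otimes> ext_part (Suc k) (wedge \<theta> (contraction (e i) \<alpha>))"
    let ?Q = "\<Oplus>i\<in>UNIV. gen i \<otimes> ?tw (contraction (e i) \<alpha>)"
    let ?Y = "\<Oplus>i\<in>UNIV. gen i \<otimes> (f \<theta> \<otimes> ext_part k (contraction (e i) \<alpha>))"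
    let ?a = "f \<theta> \<otimes> ext_part (Suc k) \<alpha>"
    let ?G = "ext_part k (contract_oneform \<theta> \<alpha>)"
    note closed = ext_part_closed[OF form_wedge[OF t \<alpha>]] ext_part_closed[OF \<alpha>]
      ext_part_closed[OF form_wedge[OF t c]] ext_part_closed[OF c]
      ext_part_closed[OF form_contract_oneform[OF t \<alpha>]] f_closed[OF \<theta>] tw[OF c]
    have 1: "?P \<oplus> ?Z = ?a" by (rule ext_part_wedge[OF \<theta> \<alpha>])
    have 2: "?Z \<oplus> ?Q = ?Y"
      by (subst gen_sum_add) (simp_all only: Suc.IH[OF c] closed)
    have 3: "?Y \<oplus> const_fun (real (Suc k)) \<odot> ?a = const_fun 2 \<odot> ?G"
      by (rule gen_f_sum[OF \<theta> \<alpha>])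
    \<comment> \<open>For \<open>k = 0\<close> the forms \<open>e\<^sub>i \<rfloor> \<alpha>\<close> enter as functions, which have no further contraction,
      and the second summand has the factor 0.\<close>
    have 4: "?Q \<oplus> const_fun (real k) \<odot> ?G = \<zero>"
    proof (cases k)
      case 0
      then show ?thesis
        using closed(5)[of 0] by (simp add: smult_const_zero del: ext_part.simps)
    next
      case (Suc j)
      then show ?thesis using gen_contract_sum[OF \<theta> \<alpha>, of j] by (simp del: ext_part.simps)
    qed
    have "?P \<oplus> (const_fun (real k) \<odot> ?G \<oplus> const_fun 2 \<odot> ?G) =
        ?a \<oplus> const_fun (real (Suc k)) \<odot> ?a"
      by (rule ext_part_cancel[OF _ _ _ _ _ _ _ _ 1 2 3 4])
         (intro gen_sum_closed B.smult_closed B.A.m_closed const_fun_in closed)+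
    also have "const_fun (real k) \<odot> ?G \<oplus> const_fun 2 \<odot> ?G = const_fun (real (Suc (Suc k))) \<odot> ?G"
      using smult_const_add[of ?G "real k" 2] closed by (simp add: add.commute del: ext_part.simps)
    also have "?a \<oplus> const_fun (real (Suc k)) \<odot> ?a = const_fun (real (Suc (Suc k))) \<odot> ?a"
      using smult_const_add[of ?a 1 "real (Suc k)"] smult_const_one[of ?a] closed
      by (simp del: ext_part.simps)
    finally have "const_fun (real (Suc (Suc k))) \<odot> (ext_part (Suc (Suc k)) (wedge \<theta> \<alpha>) \<oplus> ?G) =
        const_fun (real (Suc (Suc k))) \<odot> ?a"
      using closed by (simp only: B.smult_r_distr const_fun_in)
    then have "ext_part (Suc (Suc k)) (wedge \<theta> \<alpha>) \<oplus> ?G = ?a"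
      by (rule smult_const_cancel[rotated -1]) (use closed in \<open>simp_all del: ext_part.simps of_nat_Suc\<close>)
    then show ?case by simp
  }
qed

definition extension :: "('m \<Rightarrow> 'm multiform) \<Rightarrow> 'd" where
  "extension \<alpha> = (\<Oplus>k\<in>{..CARD('n)}. ext_part k \<alpha>)"

lemma extension_closed: "\<alpha> \<in> forms \<Longrightarrow> extension \<alpha> \<in> carrier B"
  unfolding extension_def by simp

lemma extension_add:
  "\<alpha> \<in> forms \<Longrightarrow> \<beta> \<in> forms \<Longrightarrow> extension (\<lambda>x vs. \<alpha> x vs + \<beta> x vs) = extension \<alpha> \<oplus> extension \<beta>"
  unfolding extension_def by (simp add: ext_part_add B.M.finsum_addf Pi_def)

lemma extension_smult:
  "a \<in> carrier function_ring \<Longrightarrow> \<alpha> \<in> forms \<Longrightarrow> extension (\<lambda>x vs. a x * \<alpha> x vs) = a \<odot> extension \<alpha>"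
  unfolding extension_def by (simp add: ext_part_smult B.finsum_smult_ldistr Pi_def)

lemma ext_part_above_dimension:
  assumes "\<alpha> \<in> forms" "CARD('n) < k" shows "ext_part k \<alpha> = \<zero>"
proof (rule ext_part_vanish)
  fix x vs assume "length (vs :: 'm tvec list) = k"
  then show "\<alpha> x vs = 0"
    using ext_fibre_vanishes[OF _ form_in[OF assms(1)], of x] form_outside[OF assms(1), of x] assms(2)
    by (cases "x \<in> U") (auto simp: vanishes_from_def)
qed

lemma extension_bound:
  assumes "\<alpha> \<in> forms" shows "(\<Oplus>k\<in>{..CARD('n) + j}. ext_part k \<alpha>) = extension \<alpha>"
proof (induction j)
  case (Suc j)
  have "ext_part (Suc (CARD('n) + j)) \<alpha> = \<zero>" by (rule ext_part_above_dimension[OF assms]) simp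
  then show ?case using Suc extension_closed[OF assms] assms
    by (simp add: B.M.finsum_Suc Pi_def del: ext_part.simps)
qed (simp add: extension_def)

text \<open>The wedge part of \<open>\<theta> \<diamond> \<alpha>\<close> raises the degree by one and the contraction part lowers it by one, so
  the partial sums have to be compared with shifted bounds; above the dimension all summands
  vanish.\<close>
lemma extension_oneform_mult:
  assumes \<theta>: "\<theta> \<in> oneforms" and \<alpha>: "\<alpha> \<in> forms"
  shows "extension (graf_mult \<theta> \<alpha>) = f \<theta> \<otimes> extension \<alpha>"
proof -
  have t: "\<theta> \<in> forms" and d: "\<And>x. of_degree 1 (\<theta> x)" using \<theta> by auto
  note w = form_wedge[OF t \<alpha>] and c = form_contract_oneform[OF t \<alpha>] and F = f_closed[OF \<theta>]
  have e0: "ext_part 0 (wedge \<theta> \<alpha>) = \<zero>"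
    by (rule ext_part_vanish) (use d in \<open>simp add: wedge_eq_ext_prod of_degree_def\<close>)
  have e1: "ext_part (Suc 0) (wedge \<theta> \<alpha>) = f \<theta> \<otimes> ext_part 0 \<alpha>"
    using ext_part_oneform[OF \<theta> \<alpha>, of 0] w by (simp del: ext_part.simps)
  have e2: "f \<theta> \<otimes> ext_part (Suc k) \<alpha> =
      ext_part (Suc (Suc k)) (wedge \<theta> \<alpha>) \<oplus> ext_part k (contract_oneform \<theta> \<alpha>)" for k
    using ext_part_oneform[OF \<theta> \<alpha>, of "Suc k"] by (simp del: ext_part.simps)
  have "(\<Oplus>k\<in>{..Suc (Suc N)}. ext_part k (wedge \<theta> \<alpha>)) \<oplus>
      (\<Oplus>k\<in>{..N}. ext_part k (contract_oneform \<theta> \<alpha>)) =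
      f \<theta> \<otimes> (\<Oplus>k\<in>{..Suc N}. ext_part k \<alpha>)" for N
  proof (induction N)
    case 0
    show ?case using F \<alpha> w c
      by (simp add: B.M.finsum_Suc Pi_def B.A.r_distr e0 e1[symmetric] e2 B.M.a_ac del: ext_part.simps)
  next
    case (Suc N)
    let ?W = "\<Oplus>k\<in>{..Suc (Suc N)}. ext_part k (wedge \<theta> \<alpha>)"
    let ?C = "\<Oplus>k\<in>{..N}. ext_part k (contract_oneform \<theta> \<alpha>)"
    let ?S = "\<Oplus>k\<in>{..Suc N}. ext_part k \<alpha>"
    have cl: "?W \<in> carrier B" "?C \<in> carrier B" "?S \<in> carrier B" using w c \<alpha>
      by (auto intro!: B.M.finsum_closed simp del: ext_part.simps B.M.finsum_Suc)
    have "f \<theta> \<otimes> (\<Oplus>k\<in>{..Suc (Suc N)}. ext_part k \<alpha>) =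
        f \<theta> \<otimes> ext_part (Suc (Suc N)) \<alpha> \<oplus> f \<theta> \<otimes> ?S"
      using B.M.finsum_Suc[of "\<lambda>k. ext_part k \<alpha>" "Suc N"] \<alpha> F cl(3)
      by (simp add: B.A.r_distr Pi_def del: ext_part.simps)
    also have "\<dots> = (ext_part (Suc (Suc (Suc N))) (wedge \<theta> \<alpha>) \<oplus> ext_part (Suc N) (contract_oneform \<theta> \<alpha>)) \<oplus>
        (?W \<oplus> ?C)"
      by (simp only: e2 Suc.IH)
    also have "\<dots> = (ext_part (Suc (Suc (Suc N))) (wedge \<theta> \<alpha>) \<oplus> ?W) \<oplus>
        (ext_part (Suc N) (contract_oneform \<theta> \<alpha>) \<oplus> ?C)"
      using cl ext_part_closed[OF w] ext_part_closed[OF c] by (simp only: B.M.a_ac B.M.a_closed)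
    finally show ?case
      using B.M.finsum_Suc[of "\<lambda>k. ext_part k (wedge \<theta> \<alpha>)" "Suc (Suc N)"]
        B.M.finsum_Suc[of "\<lambda>k. ext_part k (contract_oneform \<theta> \<alpha>)" N] w c
      by (simp add: Pi_def del: ext_part.simps)
  qed
  from this[of "CARD('n)"]
  have "extension (wedge \<theta> \<alpha>) \<oplus> extension (contract_oneform \<theta> \<alpha>) = f \<theta> \<otimes> extension \<alpha>"
    using extension_bound[OF w, of 2] extension_bound[OF c, of 0] extension_bound[OF \<alpha>, of 1]
    by (simp add: numeral_2_eq_2)
  then show ?thesis
    by (simp only: graf_mult_oneform[OF \<theta> \<alpha>] extension_add[OF w c])
qed

lemma extension_one: "extension one_section = \<one>"
proof -
  have z: "ext_part (Suc k) one_section = \<zero>" for k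
    by (rule ext_part_vanish) (auto simp: one_section_def)
  have "(\<lambda>x. one_section x []) = const_fun 1" by (simp add: one_section_def const_fun_def)
  then have o: "ext_part 0 one_section = \<one>" by (simp add: smult_const_one)
  have "(\<Oplus>k\<in>{..N}. ext_part k one_section) = \<one>" for N
  proof (induction N)
    case 0
    then show ?case using form_one by (simp add: o Pi_def del: ext_part.simps)
  next
    case (Suc N)
    then show ?case using form_one by (simp add: z B.M.finsum_Suc Pi_def del: ext_part.simps)
  qed
  then show ?thesis by (simp add: extension_def)
qed

lemma extension_oneform:
  assumes "\<theta> \<in> oneforms" shows "extension \<theta> = f \<theta>"
proof -
  have "\<theta> \<in> forms" using assms by simp
  then have "extension \<theta> = extension (graf_mult \<theta> one_section)" by (simp add: graf_mult_one_right)
  also have "\<dots> = f \<theta>"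
    using assms f_closed[OF assms] by (simp add: extension_oneform_mult form_one extension_one)
  finally show ?thesis .
qed

lemma extension_mult:
  assumes "\<alpha> \<in> forms" "\<beta> \<in> forms"
  shows "extension (graf_mult \<alpha> \<beta>) = extension \<alpha> \<otimes> extension \<beta>"
proof -
  let ?S = "{\<alpha> \<in> forms. \<forall>\<beta>\<in>forms. extension (graf_mult \<alpha> \<beta>) = extension \<alpha> \<otimes> extension \<beta>}"
  have "\<alpha> \<in> ?S" using assms(1)
  proof (rule form_induct)
    show "one_section \<in> ?S"
      by (simp add: form_one extension_one graf_mult_one_left extension_closed)
  next
    fix \<alpha> \<beta> assume "\<alpha> \<in> ?S" "\<beta> \<in> ?S"
    then show "(\<lambda>x vs. \<alpha> x vs + \<beta> x vs) \<in> ?S"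
      by (simp add: form_add graf_mult_add_left extension_add form_graf_mult extension_closed B.A.l_distr)
  next
    fix a \<alpha> assume "a \<in> carrier function_ring" "\<alpha> \<in> ?S"
    then show "(\<lambda>x vs. a x * \<alpha> x vs) \<in> ?S"
      by (simp add: form_smult graf_mult_scale_left carrier_smooth extension_smult form_graf_mult
          extension_closed B.smult_mult_left)
  next
    fix \<theta> \<alpha> assume t: "\<theta> \<in> oneforms" and a: "\<alpha> \<in> ?S"
    have tf: "\<theta> \<in> forms" and af: "\<alpha> \<in> forms" using t a by auto
    have "extension (graf_mult (graf_mult \<theta> \<alpha>) \<beta>) = extension (graf_mult \<theta> \<alpha>) \<otimes> extension \<beta>"
      if b: "\<beta> \<in> forms" for \<beta>
      using a b f_closed[OF t] extension_closed[OF af] extension_closed[OF b]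
      by (simp add: graf_mult_assoc[OF tf af b] extension_oneform_mult[OF t] form_graf_mult B.A.m_assoc)
    then show "graf_mult \<theta> \<alpha> \<in> ?S" by (simp add: form_graf_mult tf af)
  qed
  then show ?thesis using assms(2) by blast
qed

lemma extension_is_hom: "extension \<in> algebra_homs function_ring form_algebra B"
  unfolding algebra_homs_def linear_maps_def
  by (auto intro!: ring_hom_memI
      simp: form_algebra_simps extension_closed extension_mult extension_add extension_one extension_smult)

lemma extension_unique:
  assumes F: "F \<in> algebra_homs function_ring form_algebra B"
    and ext: "\<And>\<theta>. \<theta> \<in> oneforms \<Longrightarrow> F \<theta> = f \<theta>" and "\<alpha> \<in> forms"
  shows "F \<alpha> = extension \<alpha>"
proof -
  have F1: "F one_section = \<one>"
    and Fm: "\<And>\<alpha> \<beta>. \<alpha> \<in> forms \<Longrightarrow> \<beta> \<in> forms \<Longrightarrow> F (graf_mult \<alpha> \<beta>) = F \<alpha> \<otimes> F \<beta>"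
    and Fa: "\<And>\<alpha> \<beta>. \<alpha> \<in> forms \<Longrightarrow> \<beta> \<in> forms \<Longrightarrow> F (\<lambda>x vs. \<alpha> x vs + \<beta> x vs) = F \<alpha> \<oplus> F \<beta>"
    and Fs: "\<And>a \<alpha>. a \<in> carrier function_ring \<Longrightarrow> \<alpha> \<in> forms \<Longrightarrow> F (\<lambda>x vs. a x * \<alpha> x vs) = a \<odot> F \<alpha>"
    using F unfolding algebra_homs_def linear_maps_def ring_hom_def
    by (simp_all add: form_algebra_simps)
  let ?S = "{\<alpha> \<in> forms. F \<alpha> = extension \<alpha>}"
  have "\<alpha> \<in> ?S" using assms(3)
  proof (rule form_induct)
    show "one_section \<in> ?S" by (simp add: form_one F1 extension_one)
    show "(\<lambda>x vs. \<alpha> x vs + \<beta> x vs) \<in> ?S" if "\<alpha> \<in> ?S" "\<beta> \<in> ?S" for \<alpha> \<beta>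
      using that by (simp add: form_add Fa extension_add)
    show "(\<lambda>x vs. a x * \<alpha> x vs) \<in> ?S" if "a \<in> carrier function_ring" "\<alpha> \<in> ?S" for a \<alpha>
      using that by (simp add: form_smult Fs extension_smult)
    show "graf_mult \<theta> \<alpha> \<in> ?S" if t: "\<theta> \<in> oneforms" and "\<alpha> \<in> ?S" for \<theta> \<alpha>
      using that ext[OF t] by (simp add: form_graf_mult Fm extension_oneform_mult)
  qed
  then show ?thesis by simp
qed

end

context framed_manifold
begin

lemma form_algebra_universal:
  fixes B :: "('m \<Rightarrow> real, 'd) module"
  assumes "assoc_algebra function_ring B"
    and "clifford_map function_ring oneform_module (cometric_on A g U) B f"
  shows "\<exists>F\<in>algebra_homs function_ring form_algebra B. (\<forall>v\<in>carrier oneform_module. F v = f v) \<and>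
    (\<forall>F'\<in>algebra_homs function_ring form_algebra B. (\<forall>v\<in>carrier oneform_module. F' v = f v) \<longrightarrow>
      (\<forall>x\<in>carrier form_algebra. F' x = F x))"
proof -
  interpret B: assoc_algebra function_ring B by (rule assms(1))
  interpret clifford_extension A g p q U e B f
    by unfold_locales (rule assms(2))
  show ?thesis
    using extension_is_hom extension_oneform extension_unique
    unfolding oneform_module_simps form_algebra_simps by blast
qed

end

theorem theorem3p4:
  fixes A :: "('m::t2_space, 'n::finite) chart set"
    and g :: "'m \<Rightarrow> 'm tvec \<Rightarrow> 'm tvec \<Rightarrow> real"
    and p q :: nat
    and U :: "'m set"
    and e :: "'n \<Rightarrow> 'm \<Rightarrow> 'm tvec"
  assumes "smooth_manifold A"
    and "pseudo_riemannian_metric A g p q"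
    and "open U"
    and "local_frame A U e"
  shows "clifford_algebra TYPE('d) (smooth_function_ring A U) (one_forms A g U e) (cometric_on A g U)
    (graf_algebra A g U e) (\<lambda>\<alpha>. \<alpha>)"
proof -
  interpret framed_manifold A g p q U e
    by unfold_locales (use assms in \<open>simp_all add: smooth_manifold_def\<close>)
  show ?thesis
  proof (intro clifford_algebra.intro clifford_algebra_axioms.intro)
    show "symmetric_bilinear_module function_ring oneform_module (cometric_on A g U)"
      by (rule oneform_symmetric_bilinear)
    show "assoc_algebra function_ring form_algebra" by (rule form_algebra_assoc_algebra)
    show "clifford_map function_ring oneform_module (cometric_on A g U) form_algebra (\<lambda>\<alpha>. \<alpha>)"
      by (rule inclusion_clifford_map)
  qed (rule oneforms_generate form_algebra_universal; assumption)+
qed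

end
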